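(* Let $K$ be a non-archimedean local field with residue characteristic $p\neq 3$, and let $E$ be an elliptic curve over $K$ with additive, potentially good reduction. Let $L=K(E[3])$ and $G=\mathrm{Gal}(L/K)$, and let $\Delta^{1/3},\zeta_3,K_1,s,t,\alpha,\beta$ be as defined in the context. (1) Suppose $\zeta_3\in K$ and $\Delta^{1/3}\in K$. (a) If $\alpha\in K$, then $G\simeq C_2$. (b) If $\alpha\notin K$ and $s,t\in K$, then $G\simeq C_4$. (c) If $K(s,t)\neq K$ and $\alpha\in K(s,t)$, then $G\simeq C_4$. (d) If $K(s,t)\neq K$ and $\alpha\notin K(s,t)$, then $G\simeq Q_8$. (2) Suppose $\zeta_3\in K$ and $\Delta^{1/3}\notin K$. (a) If $\alpha,\beta\in K_1$, then $G\simeq C_3$. (b) If $\alpha\in K_1$ and $\beta\notin K_1$, then $G\simeq C_6$. (c) If $K_1(s,t)\neq K_1$, then $G\simeq \mathrm{SL}_2(\mathbb{F}_3)$. (3) Suppose $\zeta_3\notin K$ and $\Delta^{1/3}\in K$. (a) If $\alpha\in K(\zeta_3)$, then $G\simeq C_2\times C_2$. (b) If $\alpha\notin K(\zeta_3)$, $s,t\in K(\zeta_3)$ and $K(s,t)\neq K$, then $G\simeq C_8$. (c) If $\alpha\notin K(\zeta_3)$ and $s,t\in K$, then $G\simeq D_8$. (d) If $K(\zeta_3,s,t)\neq K(\zeta_3)$ and $\alpha\in K(\zeta_3,s,t)$, then $G\simeq D_8$. (e) If $K(\zeta_3,s,t)\neq K(\zeta_3)$, then $\alpha\notin K(\zeta_3)$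 and $G\simeq \mathit{SD}_{16}$. (4) Suppose $\zeta_3\notin K$ and $\Delta^{1/3}\notin K$. (a) If $\alpha,\beta\in K_1(\zeta_3)$, then $G\simeq D_6$. (b) If $\alpha\in K_1(\zeta_3)$ and $\beta\notin K_1(\zeta_3)$, then $G\simeq D_{12}$. (c) If $K_1(\zeta_3,s,t)\neq K_1(\zeta_3)$, then $\alpha\notin K_1(\zeta_3)$ and $G\simeq \mathrm{GL}_2(\mathbb{F}_3)$.
   Context: Fix an algebraic closure $K^{\mathrm{ac}}$ of $K$. $E[3]$ is the kernel of multiplication by $3$ on $E(K^{\mathrm{ac}})$, and $K(E[3])\subset K^{\mathrm{ac}}$ is the extension of $K$ generated by the $x$ and $y$ coordinates of the (nontrivial) points of $E[3]$. Fix a minimal Weierstrass equation $y^2+a_1xy+a_3y=x^3+a_2x^2+a_4x+a_6$ of $E$ with coefficients in the ring of integers $\mathcal{O}_K$, and put $b_2=a_1^2+4a_2$, $b_4=a_1a_3+2a_4$, $b_6=a_3^2+4a_6$, $b_8=a_1^2a_6-a_1a_3a_4+4a_2a_6+a_2a_3^2-a_4^2$, $\Delta=-b_2^2b_8-8b_4^3-27b_6^2+9b_2b_4b_6$, and $g(x)=3x^4+b_2x^3+3b_4x^2+3b_6x+b_8$. The roots of $g$ are the $x$-coordinates of the nontrivial points of $E[3]$. Let $\alpha_1,\alpha_2,\alpha_3,\alpha_4\in K^{\mathrm{ac}}$ be the roots of $g$. The three cube roots of $\Delta$ are $b_4-3(\alpha_1\alpha_2+\alpha_3\alpha_4)$,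 $b_4-3(\alpha_1\alpha_3+\alpha_2\alpha_4)$, $b_4-3(\alpha_1\alpha_4+\alpha_2\alpha_3)$. Choose a cube root $\Delta^{1/3}\in K^{\mathrm{ac}}$ of $\Delta$ with $\Delta^{1/3}\in K$ whenever $\Delta\in(K^\times)^3$, and number the roots so that $\Delta^{1/3}=b_4-3(\alpha_1\alpha_2+\alpha_3\alpha_4)$. Put $K_1=K(\Delta^{1/3})$, $s=\alpha_1+\alpha_2$, $t=\alpha_1\alpha_2$, $\alpha=\alpha_1$; let $\beta\in K^{\mathrm{ac}}$ satisfy $\beta^2+a_1\alpha\beta+a_3\beta=\alpha^3+a_2\alpha^2+a_4\alpha+a_6$; let $\zeta_3\in K^{\mathrm{ac}}$ be a nontrivial third root of unity. Groups: $C_n$ is the cyclic group of order $n$, $D_{2n}$ the dihedral group of order $2n$, $\mathit{SD}_{2^n}$ the semidihedral group of order $2^n$, $Q_8$ the quaternion group. *)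

theory Defs
  imports
    "HOL-Analysis.Determinants"
    "HOL-Library.Numeral_Type"
    "HOL-Algebra.Algebra"
    "HOL-Algebra.Algebraic_Closure_Type"
begin

section \<open>Subfields of an ambient field\<close>

text \<open>
  All fields occurring below are subfields of one field, the type \<open>'a\<close>, which plays the role of
  the algebraic closure. It is turned into a HOL-Algebra ring by \<open>ring_of_type_algebra\<close>.
\<close>

abbreviation ambient :: "'a::field ring" where
  "ambient \<equiv> ring_of_type_algebra"

definition adjoin :: "'a::field set \<Rightarrow> 'a set \<Rightarrow> 'a set" where
  "adjoin K S = generate_field ambient (K \<union> S)"

text \<open>Elements are functions on \<open>L\<close>, extended by \<open>undefined\<close> outside \<open>L\<close>; the product is composition.\<close>

definition galois_group :: "'a::field set \<Rightarrow> 'a set \<Rightarrow> ('a \<Rightarrow> 'a) monoid" where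
  "galois_group K L = BijGroup L
     \<lparr>carrier := {\<sigma> \<in> Bij L.
        \<sigma> \<in> ring_hom (ambient\<lparr>carrier := L\<rparr>) (ambient\<lparr>carrier := L\<rparr>) \<and> (\<forall>x\<in>K. \<sigma> x = x)}\<rparr>"


section \<open>Local fields\<close>

text \<open>
  A normalised discrete valuation of the subfield \<open>K\<close>. Only the values of \<open>v\<close> on nonzero elements
  of \<open>K\<close> matter; \<open>v 0\<close> stands for infinity, so zero is treated separately throughout.
\<close>

definition discrete_valuation_on :: "'a::field set \<Rightarrow> ('a \<Rightarrow> int) \<Rightarrow> bool" where
  "discrete_valuation_on K v \<longleftrightarrow>
     (\<forall>x\<in>K - {0}. \<forall>y\<in>K - {0}. v (x * y) = v x + v y) \<and>
     (\<forall>x\<in>K - {0}. \<forall>y\<in>K - {0}. x + y \<noteq> 0 \<longrightarrow> min (v x) (v y) \<le> v (x + y)) \<and>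
     v ` (K - {0}) = UNIV"

definition valuation_ring :: "'a::field set \<Rightarrow> ('a \<Rightarrow> int) \<Rightarrow> 'a set" where
  "valuation_ring K v = {x \<in> K. x = 0 \<or> 0 \<le> v x}"

definition maximal_ideal :: "'a::field set \<Rightarrow> ('a \<Rightarrow> int) \<Rightarrow> 'a set" where
  "maximal_ideal K v = {x \<in> K. x = 0 \<or> 0 < v x}"

definition residue_field :: "'a::field set \<Rightarrow> ('a \<Rightarrow> int) \<Rightarrow> 'a set ring" where
  "residue_field K v = ambient\<lparr>carrier := valuation_ring K v\<rparr> Quot maximal_ideal K v"

text \<open>
  The least positive \<open>n\<close> with \<open>n \<cdot> 1 = 0\<close> in the residue field. It exists when the residue field is
  finite.
\<close>

definition residue_char :: "'a::field set \<Rightarrow> ('a \<Rightarrow> int) \<Rightarrow> nat" where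
  "residue_char K v = (LEAST n. 0 < n \<and> of_nat n \<in> maximal_ideal K v)"

definition valuation_complete :: "'a::field set \<Rightarrow> ('a \<Rightarrow> int) \<Rightarrow> bool" where
  "valuation_complete K v \<longleftrightarrow>
     (\<forall>f :: nat \<Rightarrow> _.
        (\<forall>n. f n \<in> K) \<and>
        (\<forall>N. \<exists>M. \<forall>m\<ge>M. \<forall>n\<ge>M. f m = f n \<or> N \<le> v (f m - f n)) \<longrightarrow>
        (\<exists>l\<in>K. \<forall>N. \<exists>M. \<forall>n\<ge>M. f n = l \<or> N \<le> v (f n - l)))"

definition nonarch_local_field :: "'a::field set \<Rightarrow> ('a \<Rightarrow> int) \<Rightarrow> bool" where
  "nonarch_local_field K v \<longleftrightarrow>
     subfield K ambient \<and> discrete_valuation_on K v \<and> valuation_complete K v \<and>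
     finite (carrier (residue_field K v))"


section \<open>Weierstrass equations\<close>

text \<open>The equation \<open>y\<^sup>2 + a1 x y + a3 y = x\<^sup>3 + a2 x\<^sup>2 + a4 x + a6\<close>.\<close>

datatype 'a weierstrass = Weierstrass (a1: 'a) (a2: 'a) (a3: 'a) (a4: 'a) (a6: 'a)

definition coeffs_in :: "'a set \<Rightarrow> 'a weierstrass \<Rightarrow> bool" where
  "coeffs_in S E \<longleftrightarrow> {a1 E, a2 E, a3 E, a4 E, a6 E} \<subseteq> S"

definition b2 :: "'a::field weierstrass \<Rightarrow> 'a" where
  "b2 E = (a1 E)^2 + 4 * a2 E"

definition b4 :: "'a::field weierstrass \<Rightarrow> 'a" where
  "b4 E = a1 E * a3 E + 2 * a4 E"

definition b6 :: "'a::field weierstrass \<Rightarrow> 'a" where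
  "b6 E = (a3 E)^2 + 4 * a6 E"

definition b8 :: "'a::field weierstrass \<Rightarrow> 'a" where
  "b8 E = (a1 E)^2 * a6 E - a1 E * a3 E * a4 E + 4 * a2 E * a6 E + a2 E * (a3 E)^2 - (a4 E)^2"

definition disc :: "'a::field weierstrass \<Rightarrow> 'a" where
  "disc E = - ((b2 E)^2 * b8 E) - 8 * (b4 E)^3 - 27 * (b6 E)^2 + 9 * b2 E * b4 E * b6 E"

definition elliptic_curve :: "'a::field set \<Rightarrow> 'a weierstrass \<Rightarrow> bool" where
  "elliptic_curve K E \<longleftrightarrow> coeffs_in K E \<and> disc E \<noteq> 0"

definition g_poly :: "'a::field weierstrass \<Rightarrow> 'a poly" where
  "g_poly E = [:b8 E, 3 * b6 E, 3 * b4 E, b2 E, 3:]"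

definition weq :: "'a::field weierstrass \<Rightarrow> 'a \<Rightarrow> 'a \<Rightarrow> 'a" where
  "weq E x y = (y^2 + a1 E * x * y + a3 E * y) - (x^3 + a2 E * x^2 + a4 E * x + a6 E)"

text \<open>
  The equation in \<open>x', y'\<close> obtained by \<open>x = u\<^sup>2 x' + r\<close>, \<open>y = u\<^sup>3 y' + s u\<^sup>2 x' + t\<close>
  and division by \<open>u\<^sup>6\<close>.
\<close>

definition change_vars :: "'a::field \<Rightarrow> 'a \<Rightarrow> 'a \<Rightarrow> 'a \<Rightarrow> 'a weierstrass \<Rightarrow> 'a weierstrass" where
  "change_vars u r s t E = Weierstrass
     ((a1 E + 2 * s) / u)
     ((a2 E - s * a1 E + 3 * r - s^2) / u^2)
     ((a3 E + r * a1 E + 2 * t) / u^3)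
     ((a4 E - s * a3 E + 2 * r * a2 E - (t + r * s) * a1 E + 3 * r^2 - 2 * s * t) / u^4)
     ((a6 E + r * a4 E + r^2 * a2 E + r^3 - t * a3 E - t^2 - r * t * a1 E) / u^6)"

definition weierstrass_models :: "'a::field set \<Rightarrow> 'a weierstrass \<Rightarrow> 'a weierstrass set" where
  "weierstrass_models K E = {change_vars u r s t E |u r s t. {u, r, s, t} \<subseteq> K \<and> u \<noteq> 0}"

definition minimal_weierstrass :: "'a::field set \<Rightarrow> ('a \<Rightarrow> int) \<Rightarrow> 'a weierstrass \<Rightarrow> bool" where
  "minimal_weierstrass K v E \<longleftrightarrow>
     coeffs_in (valuation_ring K v) E \<and>
     (\<forall>W \<in> weierstrass_models K E. coeffs_in (valuation_ring K v) W \<longrightarrow> v (disc E) \<le> v (disc W))"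


section \<open>Reduction types\<close>

text \<open>
  Points of the reduced curve are given by representatives in the valuation ring. The equation and
  both partial derivatives vanish at a singular point. Since the residue field is finite, hence
  perfect, a singular point of the reduced curve over the algebraic closure of the residue field is
  already rational over the residue field (it is unique, so Galois invariant). A singular curve
  therefore has a singular point in the sense of the next definition.
\<close>

definition singular_mod ::
    "'a::field set \<Rightarrow> ('a \<Rightarrow> int) \<Rightarrow> 'a weierstrass \<Rightarrow> 'a \<Rightarrow> 'a \<Rightarrow> bool" where
  "singular_mod K v E x y \<longleftrightarrow>
     x \<in> valuation_ring K v \<and> y \<in> valuation_ring K v \<and>
     weq E x y \<in> maximal_ideal K v \<and>
     a1 E * y - (3 * x^2 + 2 * a2 E * x + a4 E) \<in> maximal_ideal K v \<and>
     2 * y + a1 E * x + a3 E \<in> maximal_ideal K v"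

text \<open>
  At a singular point \<open>(x, y)\<close> the quadratic part of the equation in \<open>\<xi> = X - x\<close>, \<open>\<eta> = Y - y\<close> is
  \<open>\<eta>\<^sup>2 + a1 \<xi> \<eta> - (a2 + 3 x) \<xi>\<^sup>2\<close>. The point is a cusp if this is \<open>(\<eta> - c \<xi>)\<^sup>2\<close> for some \<open>c\<close>,
  that is, if there is only one tangent direction; \<open>c\<close> is again rational by perfectness.
\<close>

definition cusp_mod ::
    "'a::field set \<Rightarrow> ('a \<Rightarrow> int) \<Rightarrow> 'a weierstrass \<Rightarrow> 'a \<Rightarrow> 'a \<Rightarrow> bool" where
  "cusp_mod K v E x y \<longleftrightarrow> singular_mod K v E x y \<and>
     (\<exists>c \<in> valuation_ring K v.
        a1 E + 2 * c \<in> maximal_ideal K v \<and> a2 E + 3 * x + c^2 \<in> maximal_ideal K v)"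

definition good_reduction :: "'a::field set \<Rightarrow> ('a \<Rightarrow> int) \<Rightarrow> 'a weierstrass \<Rightarrow> bool" where
  "good_reduction K v E \<longleftrightarrow>
     (\<exists>W \<in> weierstrass_models K E. minimal_weierstrass K v W \<and> (\<nexists>x y. singular_mod K v W x y))"

definition additive_reduction :: "'a::field set \<Rightarrow> ('a \<Rightarrow> int) \<Rightarrow> 'a weierstrass \<Rightarrow> bool" where
  "additive_reduction K v E \<longleftrightarrow>
     (\<exists>W \<in> weierstrass_models K E. minimal_weierstrass K v W \<and> (\<exists>x y. cusp_mod K v W x y))"

text \<open>
  Good reduction over some finite extension \<open>K'\<close>, with respect to the normalised valuation \<open>v'\<close> of
  \<open>K'\<close> above \<open>v\<close> (ramification index \<open>e\<close>). For a local field \<open>K\<close> this \<open>v'\<close> is unique.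
\<close>

definition potentially_good_reduction ::
    "'a::field set \<Rightarrow> ('a \<Rightarrow> int) \<Rightarrow> 'a weierstrass \<Rightarrow> bool" where
  "potentially_good_reduction K v E \<longleftrightarrow>
     (\<exists>K' v' e. subfield K' ambient \<and> K \<subseteq> K' \<and> ring.finite_dimension ambient K K' \<and>
        discrete_valuation_on K' v' \<and> 0 < e \<and> (\<forall>x\<in>K - {0}. v' x = e * v x) \<and>
        good_reduction K' v' E)"


section \<open>The group law and torsion points\<close>

datatype 'a point = Infinity | Affine 'a 'a

definition curve_points :: "'a::field weierstrass \<Rightarrow> 'a point set" where
  "curve_points E = insert Infinity {Affine x y |x y. weq E x y = 0}"

fun point_add :: "'a::field weierstrass \<Rightarrow> 'a point \<Rightarrow> 'a point \<Rightarrow> 'a point" where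
  "point_add E Infinity Q = Q"
| "point_add E P Infinity = P"
| "point_add E (Affine x1 y1) (Affine x2 y2) =
     (if x1 = x2 \<and> y1 + y2 + a1 E * x2 + a3 E = 0 then Infinity
      else
        let l = (if x1 = x2
                 then (3 * x1^2 + 2 * a2 E * x1 + a4 E - a1 E * y1) / (2 * y1 + a1 E * x1 + a3 E)
                 else (y2 - y1) / (x2 - x1));
            x3 = l^2 + a1 E * l - a2 E - x1 - x2
        in Affine x3 (- (l * (x3 - x1) + y1) - a1 E * x3 - a3 E))"

definition point_mult :: "'a::field weierstrass \<Rightarrow> nat \<Rightarrow> 'a point \<Rightarrow> 'a point" where
  "point_mult E n P = (point_add E P ^^ n) Infinity"

definition torsion :: "'a::field weierstrass \<Rightarrow> nat \<Rightarrow> 'a point set" where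
  "torsion E n = {P \<in> curve_points E. point_mult E n P = Infinity}"

definition torsion_field :: "'a::field set \<Rightarrow> 'a weierstrass \<Rightarrow> nat \<Rightarrow> 'a set" where
  "torsion_field K E n = adjoin K (\<Union>{{x, y} |x y. Affine x y \<in> torsion E n})"


section \<open>Some finite groups\<close>

text \<open>
  The pair \<open>(a, i)\<close> is the element \<open>r\<^sup>a f\<^sup>i\<close> of the group generated by \<open>r\<close> and \<open>f\<close> with relations
  \<open>r\<^sup>n = f\<^sup>2 = 1\<close> and \<open>f r f = r\<^sup>k\<close>, where \<open>k\<^sup>2 \<equiv> 1\<close> modulo \<open>n\<close>.
\<close>

definition cyclic_by_2 :: "nat \<Rightarrow> int \<Rightarrow> (int \<times> nat) monoid" where
  "cyclic_by_2 n k =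
     \<lparr>carrier = {0..<int n} \<times> {0..<2},
      mult = (\<lambda>(a, i) (b, j). ((a + k ^ i * b) mod int n, (i + j) mod 2)),
      one = (0, 0)\<rparr>"

text \<open>The argument is half the order: \<open>D\<^sub>8\<close> is \<open>dihedral_group 4\<close>.\<close>

definition dihedral_group :: "nat \<Rightarrow> (int \<times> nat) monoid" where
  "dihedral_group n = cyclic_by_2 n (-1)"

text \<open>The semidihedral group of order \<open>2\<^sup>m\<close>, for \<open>m \<ge> 4\<close>.\<close>

definition semidihedral_group :: "nat \<Rightarrow> (int \<times> nat) monoid" where
  "semidihedral_group m = cyclic_by_2 (2 ^ (m - 1)) (2 ^ (m - 2) - 1)"

text \<open>\<open>\<plusminus>1, \<plusminus>i, \<plusminus>j, \<plusminus>k\<close> with Hamilton's product, in coordinates with respect to \<open>1, i, j, k\<close>.\<close>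

definition quaternion_group :: "(int \<times> int \<times> int \<times> int) monoid" where
  "quaternion_group =
     \<lparr>carrier = {(1,0,0,0), (-1,0,0,0), (0,1,0,0), (0,-1,0,0),
                 (0,0,1,0), (0,0,-1,0), (0,0,0,1), (0,0,0,-1)},
      mult = (\<lambda>(a, b, c, d) (a', b', c', d').
        (a * a' - b * b' - c * c' - d * d',
         a * b' + b * a' + c * d' - d * c',
         a * c' - b * d' + c * a' + d * b',
         a * d' + b * c' - c * b' + d * a')),
      one = (1,0,0,0)\<rparr>"

text \<open>The numeral type \<open>3\<close> is the ring of integers modulo 3, so it is the field with 3 elements.\<close>

definition GL2_F3 :: "(3^2^2) monoid" where
  "GL2_F3 = \<lparr>carrier = {A. invertible A}, mult = (**), one = mat 1\<rparr>"

definition SL2_F3 :: "(3^2^2) monoid" where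
  "SL2_F3 = \<lparr>carrier = {A. det A = 1}, mult = (**), one = mat 1\<rparr>"

end

theory Submission
  imports Defs
begin

text \<open>
  With respect to a basis \<open>P = (\<alpha>1, \<beta>)\<close>, \<open>Q = (\<alpha>2, _)\<close> of \<open>E[3]\<close>, the Galois group becomes a subgroup \<open>R\<close> of
  \<open>GL\<^sub>2(\<F>\<^sub>3)\<close>. The roots of \<open>g\<close> correspond to the four lines of \<open>\<F>\<^sub>3\<^sup>2\<close> and the cube roots of the discriminant
  to the three partitions of these lines into two pairs. Hence an automorphism fixes \<open>\<alpha>\<close>, \<open>\<beta>\<close> if its matrix
  fixes the first basis vector, \<open>\<alpha>\<close> if it fixes the first axis, \<open>s\<close> and \<open>t\<close> if it fixes the pair of axes,
  \<open>\<delta>\<close> if it fixes the partition into axes and diagonals, and \<open>\<zeta>3\<close> if its determinant is 1. The matrices that fix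
  both \<open>\<delta>\<close> and \<open>\<zeta>3\<close> form a quaternion group, so the Galois correspondence turns each hypothesis into a
  condition on \<open>R\<close> that determines its isomorphism type.

  The reduction type matters only when \<open>\<delta>\<close> is rational and \<open>\<alpha> \<in> K(\<zeta>3)\<close>, to exclude that \<open>R\<close> is too small.
  There it suffices that, for additive reduction, the \<open>x\<close>-coordinate of a rational point of order three is the
  only rational root of \<open>g\<close>.
\<close>

section \<open>Subfields and embeddings\<close>

text \<open>The residue characteristic may be 2, and so may the characteristic of \<open>K\<close>.
  Squares are therefore never completed; instead \<open>g\<close> is shown to have no root in common
  with the 2-division polynomial, because \<open>g' = 3 * psi2_sq\<close> and the roots of
  \<open>g\<close> are distinct. Their distinctness comes from the relation
  \<open>4 * b8 = b2 * b6 - b4^2\<close>, which makes any two resolvents satisfy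
  \<open>d^2 + d * d' + d'^2 = 0\<close>. Associativity of the group law is not established: the
  lines through triples of flexes determine the whole addition table of \<open>E[3]\<close>, and
  this table suffices to attach matrices to automorphisms. The determinant is linked to
  \<open>\<zeta>3\<close> without the Weil pairing, through the permutation of the three cube roots
  of the discriminant. Taking \<open>\<delta>\<close> rational whenever possible matters if neither
  \<open>\<zeta>3\<close> nor \<open>\<delta>\<close> is in \<open>K\<close>: otherwise another cube
  root could be rational, and \<open>R\<close> would contain no element of order three.\<close>

definition is_subfield :: "'a::field set \<Rightarrow> bool" where
  "is_subfield F \<longleftrightarrow> 0 \<in> F \<and> 1 \<in> F \<and> (\<forall>x\<in>F. \<forall>y\<in>F. x + y \<in> F) \<and> (\<forall>x\<in>F. \<forall>y\<in>F. x * y \<in> F) \<and>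
     (\<forall>x\<in>F. - x \<in> F) \<and> (\<forall>x\<in>F. inverse x \<in> F)"

lemma is_subfieldD:
  assumes "is_subfield F"
  shows "0 \<in> F" "1 \<in> F" "x \<in> F \<Longrightarrow> y \<in> F \<Longrightarrow> x + y \<in> F" "x \<in> F \<Longrightarrow> y \<in> F \<Longrightarrow> x * y \<in> F"
    "x \<in> F \<Longrightarrow> - x \<in> F" "x \<in> F \<Longrightarrow> inverse x \<in> F" "x \<in> F \<Longrightarrow> y \<in> F \<Longrightarrow> x - y \<in> F"
    "x \<in> F \<Longrightarrow> y \<in> F \<Longrightarrow> x / y \<in> F" "x \<in> F \<Longrightarrow> x ^ n \<in> F" "of_nat n \<in> F" "numeral k \<in> F"
proof -
  show *: "0 \<in> F" "1 \<in> F" "x \<in> F \<Longrightarrow> y \<in> F \<Longrightarrow> x + y \<in> F" "x \<in> F \<Longrightarrow> y \<in> F \<Longrightarrow> x * y \<in> F"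
    "x \<in> F \<Longrightarrow> - x \<in> F" "x \<in> F \<Longrightarrow> inverse x \<in> F" for x y
    using assms by (auto simp: is_subfield_def)
  show "x - y \<in> F" if "x \<in> F" "y \<in> F"
    using *(3)[of x "- y"] *(5) that by simp
  show "x / y \<in> F" if "x \<in> F" "y \<in> F"
    using *(4)[of x "inverse y"] *(6) that by (simp add: divide_inverse)
  show "x ^ n \<in> F" if "x \<in> F"
    by (induction n) (use that * in auto)
  have nat: "of_nat n \<in> F" for n
    by (induction n) (use * in auto)
  show "of_nat n \<in> F" by (rule nat)
  show "numeral k \<in> F"
    using nat[of "numeral k"] by simp
qed

lemma is_subfield_sum:
  assumes "is_subfield F" "\<And>i. i \<in> I \<Longrightarrow> f i \<in> F"
  shows "sum f I \<in> F"
  using assms(2) by (induction I rule: infinite_finite_induct) (auto simp: is_subfieldD[OF assms(1)])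

lemma ambient_simps [simp]:
  "carrier ambient = UNIV" "x \<otimes>\<^bsub>ambient\<^esub> y = x * y" "x \<oplus>\<^bsub>ambient\<^esub> y = x + y"
  "\<one>\<^bsub>ambient\<^esub> = 1" "\<zero>\<^bsub>ambient\<^esub> = 0"
  by (simp_all add: ring_of_type_algebra_def)

lemma ambient_inverses:
  fixes x :: "'a::field"
  shows "\<ominus>\<^bsub>ambient\<^esub> x = - x" "x \<noteq> 0 \<Longrightarrow> inv\<^bsub>ambient\<^esub> x = inverse x"
proof -
  interpret field "ambient :: 'a ring" by (rule field_from_type_algebra)
  have "- x \<oplus>\<^bsub>ambient\<^esub> x = \<zero>\<^bsub>ambient\<^esub>" by simp
  from minus_equality[OF this] show "\<ominus>\<^bsub>ambient\<^esub> x = - x" by simp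
  assume "x \<noteq> 0"
  then have "inverse x \<otimes>\<^bsub>ambient\<^esub> x = \<one>\<^bsub>ambient\<^esub>" by simp
  from comm_inv_char[OF _ _ this] show "inv\<^bsub>ambient\<^esub> x = inverse x" 
    by (metis UNIV_I ambient_simps(1) comm_inv_char ambient_simps(2,4) right_inverse \<open>x \<noteq> 0\<close>)
qed

lemma is_subfield_if_subfield:
  fixes K :: "'a::field set"
  assumes "subfield K ambient"
  shows "is_subfield K"
proof -
  interpret field "ambient :: 'a ring" by (rule field_from_type_algebra)
  note R = subringE[OF subfieldE(1)[OF assms]]
  have "inverse x \<in> K" if "x \<in> K" for x
  proof (cases "x = 0")
    case False
    then show ?thesis
      using subfield_m_inv(1)[OF assms, of x] that by (simp add: ambient_inverses)
  qed (use that in simp)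
  then show ?thesis
    using R(2,3,5-7) by (auto simp: is_subfield_def ambient_inverses)
qed

lemma adjoin_is_subfield: "is_subfield (adjoin K S)" for K :: "'a::field set"
proof -
  interpret field "ambient :: 'a ring" by (rule field_from_type_algebra)
  show ?thesis
    unfolding adjoin_def by (rule is_subfield_if_subfield) (rule generate_field_is_subfield, simp)
qed

lemma adjoin_incl: "K \<union> S \<subseteq> adjoin K S" for K :: "'a::field set"
  by (auto simp: adjoin_def intro: generate_field.incl)

lemma adjoin_least:
  fixes K :: "'a::field set"
  assumes "is_subfield F" "K \<subseteq> F" "S \<subseteq> F"
  shows "adjoin K S \<subseteq> F"
proof
  fix x assume "x \<in> adjoin K S"
  then show "x \<in> F"
    unfolding adjoin_def
    by (induction rule: generate_field.induct)
      (use assms in \<open>auto simp: ambient_inverses is_subfieldD\<close>)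
qed

lemma adjoin_insert: "adjoin K (insert x S) = adjoin (adjoin K {x}) S" for K :: "'a::field set"
proof (rule antisym; rule adjoin_least)
  show "adjoin K {x} \<subseteq> adjoin K (insert x S)"
    by (rule adjoin_least) (use adjoin_incl[of K "insert x S"] adjoin_is_subfield in auto)
qed (use adjoin_incl[of K "insert x S"] adjoin_incl[of K "{x}"]
  adjoin_incl[of "adjoin K {x}" S] adjoin_is_subfield in auto)

lemma adjoin_empty: "is_subfield K \<Longrightarrow> adjoin K {} = K"
  using adjoin_incl[of K "{}"] adjoin_least[of K K "{}"] by auto

lemma adjoin_subset_eq: "is_subfield K \<Longrightarrow> adjoin K S = K \<longleftrightarrow> S \<subseteq> K"
  using adjoin_incl[of K S] adjoin_least[of K K S] by auto

text \<open>The values may lie outside \<open>F\<close>: an embedding is extended one generator at a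
  time, and only at the end is it known to map the splitting field to itself.\<close>

definition hom_on :: "'a::field set \<Rightarrow> ('a \<Rightarrow> 'a) \<Rightarrow> bool" where
  "hom_on F \<sigma> \<longleftrightarrow> \<sigma> 1 = 1 \<and> (\<forall>x\<in>F. \<forall>y\<in>F. \<sigma> (x + y) = \<sigma> x + \<sigma> y) \<and>
     (\<forall>x\<in>F. \<forall>y\<in>F. \<sigma> (x * y) = \<sigma> x * \<sigma> y)"

context
  fixes F :: "'a::field set" and \<sigma>
  assumes F: "is_subfield F" and hom: "hom_on F \<sigma>"
begin

lemma hom_onD:
  shows "\<sigma> 1 = 1" "x \<in> F \<Longrightarrow> y \<in> F \<Longrightarrow> \<sigma> (x + y) = \<sigma> x + \<sigma> y"
    "x \<in> F \<Longrightarrow> y \<in> F \<Longrightarrow> \<sigma> (x * y) = \<sigma> x * \<sigma> y" "\<sigma> 0 = 0" "x \<in> F \<Longrightarrow> \<sigma> (- x) = - \<sigma> x"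
    "x \<in> F \<Longrightarrow> y \<in> F \<Longrightarrow> \<sigma> (x - y) = \<sigma> x - \<sigma> y" "x \<in> F \<Longrightarrow> \<sigma> (inverse x) = inverse (\<sigma> x)"
    "x \<in> F \<Longrightarrow> y \<in> F \<Longrightarrow> \<sigma> (x / y) = \<sigma> x / \<sigma> y" "x \<in> F \<Longrightarrow> \<sigma> (x ^ n) = \<sigma> x ^ n"
    "\<sigma> (numeral k) = numeral k" "x \<in> F \<Longrightarrow> \<sigma> x = 0 \<longleftrightarrow> x = 0"
proof -
  note S = is_subfieldD[OF F]
  show *: "\<sigma> 1 = 1" "\<And>x y. x \<in> F \<Longrightarrow> y \<in> F \<Longrightarrow> \<sigma> (x + y) = \<sigma> x + \<sigma> y"
    "\<And>x y. x \<in> F \<Longrightarrow> y \<in> F \<Longrightarrow> \<sigma> (x * y) = \<sigma> x * \<sigma> y"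
    using hom by (auto simp: hom_on_def)
  show z: "\<sigma> 0 = 0"
    using *(2)[of 0 0] S(1) by (metis add_cancel_left_left add_0)
  show m: "\<And>x. x \<in> F \<Longrightarrow> \<sigma> (- x) = - \<sigma> x"
    using *(2)[of _ "- _"] S(5) z by (metis add.right_inverse add_eq_0_iff)
  show "\<sigma> (x - y) = \<sigma> x - \<sigma> y" if "x \<in> F" "y \<in> F" for x y
    using *(2)[of x "- y"] m[of y] S(5) that by simp
  have nz: "\<sigma> x \<noteq> 0" if "x \<in> F" "x \<noteq> 0" for x
    using *(3)[of x "inverse x"] that S(6) *(1) by auto
  show i: "\<sigma> (inverse x) = inverse (\<sigma> x)" if "x \<in> F" for x
  proof (cases "x = 0")
    case False
    then have "\<sigma> x * \<sigma> (inverse x) = 1"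
      using *(3)[of x "inverse x"] that S(6) *(1) by auto
    then show ?thesis by (metis inverse_unique)
  qed (simp add: z)
  show "\<sigma> (x / y) = \<sigma> x / \<sigma> y" if "x \<in> F" "y \<in> F" for x y
    using *(3)[of x "inverse y"] i[of y] S(6) that by (simp add: divide_inverse)
  show "\<sigma> (x ^ n) = \<sigma> x ^ n" if "x \<in> F" for x n
    by (induction n) (use * that S(9) in auto)
  have "\<sigma> (of_nat n) = of_nat n" for n
    by (induction n) (use * z S(2,10) in auto)
  from this[of "numeral k"] show "\<sigma> (numeral k) = numeral k" by simp
  show "\<sigma> x = 0 \<longleftrightarrow> x = 0" if "x \<in> F" for x
    using nz that z by auto
qed

lemma hom_on_inj: "inj_on \<sigma> F"
proof (rule inj_onI)
  fix x y assume "x \<in> F" "y \<in> F" "\<sigma> x = \<sigma> y"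
  then show "x = y"
    using hom_onD(6)[of x y] hom_onD(11)[of "x - y"] is_subfieldD(7)[OF F, of x y] by simp
qed

lemma hom_on_sum: "(\<And>i. i \<in> I \<Longrightarrow> f i \<in> F) \<Longrightarrow> \<sigma> (sum f I) = (\<Sum>i\<in>I. \<sigma> (f i))"
proof (induction I rule: infinite_finite_induct)
  case (insert i I)
  then show ?case
    using is_subfield_sum[OF F, of I f] by (simp add: hom_onD)
qed (simp_all add: hom_onD)

end

section \<open>Polynomials over a subfield\<close>

definition polys_over :: "'a::field set \<Rightarrow> 'a poly set" where
  "polys_over F = {p. \<forall>i. Polynomial.coeff p i \<in> F}"

context
  fixes F :: "'a::field set"
  assumes F: "is_subfield F"
begin

lemma polys_over_closed:
  shows "0 \<in> polys_over F" "1 \<in> polys_over F"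
    "p \<in> polys_over F \<Longrightarrow> q \<in> polys_over F \<Longrightarrow> p + q \<in> polys_over F"
    "p \<in> polys_over F \<Longrightarrow> q \<in> polys_over F \<Longrightarrow> p - q \<in> polys_over F"
    "p \<in> polys_over F \<Longrightarrow> - p \<in> polys_over F"
    "p \<in> polys_over F \<Longrightarrow> q \<in> polys_over F \<Longrightarrow> p * q \<in> polys_over F"
    "c \<in> F \<Longrightarrow> p \<in> polys_over F \<Longrightarrow> smult c p \<in> polys_over F"
    "c \<in> F \<Longrightarrow> Polynomial.monom c n \<in> polys_over F"
    "c \<in> F \<Longrightarrow> p \<in> polys_over F \<Longrightarrow> pCons c p \<in> polys_over F"
  using is_subfieldD[OF F]
  by (auto simp: polys_over_def Polynomial.coeff_mult coeff_pCons intro!: is_subfield_sum[OF F] split: nat.splits)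

lemma polys_over_poly:
  assumes "p \<in> polys_over F" "x \<in> F"
  shows "poly p x \<in> F"
  unfolding poly_altdef
  by (rule is_subfield_sum[OF F]) (use assms in \<open>auto simp: polys_over_def is_subfieldD[OF F]\<close>)

text \<open>Division in the type \<open>'a poly\<close> does not show that the coefficients stay in
  \<open>F\<close>, so long division is repeated inside \<open>polys_over F\<close>.\<close>

lemma polys_over_division:
  assumes "p \<in> polys_over F" "m \<in> polys_over F" "m \<noteq> 0"
  shows "\<exists>q\<in>polys_over F. \<exists>r\<in>polys_over F. p = q * m + r \<and>
    (r = 0 \<or> Polynomial.degree r < Polynomial.degree m)"
  using assms(1)
proof (induction "Polynomial.degree p" arbitrary: p rule: less_induct)
  case less
  show ?case
  proof (cases "p = 0 \<or> Polynomial.degree p < Polynomial.degree m")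
    case True
    then show ?thesis
      using less.prems polys_over_closed(1) by (intro bexI[of _ 0] bexI[of _ p]) auto
  next
    case False
    then have p0: "p \<noteq> 0" and le: "Polynomial.degree m \<le> Polynomial.degree p" by auto
    define c where "c = lead_coeff p / lead_coeff m"
    define t where "t = Polynomial.monom c (Polynomial.degree p - Polynomial.degree m)"
    have c: "c \<in> F" "c \<noteq> 0"
      using less.prems assms p0 is_subfieldD[OF F] by (auto simp: c_def polys_over_def)
    then have t: "t \<in> polys_over F" "t \<noteq> 0"
      by (auto simp: t_def polys_over_closed)
    define p' where "p' = p - t * m"
    have p': "p' \<in> polys_over F"
      using t less.prems assms by (auto simp: p'_def polys_over_closed)
    have degt: "Polynomial.degree t = Polynomial.degree p - Polynomial.degree m"
      unfolding t_def by (rule Polynomial.degree_monom_eq[OF c(2)])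
    then have deg: "Polynomial.degree (t * m) = Polynomial.degree p"
      unfolding Polynomial.degree_mult_eq[OF t(2) assms(3)]
      using le by simp
    have lc: "lead_coeff (t * m) = lead_coeff p"
    proof -
      have "lead_coeff t = c"
        unfolding degt by (simp add: t_def)
      then show ?thesis
        using assms(3) by (simp add: Polynomial.lead_coeff_mult c_def)
    qed
    show ?thesis
    proof (cases "p' = 0")
      case True
      then show ?thesis
        using t polys_over_closed(1) by (intro bexI[of _ t] bexI[of _ 0]) (auto simp: p'_def)
    next
      case False
      have "Polynomial.degree p' \<le> Polynomial.degree p"
        unfolding p'_def by (rule Polynomial.degree_diff_le) (use deg in auto)
      moreover have "Polynomial.coeff p' (Polynomial.degree p) = 0"
        using lc deg by (simp add: p'_def)
      ultimately have "Polynomial.degree p' < Polynomial.degree p"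
        using False by (metis le_neq_implies_less leading_coeff_0_iff)
      from less.hyps[OF this p'] obtain q r where
        "q \<in> polys_over F" "r \<in> polys_over F" "p' = q * m + r"
        "r = 0 \<or> Polynomial.degree r < Polynomial.degree m" by blast
      then show ?thesis
        using t by (intro bexI[of _ "q + t"] bexI[of _ r])
          (auto simp: p'_def algebra_simps polys_over_closed)
    qed
  qed
qed

end

lemma polys_over_mono: "F \<subseteq> F' \<Longrightarrow> polys_over F \<subseteq> polys_over F'"
  by (auto simp: polys_over_def)

text \<open>Determined up to a scalar only, since the leading coefficient is left open.\<close>

definition min_poly :: "'a::field set \<Rightarrow> 'a \<Rightarrow> 'a poly \<Rightarrow> bool" where
  "min_poly F x m \<longleftrightarrow> m \<in> polys_over F \<and> m \<noteq> 0 \<and> poly m x = 0 \<and>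
     (\<forall>p\<in>polys_over F. p \<noteq> 0 \<longrightarrow> poly p x = 0 \<longrightarrow> Polynomial.degree m \<le> Polynomial.degree p)"

lemma min_poly_exists:
  assumes "p \<in> polys_over F" "p \<noteq> 0" "poly p x = 0"
  shows "\<exists>m. min_poly F x m"
proof -
  obtain m where m: "m \<in> polys_over F \<and> m \<noteq> 0 \<and> poly m x = 0"
    and least: "\<And>q. q \<in> polys_over F \<and> q \<noteq> 0 \<and> poly q x = 0 \<Longrightarrow> Polynomial.degree m \<le> Polynomial.degree q"
    using exists_least_lemma[of "\<lambda>n. \<exists>q. q \<in> polys_over F \<and> q \<noteq> 0 \<and> poly q x = 0 \<and> Polynomial.degree q = n"]
      ex_has_least_nat[of "\<lambda>q. q \<in> polys_over F \<and> q \<noteq> 0 \<and> poly q x = 0" p Polynomial.degree] assms by blast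
  then show ?thesis
    unfolding min_poly_def by blast
qed

lemma min_poly_dvd:
  assumes "is_subfield F" "min_poly F x m" "p \<in> polys_over F" "poly p x = 0"
  shows "\<exists>q\<in>polys_over F. p = q * m"
proof -
  have m: "m \<in> polys_over F" "m \<noteq> 0" "poly m x = 0" using assms(2) by (auto simp: min_poly_def)
  obtain q r where qr: "q \<in> polys_over F" "r \<in> polys_over F" "p = q * m + r"
    "r = 0 \<or> Polynomial.degree r < Polynomial.degree m"
    using polys_over_division[OF assms(1,3) m(1,2)] by blast
  have "poly r x = 0" using assms(4) m(3) qr(3) by simp
  then have "r = 0"
    using qr assms(2) unfolding min_poly_def by force
  then show ?thesis using qr by auto
qed

lemma min_poly_degree: "min_poly F x m \<Longrightarrow> 0 < Polynomial.degree m"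
  by (metis min_poly_def gr0I degree_eq_zeroE poly_pCons poly_0 mult_zero_right add_0_right pCons_eq_0_iff)

section \<open>Extending embeddings\<close>

lemma map_poly_hom_on:
  assumes F: "is_subfield F" and hom: "hom_on F \<sigma>" and p: "p \<in> polys_over F" and q: "q \<in> polys_over F"
  shows "map_poly \<sigma> (p + q) = map_poly \<sigma> p + map_poly \<sigma> q"
    "map_poly \<sigma> (p - q) = map_poly \<sigma> p - map_poly \<sigma> q"
    "map_poly \<sigma> (p * q) = map_poly \<sigma> p * map_poly \<sigma> q"
proof -
  note h = hom_onD[OF F hom]
  have c: "Polynomial.coeff p i \<in> F" "Polynomial.coeff q i \<in> F" for i
    using p q by (auto simp: polys_over_def)
  show "map_poly \<sigma> (p + q) = map_poly \<sigma> p + map_poly \<sigma> q"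
    "map_poly \<sigma> (p - q) = map_poly \<sigma> p - map_poly \<sigma> q"
    by (rule poly_eqI; simp add: coeff_map_poly h c)+
  show "map_poly \<sigma> (p * q) = map_poly \<sigma> p * map_poly \<sigma> q"
    by (rule poly_eqI)
      (simp add: coeff_map_poly h c Polynomial.coeff_mult hom_on_sum[OF F hom] is_subfieldD[OF F])
qed

lemma map_poly_nonzero:
  assumes F: "is_subfield F" and hom: "hom_on F \<sigma>" and p: "p \<in> polys_over F"
  shows "Polynomial.degree (map_poly \<sigma> p) = Polynomial.degree p"
proof (cases "p = 0")
  case False
  then have "\<sigma> (lead_coeff p) \<noteq> 0"
    using hom_onD(11)[OF F hom, of "lead_coeff p"] p by (auto simp: polys_over_def)
  then show ?thesis by (rule Polynomial.map_poly_degree_eq)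
qed simp

text \<open>The ring \<open>F[x]\<close> is already a field because Euclid's algorithm inverts
  \<open>q(x)\<close>: from \<open>m = a * q + r\<close> follows
  \<open>1 / q(x) = - a(x) / r(x)\<close>, and \<open>r\<close> has smaller degree than
  \<open>q\<close>.\<close>

lemma adjoin_single_eq:
  fixes F :: "'a::field set"
  assumes F: "is_subfield F" and m: "min_poly F x m"
  shows "adjoin F {x} = (\<lambda>p. poly p x) ` polys_over F" (is "_ = ?R")
proof (rule antisym)
  show "?R \<subseteq> adjoin F {x}"
  proof
    fix z assume "z \<in> ?R"
    then obtain p where "z = poly p x" "p \<in> polys_over F" by blast
    then show "z \<in> adjoin F {x}"
      using polys_over_poly[OF adjoin_is_subfield, of p F "{x}" x] polys_over_mono[of F "adjoin F {x}"]
        adjoin_incl[of F "{x}"] by auto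
  qed
  note c = polys_over_closed[OF F]
  have mm: "m \<in> polys_over F" "m \<noteq> 0" "poly m x = 0" using m by (auto simp: min_poly_def)
  have inv: "inverse (poly q x) \<in> ?R"
    if "q \<in> polys_over F" "Polynomial.degree q < Polynomial.degree m" for q
    using that
  proof (induction "Polynomial.degree q" arbitrary: q rule: less_induct)
    case less
    show ?case
    proof (cases "poly q x = 0")
      case True
      then show ?thesis using c(1) by (auto intro!: image_eqI[of _ _ 0])
    next
      case nz: False
      then have q0: "q \<noteq> 0" by auto
      obtain a r where ar: "a \<in> polys_over F" "r \<in> polys_over F" "m = a * q + r"
        "r = 0 \<or> Polynomial.degree r < Polynomial.degree q"
        using polys_over_division[OF F mm(1) less.prems(1) q0] by blast
      have *: "poly a x * poly q x = - poly r x"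
        using mm(3) ar(3) by (simp add: add_eq_0_iff2)
      show ?thesis
      proof (cases "r = 0")
        \<comment> \<open>Here \<open>a(x) = 0\<close>, so by minimality \<open>a\<close> has at
          least the degree of \<open>m\<close>, which forces \<open>q\<close> to be
          constant.\<close>
        case True
        then have "poly a x = 0" and "a \<noteq> 0" using * nz ar mm by auto
        then have "Polynomial.degree m \<le> Polynomial.degree a"
          using m ar by (auto simp: min_poly_def)
        moreover have "Polynomial.degree m = Polynomial.degree a + Polynomial.degree q"
          using True ar \<open>a \<noteq> 0\<close> q0 by (simp add: Polynomial.degree_mult_eq)
        ultimately obtain k where k: "q = [:k:]"
          by (metis add_le_same_cancel1 degree_eq_zeroE le_zero_eq)
        then have "k \<in> F"
          using less.prems by (auto simp: polys_over_def dest: spec[of _ 0])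
        then have "[:inverse k:] \<in> polys_over F"
          using c(9)[OF _ c(1)] is_subfieldD(6)[OF F] by simp
        then show ?thesis
          by (rule image_eqI[rotated]) (simp add: k)
      next
        case False
        then have lt: "Polynomial.degree r < Polynomial.degree q" using ar by auto
        then have nz_r: "poly r x \<noteq> 0"
          using less.prems(2) m ar(2) False unfolding min_poly_def by (meson less_trans not_le)
        obtain b where b: "b \<in> polys_over F" "inverse (poly r x) = poly b x"
          using less.hyps[OF lt ar(2)] lt less.prems(2) by auto
        have "inverse (poly q x) = poly (- (a * b)) x"
          using * nz nz_r by (simp add: b(2)[symmetric] field_simps)
        then show ?thesis
          using c(5)[OF c(6)[OF ar(1) b(1)]] by blast
      qed
    qed
  qed
  have "is_subfield ?R"
    unfolding is_subfield_def
  proof (intro conjI ballI)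
    show "0 \<in> ?R" by (rule image_eqI[OF _ c(1)]) simp
    show "1 \<in> ?R" by (rule image_eqI[OF _ c(2)]) simp
  next
    fix u w assume "u \<in> ?R" "w \<in> ?R"
    then obtain p q where pq: "p \<in> polys_over F" "q \<in> polys_over F" "u = poly p x" "w = poly q x" by blast
    show "u + w \<in> ?R"
      by (rule image_eqI[OF _ c(3)[OF pq(1,2)]]) (simp add: pq)
    show "u * w \<in> ?R"
      by (rule image_eqI[OF _ c(6)[OF pq(1,2)]]) (simp add: pq)
  next
    fix u assume "u \<in> ?R"
    then obtain p where p: "p \<in> polys_over F" "u = poly p x" by blast
    then show "- u \<in> ?R"
      using c by (auto intro!: image_eqI[of _ _ "- p"])
    obtain b q where q: "q \<in> polys_over F" "p = b * m + q"
      "q = 0 \<or> Polynomial.degree q < Polynomial.degree m"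
      using polys_over_division[OF F p(1) mm(1,2)] by blast
    then have "u = poly q x" "Polynomial.degree q < Polynomial.degree m"
      using p(2) mm(3) min_poly_degree[OF m] by auto
    then show "inverse u \<in> ?R" using inv[OF q(1)] by simp
  qed
  moreover have "F \<subseteq> ?R"
  proof
    fix u assume "u \<in> F"
    then have "[:u:] \<in> polys_over F" using c(9)[OF _ c(1)] by simp
    then show "u \<in> ?R" by (rule image_eqI[rotated]) simp
  qed
  moreover have "x \<in> ?R"
  proof -
    have "[:0, 1:] \<in> polys_over F" using c(9)[OF _ c(9)[OF _ c(1)]] is_subfieldD(1,2)[OF F] by simp
    then show "x \<in> ?R" by (rule image_eqI[rotated]) simp
  qed
  ultimately show "adjoin F {x} \<subseteq> ?R"
    by (intro adjoin_least) auto
qed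

text \<open>If \<open>p(x) = q(x)\<close>, then \<open>m\<close> divides \<open>p - q\<close> over
  \<open>F\<close>, and the image of \<open>m\<close> under \<open>\<sigma>\<close> vanishes at
  \<open>y\<close>; so the value at \<open>p(x)\<close> does not depend on the choice of
  \<open>p\<close>.\<close>

lemma hom_on_extend_simple:
  fixes F :: "'a::field set"
  assumes F: "is_subfield F" and hom: "hom_on F \<sigma>" and m: "min_poly F x m"
    and y: "poly (map_poly \<sigma> m) y = 0"
  shows "\<exists>\<tau>. hom_on (adjoin F {x}) \<tau> \<and> (\<forall>p\<in>polys_over F. \<tau> (poly p x) = poly (map_poly \<sigma> p) y)"
proof -
  note c = polys_over_closed[OF F] and h = map_poly_hom_on[OF F hom]
  have mm: "m \<in> polys_over F" using m by (auto simp: min_poly_def)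
  have wd: "poly (map_poly \<sigma> p) y = poly (map_poly \<sigma> q) y"
    if pq: "p \<in> polys_over F" "q \<in> polys_over F" "poly p x = poly q x" for p q
  proof -
    obtain a where "a \<in> polys_over F" "p - q = a * m"
      using min_poly_dvd[OF F m c(4)[OF pq(1,2)]] pq(3) by auto
    then have "map_poly \<sigma> p - map_poly \<sigma> q = map_poly \<sigma> a * map_poly \<sigma> m"
      using h that mm by metis
    then have "poly (map_poly \<sigma> p) y - poly (map_poly \<sigma> q) y = 0"
      using y by (metis poly_diff poly_mult mult_zero_right)
    then show ?thesis by simp
  qed
  define \<tau> where "\<tau> z = poly (map_poly \<sigma> (SOME p. p \<in> polys_over F \<and> poly p x = z)) y" for z
  have \<tau>: "\<tau> (poly p x) = poly (map_poly \<sigma> p) y" if "p \<in> polys_over F" for p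
    using someI[of "\<lambda>q. q \<in> polys_over F \<and> poly q x = poly p x" p] that
    unfolding \<tau>_def by (intro wd) auto
  have "hom_on (adjoin F {x}) \<tau>"
    unfolding hom_on_def adjoin_single_eq[OF F m]
  proof (intro conjI ballI)
    show "\<tau> 1 = 1"
      using \<tau>[OF c(2)] hom_onD(1)[OF F hom] by (simp add: map_poly_1)
  next
    fix u w assume "u \<in> (\<lambda>p. poly p x) ` polys_over F" "w \<in> (\<lambda>p. poly p x) ` polys_over F"
    then obtain p q where pq: "p \<in> polys_over F" "q \<in> polys_over F" and [simp]: "u = poly p x" "w = poly q x"
      by blast
    show "\<tau> (u + w) = \<tau> u + \<tau> w" "\<tau> (u * w) = \<tau> u * \<tau> w"
      using \<tau>[OF pq(1)] \<tau>[OF pq(2)] \<tau>[OF c(3)[OF pq]] \<tau>[OF c(6)[OF pq]] h[OF pq] by simp_all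
  qed
  then show ?thesis using \<tau> by blast
qed

lemma poly_map_const:
  assumes "\<sigma> 0 = 0"
  shows "poly (map_poly \<sigma> [:u:]) y = \<sigma> u"
  using assms by (simp add: map_poly_pCons)

lemma hom_on_extend_simple':
  fixes F :: "'a::field set"
  assumes F: "is_subfield F" and hom: "hom_on F \<sigma>" and m: "min_poly F x m"
    and y: "poly (map_poly \<sigma> m) y = 0"
  shows "\<exists>\<tau>. hom_on (adjoin F {x}) \<tau> \<and> (\<forall>u\<in>F. \<tau> u = \<sigma> u) \<and> \<tau> x = y"
proof -
  note c = polys_over_closed[OF F] and h = hom_onD[OF F hom]
  obtain \<tau> where \<tau>: "hom_on (adjoin F {x}) \<tau>" "\<And>p. p\<in>polys_over F \<Longrightarrow> \<tau> (poly p x) = poly (map_poly \<sigma> p) y"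
    using hom_on_extend_simple[OF assms] by blast
  have "\<tau> u = \<sigma> u" if "u \<in> F" for u
    using \<tau>(2)[OF c(9)[OF that c(1)]] h by (simp add: poly_map_const)
  moreover have "\<tau> x = y"
    using \<tau>(2)[OF c(9)[OF _ c(9)[OF _ c(1)], of 0 1]] h is_subfieldD(1,2)[OF F] by (simp add: map_poly_pCons)
  ultimately show ?thesis using \<tau>(1) by blast
qed

definition alg_closed_type :: "'a::field itself \<Rightarrow> bool" where
  "alg_closed_type _ \<longleftrightarrow> (\<forall>p :: 'a poly. 0 < Polynomial.degree p \<longrightarrow> (\<exists>x. poly p x = 0))"

definition separable_over :: "'a::field set \<Rightarrow> 'a \<Rightarrow> bool" where
  "separable_over F x \<longleftrightarrow> (\<exists>p\<in>polys_over F. p \<noteq> 0 \<and> poly p x = 0 \<and>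
     (\<forall>y. poly p y = 0 \<longrightarrow> poly (pderiv p) y \<noteq> 0))"

lemma separable_over_mono: "separable_over F x \<Longrightarrow> F \<subseteq> F' \<Longrightarrow> separable_over F' x"
  using polys_over_mono[of F F'] unfolding separable_over_def by blast

text \<open>Separability is asked of each element relative to its predecessors only: the \<open>y\<close>-coordinates of
  points of order three will be separable over the field generated by the \<open>x\<close>-coordinates.\<close>

fun separable_seq :: "'a::field set \<Rightarrow> 'a list \<Rightarrow> bool" where
  "separable_seq F [] \<longleftrightarrow> True"
| "separable_seq F (x # xs) \<longleftrightarrow> separable_over F x \<and> separable_seq (adjoin F {x}) xs"

lemma adjoin_mono: "F \<subseteq> F' \<Longrightarrow> S \<subseteq> S' \<Longrightarrow> adjoin F S \<subseteq> adjoin F' S'" for F :: "'a::field set"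
  using adjoin_least[OF adjoin_is_subfield, of F F' S' S] adjoin_incl[of F' S'] by auto

lemma separable_seq_mono: "separable_seq F xs \<Longrightarrow> F \<subseteq> F' \<Longrightarrow> separable_seq F' xs"
proof (induction xs arbitrary: F F')
  case (Cons x xs)
  then show ?case
    using adjoin_mono[of F F' "{x}" "{x}"] by (auto intro: separable_over_mono)
qed simp

lemma separable_seq_append:
  "separable_seq F xs \<Longrightarrow> is_subfield F \<Longrightarrow> separable_seq (adjoin F (set xs)) ys \<Longrightarrow> separable_seq F (xs @ ys)"
proof (induction xs arbitrary: F)
  case (Cons x xs)
  then show ?case
    using adjoin_insert[of F x "set xs"] adjoin_is_subfield[of F "{x}"] by simp
qed (simp add: adjoin_empty)

lemma separable_seqI: "(\<And>x. x \<in> set xs \<Longrightarrow> separable_over F x) \<Longrightarrow> separable_seq F xs" for F :: "'a::field set"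
proof (induction xs arbitrary: F)
  case (Cons x xs)
  then show ?case
    using separable_over_mono[of F _ "adjoin F {x}"] adjoin_incl[of F "{x}"] by auto
qed simp

text \<open>Each generator is sent to a root of its transported minimal polynomial; such a root
  exists because the ambient field is algebraically closed.\<close>

lemma hom_on_extend_seq:
  fixes F :: "'a::field set"
  assumes ac: "alg_closed_type TYPE('a)" and "is_subfield F" "hom_on F \<sigma>" "separable_seq F xs"
  shows "\<exists>\<tau>. hom_on (adjoin F (set xs)) \<tau> \<and> (\<forall>u\<in>F. \<tau> u = \<sigma> u)"
  using assms(2-)
proof (induction xs arbitrary: F \<sigma>)
  case Nil
  then show ?case by (auto simp: adjoin_empty)
next
  case insert: (Cons x xs)
  obtain m where m: "min_poly F x m"
    using insert.prems(3) min_poly_exists unfolding separable_seq.simps separable_over_def by blast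
  then have "0 < Polynomial.degree (map_poly \<sigma> m)"
    using map_poly_nonzero[OF insert.prems(1,2), of m] min_poly_degree[OF m] by (simp add: min_poly_def)
  then obtain y where "poly (map_poly \<sigma> m) y = 0"
    using ac by (auto simp: alg_closed_type_def)
  from hom_on_extend_simple'[OF insert.prems(1,2) m this] obtain \<tau> where
    \<tau>: "hom_on (adjoin F {x}) \<tau>" "\<forall>u\<in>F. \<tau> u = \<sigma> u" by blast
  obtain \<tau>' where \<tau>': "hom_on (adjoin (adjoin F {x}) (set xs)) \<tau>'" "\<forall>u\<in>adjoin F {x}. \<tau>' u = \<tau> u"
    using insert.IH[OF adjoin_is_subfield \<tau>(1)] insert.prems(3) by auto
  then show ?case
    unfolding list.set adjoin_insert[of F x "set xs"]
    using \<tau>(2) \<tau>' adjoin_incl[of F "{x}"] by (intro exI[of _ \<tau>']) auto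
qed

text \<open>Linear factors are split off one by one. A simple root of \<open>m\<close> is no root of
  the cofactor, so the roots of the cofactor stay roots of \<open>h\<close> after the same linear
  factor is removed from \<open>h\<close>.\<close>

lemma simple_roots_dvd:
  fixes m h :: "'a::field poly"
  assumes ac: "alg_closed_type TYPE('a)"
    and "m \<noteq> 0" "\<And>y. poly m y = 0 \<Longrightarrow> poly (pderiv m) y \<noteq> 0" "\<And>y. poly m y = 0 \<Longrightarrow> poly h y = 0"
  shows "m dvd h"
  using assms(2-)
proof (induction "Polynomial.degree m" arbitrary: m h)
  case 0
  then obtain k where "m = [:k:]" "k \<noteq> 0"
    by (metis degree_eq_zeroE pCons_0_0)
  then show ?case by (metis dvd_trans is_unit_const_poly_iff one_dvd dvd_field_iff)
next
  case (Suc n)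
  then obtain y where y: "poly m y = 0"
    using ac by (metis alg_closed_type_def zero_less_Suc)
  then obtain m1 where m1: "m = [:-y, 1:] * m1" by (metis poly_eq_0_iff_dvd dvdE)
  obtain h1 where h1: "h = [:-y, 1:] * h1" using Suc.prems(3)[OF y] by (metis poly_eq_0_iff_dvd dvdE)
  have d: "pderiv m = m1 + [:-y,1:] * pderiv m1"
    unfolding m1 pderiv_mult by (simp add: pderiv_pCons)
  have "m1 \<noteq> 0" using Suc.prems(1) m1 by auto
  then have deg: "n = Polynomial.degree m1"
    using Suc.hyps(2) unfolding m1 by (subst (asm) Polynomial.degree_mult_eq) auto
  have "m1 dvd h1"
  proof (rule Suc.hyps(1)[OF deg \<open>m1 \<noteq> 0\<close>])
    fix z assume z: "poly m1 z = 0"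
    then have mz: "poly m z = 0" by (simp add: m1)
    from Suc.prems(2)[OF this] show "poly (pderiv m1) z \<noteq> 0"
      unfolding d using z by auto
    have "z \<noteq> y"
      using Suc.prems(2)[OF y] z unfolding d by auto
    then show "poly h1 z = 0"
      using Suc.prems(3)[OF mz] by (simp add: h1)
  qed
  then show ?case unfolding m1 h1 by (rule mult_dvd_mono[OF dvd_refl])
qed

text \<open>Write \<open>z = q(x)\<close> with \<open>q\<close> of degree less than the minimal polynomial of \<open>x\<close>. Sending \<open>x\<close> to
  its conjugates shows that \<open>q - z\<close> has too many roots, so that \<open>q\<close> is constant.\<close>

lemma fixed_imp_mem:
  fixes F :: "'a::field set"
  assumes ac: "alg_closed_type TYPE('a)" and "is_subfield F" "separable_seq F xs" "z \<in> adjoin F (set xs)"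
    "\<And>\<tau>. hom_on (adjoin F (set xs)) \<tau> \<Longrightarrow> (\<And>u. u \<in> F \<Longrightarrow> \<tau> u = u) \<Longrightarrow> \<tau> z = z"
  shows "z \<in> F"
  using assms(2-)
proof (induction xs arbitrary: F)
  case Nil
  then show ?case by (auto simp: adjoin_empty)
next
  case insert: (Cons x xs)
  note F = insert.prems(1)
  have sub: "F \<subseteq> adjoin F {x}"
    using adjoin_incl[of F "{x}"] by simp
  note c = polys_over_closed[OF F]
  \<comment> \<open>Applied over \<open>F(x)\<close>, the induction hypothesis first moves
    \<open>z\<close> into \<open>F(x)\<close>, where it is a polynomial in \<open>x\<close>.\<close>
  have zx: "z \<in> adjoin F {x}"
  proof (rule insert.IH[OF adjoin_is_subfield])
    show "separable_seq (adjoin F {x}) xs"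
      using insert.prems(2) by simp
    show "z \<in> adjoin (adjoin F {x}) (set xs)"
      using insert.prems(3) by (simp add: adjoin_insert[of F x "set xs"])
    show "\<tau> z = z" if "hom_on (adjoin (adjoin F {x}) (set xs)) \<tau>" "\<And>u. u \<in> adjoin F {x} \<Longrightarrow> \<tau> u = u" for \<tau>
      using insert.prems(4)[of \<tau>] that sub by (auto simp: adjoin_insert[of F x "set xs"])
  qed
  obtain p where p: "p \<in> polys_over F" "p \<noteq> 0" "poly p x = 0"
    "\<And>y. poly p y = 0 \<Longrightarrow> poly (pderiv p) y \<noteq> 0"
    using insert.prems(2) by (auto simp: separable_over_def)
  obtain m where m: "min_poly F x m" using min_poly_exists[OF p(1-3)] by blast
  then have mm: "m \<in> polys_over F" "m \<noteq> 0" by (auto simp: min_poly_def)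
  obtain a where a: "p = a * m" using min_poly_dvd[OF F m p(1,3)] by blast
  have simple: "poly (pderiv m) y \<noteq> 0" if "poly m y = 0" for y
    using p(4)[of y] that by (auto simp: a pderiv_mult)
  obtain q0 where q0: "q0 \<in> polys_over F" "z = poly q0 x"
    using zx unfolding adjoin_single_eq[OF F m] by blast
  obtain b q where q: "b \<in> polys_over F" "q \<in> polys_over F" "q0 = b * m + q"
    "q = 0 \<or> Polynomial.degree q < Polynomial.degree m"
    using polys_over_division[OF F q0(1) mm] by blast
  have zq: "z = poly q x"
    using q0(2) m unfolding q(3) by (simp add: min_poly_def)
  have idF: "hom_on F (\<lambda>u. u)" by (auto simp: hom_on_def)
  have "m dvd q - [:z:]"
  proof (rule simple_roots_dvd[OF ac mm(2) simple])
    fix y assume y: "poly m y = 0"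
    then have "poly (map_poly (\<lambda>u. u) m) y = 0" by simp
    from hom_on_extend_simple[OF F idF m this] obtain \<tau> where
      \<tau>: "hom_on (adjoin F {x}) \<tau>" "\<And>p. p \<in> polys_over F \<Longrightarrow> \<tau> (poly p x) = poly p y" by auto
    have fixF: "\<tau> u = u" if "u \<in> F" for u
      using \<tau>(2)[OF c(9)[OF that c(1)]] by simp
    \<comment> \<open>The hypothesis on \<open>z\<close> speaks of embeddings of the whole field
      only, so the one that sends \<open>x\<close> to \<open>y\<close> has to be extended.\<close>
    obtain \<tau>' where \<tau>': "hom_on (adjoin (adjoin F {x}) (set xs)) \<tau>'" "\<forall>u\<in>adjoin F {x}. \<tau>' u = \<tau> u"
      using hom_on_extend_seq[OF ac adjoin_is_subfield \<tau>(1)] insert.prems(2) by auto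
    have "\<tau>' z = z"
    proof (rule insert.prems(4))
      show "hom_on (adjoin F (set (x # xs))) \<tau>'"
        using \<tau>'(1) by (simp add: adjoin_insert[of F x "set xs"])
    next
      fix u assume "u \<in> F"
      then show "\<tau>' u = u" using \<tau>'(2) fixF sub by auto
    qed
    then have "\<tau> z = z" using \<tau>'(2) zx by simp
    then show "poly (q - [:z:]) y = 0"
      using \<tau>(2)[OF q(2)] zq by simp
  qed
  moreover have "q - [:z:] = 0 \<or> Polynomial.degree (q - [:z:]) < Polynomial.degree m"
    using q(4) min_poly_degree[OF m] by (auto intro: Polynomial.degree_diff_less)
  ultimately have "q = [:z:]"
    by (metis dvd_imp_degree_le eq_iff_diff_eq_0 not_le)
  then have "Polynomial.coeff q 0 = z" by simp
  then show "z \<in> F" using q(2) by (auto simp: polys_over_def)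
qed

section \<open>Galois groups of splitting fields\<close>

lemma alg_closed_type_if_algebraic_closure:
  fixes K :: "'a::field set"
  assumes "algebraic_closure (ambient :: 'a ring) K"
  shows "alg_closed_type TYPE('a)"
  unfolding alg_closed_type_def
proof (intro allI impI)
  fix p :: "'a poly" assume deg0: "0 < Polynomial.degree p"
  interpret algebraic_closure "ambient :: 'a ring" K by fact
  \<comment> \<open>Polynomials in HOL-Algebra are lists that start with the leading coefficient,
    whereas \<open>coeffs\<close> starts with the constant one.\<close>
  define P where "P = rev (Polynomial.coeffs p)"
  have deg: "Polynomials.degree P = Polynomial.degree p"
    by (auto simp: P_def degree_eq_length_coeffs)
  have P: "P \<in> carrier (poly_ring (ambient :: 'a ring))"
    by (auto simp: univ_poly_def polynomial_def P_def hd_rev last_coeffs_eq_coeff_degree)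
  then have "splitted P" using roots_over_carrier by blast
  then have "roots P \<noteq> {#}" unfolding splitted_def using deg deg0 by auto
  then obtain x where "x \<in># roots P" by blast
  then have x: "is_root P x" using roots_mem_iff_is_root[OF P] by auto
  have pw: "x [^]\<^bsub>ambient\<^esub> n = x ^ n" for n :: nat
    by (induction n) (simp_all add: mult.commute)
  have "eval xs x = poly (Poly (rev xs)) x" for xs
    by (induction xs) (auto simp: Poly_append poly_monom pw algebra_simps)
  from this[of P] have "poly p x = 0"
    using x by (simp add: P_def is_root_def)
  then show "\<exists>x. poly p x = 0" ..
qed

lemma galois_groupD:
  assumes "\<sigma> \<in> carrier (galois_group K L)"
  shows "hom_on L \<sigma>" "x \<in> K \<Longrightarrow> \<sigma> x = x" "bij_betw \<sigma> L L" "\<sigma> \<in> extensional L" "\<sigma> \<in> Bij L"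
    "x \<in> L \<Longrightarrow> \<sigma> x \<in> L"
proof -
  show "hom_on L \<sigma>"
    using assms by (auto simp: galois_group_def BijGroup_def hom_on_def ring_hom_def)
  show "x \<in> K \<Longrightarrow> \<sigma> x = x" and *: "bij_betw \<sigma> L L" and "\<sigma> \<in> extensional L" "\<sigma> \<in> Bij L"
    using assms by (auto simp: galois_group_def BijGroup_def Bij_def)
  show "x \<in> L \<Longrightarrow> \<sigma> x \<in> L"
    using * by (meson bij_betwE)
qed

lemma galois_group_mult:
  assumes "\<sigma> \<in> carrier (galois_group K L)" "\<tau> \<in> carrier (galois_group K L)"
  shows "\<sigma> \<otimes>\<^bsub>galois_group K L\<^esub> \<tau> = compose L \<sigma> \<tau>"
  using galois_groupD(5)[OF assms(1)] galois_groupD(5)[OF assms(2)]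
  by (simp add: galois_group_def BijGroup_def)

lemma galois_group_closed:
  assumes "is_subfield L" "\<sigma> \<in> carrier (galois_group K L)" "\<tau> \<in> carrier (galois_group K L)" "K \<subseteq> L"
  shows "compose L \<sigma> \<tau> \<in> carrier (galois_group K L)"
proof -
  note s = galois_groupD[OF assms(2)] and t = galois_groupD[OF assms(3)]
  note S = hom_onD[OF assms(1) s(1)] and T = hom_onD[OF assms(1) t(1)] and L = is_subfieldD[OF assms(1)]
  show ?thesis
    using compose_Bij[OF s(5) t(5)] s(2,6) t(2,6) S(1-3) T(1-3) L(1-4) assms(4)
    by (auto simp: galois_group_def BijGroup_def ring_hom_def compose_def subset_iff)
qed

lemma galois_group_one: "is_subfield L \<Longrightarrow> K \<subseteq> L \<Longrightarrow> (\<lambda>x\<in>L. x) \<in> carrier (galois_group K L)"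
  using is_subfieldD(1-4)[of L] id_Bij[of L]
  by (auto simp: galois_group_def BijGroup_def ring_hom_def)

text \<open>Normality is expressed by \<open>stable\<close>: every embedding over \<open>K\<close>
  maps the finite list of generators to itself.\<close>

locale splitting_field =
  fixes K L :: "'a::field set" and xs
  assumes ac: "alg_closed_type TYPE('a)" and K: "is_subfield K" and L_def: "L = adjoin K (set xs)"
    and sep: "separable_seq K xs"
    and stable: "\<And>\<tau> x. hom_on L \<tau> \<Longrightarrow> (\<And>u. u \<in> K \<Longrightarrow> \<tau> u = u) \<Longrightarrow> x \<in> set xs \<Longrightarrow> \<tau> x \<in> set xs"
begin

lemma L: "is_subfield L" "K \<subseteq> L" "set xs \<subseteq> L"
  using adjoin_incl[of K "set xs"] by (auto simp: L_def adjoin_is_subfield)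

text \<open>The elements of \<open>L\<close> with image in \<open>L\<close> form a field that
  contains the generators, so \<open>L\<close> is mapped into itself. The generators are permuted,
  as an injective self-map of a finite set is surjective; hence the image is all of
  \<open>L\<close>. Restriction produces the value \<open>undefined\<close> outside \<open>L\<close>
  that \<open>galois_group\<close> prescribes.\<close>

lemma restrict_mem_galois_group:
  assumes hom: "hom_on L \<tau>" and fx: "\<And>u. u \<in> K \<Longrightarrow> \<tau> u = u"
  shows "restrict \<tau> L \<in> carrier (galois_group K L)"
proof -
  note l = is_subfieldD[OF L(1)] and h = hom_onD[OF L(1) hom]
  have inj: "inj_on \<tau> L" by (rule hom_on_inj[OF L(1) hom])
  have preimage: "is_subfield {x \<in> L. \<tau> x \<in> L}"
    using l(1-6) h(1-5,7) by (auto simp: is_subfield_def)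
  have "K \<subseteq> {x \<in> L. \<tau> x \<in> L}"
    using L(2) fx by auto
  moreover have "set xs \<subseteq> {x \<in> L. \<tau> x \<in> L}"
    using L(3) stable[OF hom fx] by auto
  ultimately have sub: "\<tau> ` L \<subseteq> L"
    using adjoin_least[OF preimage, of K "set xs"] unfolding L_def[symmetric] by blast
  have "\<tau> ` set xs = set xs"
    using inj_on_subset[OF inj L(3)] stable[OF hom fx]
    by (intro endo_inj_surj) auto
  moreover have "is_subfield (\<tau> ` L)"
    unfolding is_subfield_def
  proof (intro conjI ballI)
    show "0 \<in> \<tau> ` L" "1 \<in> \<tau> ` L"
      using l(1,2) h(1,4) by (metis image_eqI)+
    fix u assume "u \<in> \<tau> ` L"
    then obtain x where x: "x \<in> L" "u = \<tau> x" by blast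
    show "- u \<in> \<tau> ` L" "inverse u \<in> \<tau> ` L"
      using l(5,6)[OF x(1)] h(5,7)[OF x(1)] x(2) by (metis image_eqI)+
    fix w assume "w \<in> \<tau> ` L"
    then obtain y where y: "y \<in> L" "w = \<tau> y" by blast
    show "u + w \<in> \<tau> ` L" "u * w \<in> \<tau> ` L"
      using l(3,4)[OF x(1) y(1)] h(2,3)[OF x(1) y(1)] x(2) y(2) by (metis image_eqI)+
  qed
  moreover have "K \<subseteq> \<tau> ` L"
    using fx L(2) by (metis image_eqI subset_iff)
  ultimately have "L \<subseteq> \<tau> ` L"
    using adjoin_least[of "\<tau> ` L" K "set xs"] image_mono[OF L(3), of \<tau>] unfolding L_def by auto
  then have "bij_betw \<tau> L L"
    using inj sub by (auto simp: bij_betw_def)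
  then have "restrict \<tau> L \<in> Bij L"
    by (simp add: Bij_def)
  then show ?thesis
    using l(1-4) h(1-3) sub fx L(2)
    by (auto simp: galois_group_def BijGroup_def ring_hom_def)
qed

text \<open>The Galois correspondence, element by element. For the direction from right to left,
  \<open>L\<close> is regarded as an extension of \<open>K(A)\<close> with the same generators,
  which inherit separability.\<close>

lemma mem_adjoin_iff:
  assumes "A \<subseteq> L" "z \<in> L"
  shows "z \<in> adjoin K A \<longleftrightarrow> (\<forall>\<sigma>\<in>carrier (galois_group K L). (\<forall>a\<in>A. \<sigma> a = a) \<longrightarrow> \<sigma> z = z)"
proof
  assume z: "z \<in> adjoin K A"
  show "\<forall>\<sigma>\<in>carrier (galois_group K L). (\<forall>a\<in>A. \<sigma> a = a) \<longrightarrow> \<sigma> z = z"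
  proof (intro ballI impI)
    fix \<sigma> assume \<sigma>: "\<sigma> \<in> carrier (galois_group K L)" and A: "\<forall>a\<in>A. \<sigma> a = a"
    note s = galois_groupD[OF \<sigma>]
    have "is_subfield {x \<in> L. \<sigma> x = x}"
      using is_subfieldD(1-6)[OF L(1)] hom_onD(1-5,7)[OF L(1) s(1)] by (auto simp: is_subfield_def)
    from adjoin_least[OF this, of K A] show "\<sigma> z = z"
      using z A assms(1) L(2) s(2) by auto
  qed
next
  assume inv: "\<forall>\<sigma>\<in>carrier (galois_group K L). (\<forall>a\<in>A. \<sigma> a = a) \<longrightarrow> \<sigma> z = z"
  let ?F = "adjoin K A"
  have KF: "K \<subseteq> ?F" and AF: "A \<subseteq> ?F" using adjoin_incl[of K A] by auto
  have "?F \<subseteq> L" by (rule adjoin_least) (use L assms(1) in auto)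
  then have LF: "adjoin ?F (set xs) = L"
    using adjoin_least[of L ?F "set xs"] adjoin_least[of "adjoin ?F (set xs)" K "set xs"] adjoin_incl[of ?F "set xs"] KF L
    by (auto simp: adjoin_is_subfield L_def)
  show "z \<in> ?F"
  proof (rule fixed_imp_mem[OF ac adjoin_is_subfield])
    show "separable_seq ?F xs"
      using separable_seq_mono[OF sep KF] .
    show "z \<in> adjoin ?F (set xs)" using assms(2) LF by simp
    fix \<tau> assume "hom_on (adjoin ?F (set xs)) \<tau>" and fx: "\<And>u. u \<in> ?F \<Longrightarrow> \<tau> u = u"
    then have "restrict \<tau> L \<in> carrier (galois_group K L)"
      using KF by (intro restrict_mem_galois_group) (auto simp: LF)
    moreover have "\<forall>a\<in>A. restrict \<tau> L a = a"
      using fx AF assms(1) by auto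
    ultimately show "\<tau> z = z"
      using inv assms(2) by (metis restrict_apply')
  qed
qed

lemma mem_base_iff:
  assumes "z \<in> L"
  shows "z \<in> K \<longleftrightarrow> (\<forall>\<sigma>\<in>carrier (galois_group K L). \<sigma> z = z)"
  using mem_adjoin_iff[OF _ assms, of "{}"] by (simp add: adjoin_empty[OF K])

end

section \<open>Changes of variables and the 3-division polynomial\<close>

lemmas b_defs = b2_def b4_def b6_def b8_def

lemma change_vars_coeffs:
  assumes "u \<noteq> 0" and W: "W = change_vars u r s t E"
  shows "a1 E = u * a1 W - 2 * s" "a2 E = u^2 * a2 W + s * a1 E - 3 * r + s^2"
    "a3 E = u^3 * a3 W - r * a1 E - 2 * t"
    "a4 E = u^4 * a4 W + s * a3 E - 2 * r * a2 E + (t + r * s) * a1 E - 3 * r^2 + 2 * s * t"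
    "a6 E = u^6 * a6 W - r * a4 E - r^2 * a2 E - r^3 + t * a3 E + t^2 + r * t * a1 E"
  using assms(1) by (simp_all add: W change_vars_def)

lemma change_vars_weq:
  assumes "u \<noteq> 0"
  shows "weq E (u^2 * x + r) (u^3 * y + s * u^2 * x + t) = u^6 * weq (change_vars u r s t E) x y"
  unfolding weq_def change_vars_coeffs[OF assms refl, of E r s t] by Groebner_Basis.algebra

lemma change_vars_b:
  assumes "u \<noteq> 0" and W: "W = change_vars u r s t E"
  shows "b2 E = u^2 * b2 W - 12 * r" "b4 E = u^4 * b4 W - r * b2 E - 6 * r^2"
    "b6 E = u^6 * b6 W - 2 * r * b4 E - r^2 * b2 E - 4 * r^3"
    "b8 E = u^8 * b8 W - 3 * r * b6 E - 3 * r^2 * b4 E - r^3 * b2 E - 3 * r^4"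
  unfolding b_defs change_vars_coeffs[OF assms] by Groebner_Basis.algebra+

lemma poly_g_poly: "poly (g_poly E) x = 3 * x^4 + b2 E * x^3 + 3 * b4 E * x^2 + 3 * b6 E * x + b8 E"
  by (simp add: g_poly_def algebra_simps eval_nat_numeral)

lemma change_vars_g_poly:
  assumes "u \<noteq> 0"
  shows "poly (g_poly E) (u^2 * x + r) = u^8 * poly (g_poly (change_vars u r s t E)) x"
  unfolding poly_g_poly change_vars_b[OF assms refl, of E r s t] by Groebner_Basis.algebra

lemma b_relation: "4 * b8 E = b2 E * b6 E - (b4 E)^2"
  unfolding b_defs by Groebner_Basis.algebra

lemma change_vars_disc:
  assumes "u \<noteq> 0"
  shows "disc E = u^12 * disc (change_vars u r s t E)"
proof -
  define W where "W = change_vars u r s t E"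
  \<comment> \<open>Treated as independent quantities, the \<open>b\<close>-invariants satisfy the
    transformation formula only up to this multiple of
    \<open>4 * b8 - (b2 * b6 - b4^2)\<close>.\<close>
  have "disc E = u^12 * disc W +
      (6 * u^2 * r * b2 W - 36 * r^2) * u^8 * (4 * b8 W - (b2 W * b6 W - (b4 W)^2))"
    unfolding disc_def change_vars_b[OF assms refl, of E r s t] W_def by Groebner_Basis.algebra
  then show ?thesis
    by (simp add: b_relation W_def)
qed

text \<open>The square of the 2-division polynomial \<open>2 * y + a1 * x + a3\<close>, reduced
  modulo the equation of the curve.\<close>

definition psi2_sq :: "'a::field weierstrass \<Rightarrow> 'a \<Rightarrow> 'a" where
  "psi2_sq E x = 4 * x^3 + b2 E * x^2 + 2 * b4 E * x + b6 E"

lemma psi2_sq: "(2 * y + a1 E * x + a3 E)^2 = psi2_sq E x + 4 * weq E x y"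
  unfolding psi2_sq_def b_defs weq_def by Groebner_Basis.algebra

lemma pderiv_g_poly: "poly (pderiv (g_poly E)) x = 3 * psi2_sq E x"
  unfolding g_poly_def psi2_sq_def by (simp add: pderiv_pCons algebra_simps power2_eq_square power3_eq_cube)

text \<open>Divided by \<open>Y^2\<close> at a point of the curve, this says that the third
  intersection of the tangent with the curve has an \<open>x\<close>-coordinate differing from
  \<open>x\<close> by \<open>- g(x) / Y^2\<close>. So the roots of \<open>g\<close> belong to points
  of triple contact.\<close>

lemma tangent_identity:
  fixes E :: "'a::field weierstrass" and x y :: 'a
  defines "N \<equiv> 3 * x^2 + 2 * a2 E * x + a4 E - a1 E * y" and "Y \<equiv> 2 * y + a1 E * x + a3 E"
  shows "N^2 + a1 E * N * Y - (a2 E + 3 * x) * Y^2 = - poly (g_poly E) x - (b2 E + 12 * x) * weq E x y"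
  unfolding N_def Y_def poly_g_poly b_defs weq_def by Groebner_Basis.algebra

text \<open>The affine points of order three, described without the group law;
  \<open>torsion_3\<close> identifies the two descriptions.\<close>

definition flexes :: "'a::field weierstrass \<Rightarrow> ('a \<times> 'a) set" where
  "flexes E = {(x, y). weq E x y = 0 \<and> poly (g_poly E) x = 0}"

text \<open>No point is both a flex and of order two. This makes the tangent slope at a flex finite,
  and it makes both coordinates separable: it bounds \<open>g'\<close> away from 0 at the roots of
  \<open>g\<close>, and \<open>2 * y + a1 * x + a3\<close> is the derivative of the curve equation
  in \<open>y\<close>.\<close>

definition psi2_nonzero :: "'a::field weierstrass \<Rightarrow> bool" where
  "psi2_nonzero E \<longleftrightarrow> (\<forall>x. poly (g_poly E) x = 0 \<longrightarrow> psi2_sq E x \<noteq> 0)"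

lemma flex_slope:
  assumes "(x, y) \<in> flexes E" "2 * y + a1 E * x + a3 E \<noteq> 0"
  defines "l \<equiv> (3 * x^2 + 2 * a2 E * x + a4 E - a1 E * y) / (2 * y + a1 E * x + a3 E)"
  shows "l^2 + a1 E * l = a2 E + 3 * x"
proof -
  let ?N = "3 * x^2 + 2 * a2 E * x + a4 E - a1 E * y" and ?Y = "2 * y + a1 E * x + a3 E"
  have "?N^2 + a1 E * ?N * ?Y = (a2 E + 3 * x) * ?Y^2"
    using tangent_identity[where E=E and x=x and y=y] assms(1) by (simp add: flexes_def)
  then have "(?N^2 + a1 E * ?N * ?Y) / ?Y^2 = a2 E + 3 * x"
    using assms(2) by simp
  moreover have "(?N^2 + a1 E * ?N * ?Y) / ?Y^2 = l^2 + a1 E * l"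
    using assms(2) by (simp add: l_def add_divide_distrib power_divide power2_eq_square)
  ultimately show ?thesis by simp
qed

text \<open>Moving a flex to the origin and its tangent to the line \<open>y = 0\<close> gives Deuring's normal form
  \<open>y\<^sup>2 + a1 x y + a3 y = x\<^sup>3\<close>.\<close>

lemma flex_deuring:
  assumes "(x, y) \<in> flexes E" "2 * y + a1 E * x + a3 E \<noteq> 0"
  defines "l \<equiv> (3 * x^2 + 2 * a2 E * x + a4 E - a1 E * y) / (2 * y + a1 E * x + a3 E)"
  shows "change_vars 1 x l y E = Weierstrass (a1 E + 2 * l) 0 (2 * y + a1 E * x + a3 E) 0 0"
proof -
  have "l * (2 * y + a1 E * x + a3 E) = 3 * x^2 + 2 * a2 E * x + a4 E - a1 E * y"
    using assms(2) by (simp add: l_def)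
  moreover have "l^2 + a1 E * l = a2 E + 3 * x"
    using flex_slope[OF assms(1,2)] by (simp add: l_def)
  moreover have "weq E x y = 0" using assms(1) by (simp add: flexes_def)
  ultimately have "a2 E - l * a1 E + 3 * x - l^2 = 0"
    "a4 E - l * a3 E + 2 * x * a2 E - (y + x * l) * a1 E + 3 * x^2 - 2 * l * y = 0"
    "a6 E + x * a4 E + x^2 * a2 E + x^3 - y * a3 E - y^2 - x * y * a1 E = 0"
    unfolding weq_def by Groebner_Basis.algebra+
  then show ?thesis
    by (simp add: change_vars_def algebra_simps)
qed

lemma g_poly_deuring:
  "poly (g_poly (Weierstrass a 0 b 0 0)) x = x * (3 * x^3 + a^2 * x^2 + 3 * a * b * x + 3 * b^2)"
  unfolding poly_g_poly b_defs weierstrass.sel by (simp add: algebra_simps eval_nat_numeral)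

text \<open>The line \<open>y = m * x\<close> through the origin meets the curve again at the
  abscissas \<open>x\<close> and \<open>z\<close>, whence \<open>z * x = - b * m\<close>. This
  substitution turns the cubic at \<open>z\<close>, up to powers of \<open>x\<close> and
  \<open>b\<close>, into \<open>m^2\<close> times the cubic at \<open>x\<close>.\<close>

lemma deuring_third:
  fixes a b x y :: "'a::field"
  assumes "x \<noteq> 0" and curve: "y^2 + a * x * y + b * y = x^3"
    and flex: "3 * x^3 + a^2 * x^2 + 3 * a * b * x + 3 * b^2 = 0"
  defines "m \<equiv> y / x"
  defines "z \<equiv> m^2 + a * m - x"
  shows "3 * z^3 + a^2 * z^2 + 3 * a * b * z + 3 * b^2 = 0"
proof -
  have y: "y = m * x" using assms(1) by (simp add: m_def)
  have "x * (m^2 * x + a * m * x + b * m - x^2) = 0"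
    using curve unfolding y by Groebner_Basis.algebra
  then have 1: "m^2 * x + a * m * x + b * m = x^2" using assms(1) by simp
  then have zx: "z * x = - (b * m)" unfolding z_def by Groebner_Basis.algebra
  have "x^3 * (3 * z^3 + a^2 * z^2 + 3 * a * b * z + 3 * b^2) =
      b^2 * (- 3 * b * m^3 + a^2 * m^2 * x - 3 * a * m * x^2 + 3 * x^3)"
    using zx by Groebner_Basis.algebra
  also have "- 3 * b * m^3 + a^2 * m^2 * x - 3 * a * m * x^2 + 3 * x^3 = 0"
  proof -
    have "x * (- 3 * b * m^3 + a^2 * m^2 * x - 3 * a * m * x^2 + 3 * x^3) = 
      m^2 * (3 * x^3 + a^2 * x^2 + 3 * a * b * x + 3 * b^2)"
      using 1 by Groebner_Basis.algebra
    then show ?thesis using assms(1) flex by simp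
  qed
  finally show ?thesis using assms(1) by simp
qed

text \<open>By the choice of \<open>x3\<close> both sides have the same terms of degree three and
  two, so they differ by a linear polynomial \<open>d * x + c\<close>, which vanishes at
  \<open>x1\<close> and \<open>x2\<close>. The second claim is \<open>d = 0\<close>; it compares the
  slope of the secant with that of the tangent at \<open>x1\<close>.\<close>

lemma secant_identity:
  fixes E :: "'a::field weierstrass" and x x1 x2 y1 l :: 'a
  defines "x3 \<equiv> l^2 + a1 E * l - a2 E - x1 - x2"
  assumes "weq E x1 y1 = 0" "weq E x2 (l * (x2 - x1) + y1) = 0" "x1 \<noteq> x2"
  shows "weq E x (l * (x - x1) + y1) = - ((x - x1) * (x - x2) * (x - x3))"
    "l * (2 * y1 + a1 E * x1 + a3 E) = 3 * x1^2 + 2 * a2 E * x1 + a4 E - a1 E * y1 - (x1 - x2) * (x1 - x3)"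
proof -
  define c where "c = (y1 - l * x1)^2 + a3 E * (y1 - l * x1) - a6 E - x1 * x2 * x3"
  define d where "d = 2 * l * (y1 - l * x1) + a1 E * (y1 - l * x1) + a3 E * l - a4 E + (x1 * x2 + x1 * x3 + x2 * x3)"
  have *: "weq E x (l * (x - x1) + y1) = - ((x - x1) * (x - x2) * (x - x3)) + d * x + c" for x
    unfolding weq_def c_def d_def x3_def by Groebner_Basis.algebra
  have "d * x1 + c = 0" "d * x2 + c = 0"
    using *[of x1] *[of x2] assms by auto
  then have "d * (x1 - x2) = 0" by Groebner_Basis.algebra
  then have "d = 0" using assms by simp
  then have "c = 0" using \<open>d * x1 + c = 0\<close> by simp
  show "weq E x (l * (x - x1) + y1) = - ((x - x1) * (x - x2) * (x - x3))"
    using * \<open>c = 0\<close> \<open>d = 0\<close> by simp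
  show "l * (2 * y1 + a1 E * x1 + a3 E) = 3 * x1^2 + 2 * a2 E * x1 + a4 E - a1 E * y1 - (x1 - x2) * (x1 - x3)"
    using \<open>d = 0\<close> unfolding d_def x3_def by Groebner_Basis.algebra
qed


section \<open>Points of order three\<close>

definition neg :: "'a::field weierstrass \<Rightarrow> 'a \<times> 'a \<Rightarrow> 'a \<times> 'a" where
  "neg E = (\<lambda>(x, y). (x, - y - a1 E * x - a3 E))"

text \<open>The third intersection point itself, without the reflection of the group law. In this
  form the relation is symmetric in all three collinear points.\<close>

definition third :: "'a::field weierstrass \<Rightarrow> 'a \<times> 'a \<Rightarrow> 'a \<times> 'a \<Rightarrow> 'a \<times> 'a" where
  "third E = (\<lambda>(x1, y1) (x2, y2).
     let l = (y2 - y1) / (x2 - x1); x3 = l^2 + a1 E * l - a2 E - x1 - x2 in (x3, l * (x3 - x1) + y1))"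

lemma neg_simps [simp]: "fst (neg E A) = fst A" "neg E (neg E A) = A" "neg E A = neg E B \<longleftrightarrow> A = B"
  by (auto simp: neg_def split: prod.splits)

lemma third_commute: "fst A \<noteq> fst B \<Longrightarrow> third E A B = third E B A"
proof -
  assume "fst A \<noteq> fst B"
  obtain x1 y1 x2 y2 where AB: "A = (x1, y1)" "B = (x2, y2)" by (metis surj_pair)
  define l where "l = (y2 - y1) / (x2 - x1)"
  have l: "(y1 - y2) / (x1 - x2) = l"
    unfolding l_def by (metis minus_diff_eq minus_divide_divide)
  have "y2 - y1 = l * (x2 - x1)"
    using \<open>fst A \<noteq> fst B\<close> by (simp add: l_def AB)
  then show ?thesis
    unfolding AB third_def Let_def prod.case l l_def[symmetric] by (auto simp: algebra_simps)
qed

lemma third_third: "fst A \<noteq> fst B \<Longrightarrow> fst (third E A B) \<noteq> fst A \<Longrightarrow> third E A (third E A B) = B"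
proof -
  assume *: "fst A \<noteq> fst B" "fst (third E A B) \<noteq> fst A"
  obtain x1 y1 x2 y2 where AB: "A = (x1, y1)" "B = (x2, y2)" by (metis surj_pair)
  define l where "l = (y2 - y1) / (x2 - x1)"
  define x3 where "x3 = l^2 + a1 E * l - a2 E - x1 - x2"
  have t: "third E A B = (x3, l * (x3 - x1) + y1)"
    by (simp add: third_def AB Let_def l_def x3_def)
  have sl: "(l * (x3 - x1) + y1 - y1) / (x3 - x1) = l" and y2: "l * (x2 - x1) + y1 = y2"
    using * t by (auto simp: AB l_def)
  have x2: "l^2 + a1 E * l - a2 E - x1 - x3 = x2" by (simp add: x3_def)
  show ?thesis
    unfolding t unfolding AB third_def Let_def prod.case sl x2 y2 ..
qed

lemma third_neg: "fst A \<noteq> fst B \<Longrightarrow> third E (neg E A) (neg E B) = neg E (third E A B)"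
proof -
  assume *: "fst A \<noteq> fst B"
  obtain x1 y1 x2 y2 where AB: "A = (x1, y1)" "B = (x2, y2)" by (metis surj_pair)
  define l where "l = (y2 - y1) / (x2 - x1)"
  have y: "y2 = y1 + l * (x2 - x1)" and d: "x2 - x1 \<noteq> 0"
    using * by (auto simp: AB l_def)
  have "- y2 - a1 E * x2 - a3 E - (- y1 - a1 E * x1 - a3 E) = (- l - a1 E) * (x2 - x1)"
    unfolding y by (simp add: algebra_simps)
  then have sl: "(- y2 - a1 E * x2 - a3 E - (- y1 - a1 E * x1 - a3 E)) / (x2 - x1) = - l - a1 E"
    using d by simp
  have x3: "(- l - a1 E)^2 + a1 E * (- l - a1 E) - a2 E - x1 - x2 = l^2 + a1 E * l - a2 E - x1 - x2"
    by Groebner_Basis.algebra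
  show ?thesis
    unfolding AB third_def neg_def Let_def prod.case l_def[symmetric] sl x3
    by (simp add: algebra_simps)
qed

lemma point_add_third:
  assumes "fst A \<noteq> fst B"
  shows "point_add E (case_prod Affine A) (case_prod Affine B) = case_prod Affine (neg E (third E A B))"
  using assms by (auto simp: third_def neg_def Let_def split: prod.splits)

lemma point_add_neg: "point_add E (case_prod Affine A) (case_prod Affine (neg E A)) = Infinity"
  by (auto simp: neg_def split: prod.splits)

lemma weq_neg: "weq E x (- y - a1 E * x - a3 E) = weq E x y"
  unfolding weq_def by Groebner_Basis.algebra

lemma neg_flexes [simp]: "neg E A \<in> flexes E \<longleftrightarrow> A \<in> flexes E"
  by (cases A) (simp add: neg_def flexes_def weq_neg)

lemma flexes_same_x:
  assumes "A \<in> flexes E" "B \<in> flexes E" "fst A = fst B"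
  shows "B = A \<or> B = neg E A"
proof -
  obtain x y z where AB: "A = (x, y)" "B = (x, z)" using assms(3) by (metis fst_conv surj_pair)
  have "(z - y) * (z + y + a1 E * x + a3 E) = weq E x z - weq E x y"
    unfolding weq_def by Groebner_Basis.algebra
  also have "\<dots> = 0" using assms by (simp add: AB flexes_def)
  finally have "z = y \<or> z + y + a1 E * x + a3 E = 0" by simp
  moreover have "z = - y - a1 E * x - a3 E" if "z + y + a1 E * x + a3 E = 0"
    using that by Groebner_Basis.algebra
  ultimately show ?thesis
    unfolding AB neg_def by auto
qed

context
  fixes E :: "'a::field weierstrass"
  assumes nz: "psi2_nonzero E"
begin

lemma flex_not_two_torsion: "(x, y) \<in> flexes E \<Longrightarrow> 2 * y + a1 E * x + a3 E \<noteq> 0"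
  using psi2_sq[of y E x] nz by (auto simp: flexes_def psi2_nonzero_def)

lemma neg_neq: "A \<in> flexes E \<Longrightarrow> neg E A \<noteq> A"
proof
  assume A: "A \<in> flexes E" "neg E A = A"
  obtain x y where xy: "A = (x, y)" by (metis surj_pair)
  have "- y - a1 E * x - a3 E = y" using A(2) by (simp add: xy neg_def)
  then have "y - (- y - a1 E * x - a3 E) = 0" by (simp only: diff_self)
  then have "2 * y + a1 E * x + a3 E = 0" by (simp add: algebra_simps)
  then show False using flex_not_two_torsion A(1) xy by simp
qed

text \<open>Moving one flex to the origin with horizontal tangent produces a Deuring model, where
  \<open>deuring_third\<close> shows that the line through two flexes meets the curve in a third
  one.\<close>

lemma third_flex:
  assumes A: "A \<in> flexes E" and B: "B \<in> flexes E" and ne: "fst A \<noteq> fst B"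
  shows "third E A B \<in> flexes E" "fst (third E A B) \<noteq> fst A" "fst (third E A B) \<noteq> fst B"
proof -
  have *: "third E A B \<in> flexes E \<and> fst (third E A B) \<noteq> fst A"
    if A: "A \<in> flexes E" and B: "B \<in> flexes E" and ne: "fst A \<noteq> fst B" for A B
  proof -
    obtain x1 y1 x2 y2 where AB: "A = (x1, y1)" "B = (x2, y2)" by (metis surj_pair)
    have d: "x2 - x1 \<noteq> 0" "x1 \<noteq> x2" using ne by (auto simp: AB)
    define l where "l = (y2 - y1) / (x2 - x1)"
    define x3 where "x3 = l^2 + a1 E * l - a2 E - x1 - x2"
    have t: "third E A B = (x3, l * (x3 - x1) + y1)"
      by (simp add: third_def AB Let_def l_def x3_def)
    have y2: "y2 = l * (x2 - x1) + y1" using d by (simp add: l_def)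
    have w: "weq E x1 y1 = 0" "weq E x2 (l * (x2 - x1) + y1) = 0"
      using A B by (simp_all add: flexes_def AB flip: y2)
    note sec = secant_identity[OF w d(2), folded x3_def]
    let ?Y = "2 * y1 + a1 E * x1 + a3 E"
    define m where "m = (3 * x1^2 + 2 * a2 E * x1 + a4 E - a1 E * y1) / ?Y"
    have A': "(x1, y1) \<in> flexes E" using A AB by simp
    note Y = flex_not_two_torsion[OF A']
    have slope: "m^2 + a1 E * m = a2 E + 3 * x1"
      using flex_slope[OF A' Y] by (simp add: m_def)
    \<comment> \<open>Otherwise the secant would be the tangent at the flex, which meets the curve
      in that flex alone.\<close>
    have "x3 \<noteq> x1"
    proof
      assume "x3 = x1"
      then have "l = m" using sec(2) Y by (simp add: m_def field_simps)
      then have "x2 = x1" using \<open>x3 = x1\<close> slope by (simp add: x3_def algebra_simps)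
      with d show False by simp
    qed
    define D where "D = change_vars 1 x1 m y1 E"
    have D: "D = Weierstrass (a1 E + 2 * m) 0 ?Y 0 0"
      unfolding D_def m_def by (rule flex_deuring[OF A' Y])
    have g: "poly (g_poly E) (x + x1) = x * (3 * x^3 + (a1 E + 2 * m)^2 * x^2 + 3 * (a1 E + 2 * m) * ?Y * x + 3 * ?Y^2)" for x
      using change_vars_g_poly[of 1 E x x1 m y1] by (simp add: D[unfolded D_def] g_poly_deuring)
    have "weq D (x2 - x1) (y2 - y1 - m * (x2 - x1)) = 0"
      using change_vars_weq[of 1 E "x2 - x1" x1 "y2 - y1 - m * (x2 - x1)" m y1] B
      by (simp add: D_def flexes_def AB algebra_simps)
    then have curve: "(y2 - y1 - m * (x2 - x1))^2 + (a1 E + 2 * m) * (x2 - x1) * (y2 - y1 - m * (x2 - x1))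
        + ?Y * (y2 - y1 - m * (x2 - x1)) = (x2 - x1)^3"
      by (simp add: D weq_def)
    have flex: "3 * (x2 - x1)^3 + (a1 E + 2 * m)^2 * (x2 - x1)^2 + 3 * (a1 E + 2 * m) * ?Y * (x2 - x1) + 3 * ?Y^2 = 0"
      using g[of "x2 - x1"] B d by (simp add: flexes_def AB)
    have "(y2 - y1 - m * (x2 - x1)) / (x2 - x1) = l - m"
      using d by (simp add: l_def diff_divide_distrib)
    then have "3 * z^3 + (a1 E + 2 * m)^2 * z^2 + 3 * (a1 E + 2 * m) * ?Y * z + 3 * ?Y^2 = 0"
      if "z = (l - m)^2 + (a1 E + 2 * m) * (l - m) - (x2 - x1)" for z
      using deuring_third[OF d(1) curve flex] that by simp
    moreover have "x3 - x1 = (l - m)^2 + (a1 E + 2 * m) * (l - m) - (x2 - x1)"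
      unfolding x3_def using slope by Groebner_Basis.algebra
    ultimately have h0: "3 * (x3 - x1)^3 + (a1 E + 2 * m)^2 * (x3 - x1)^2 +
        3 * (a1 E + 2 * m) * ?Y * (x3 - x1) + 3 * ?Y^2 = 0"
      by blast
    have "poly (g_poly E) (x3 - x1 + x1) = 0"
      unfolding g h0 by simp
    then have "poly (g_poly E) x3 = 0" by simp
    moreover have "weq E x3 (l * (x3 - x1) + y1) = 0"
      using sec(1)[of x3] by simp
    ultimately show ?thesis
      using \<open>x3 \<noteq> x1\<close> \<open>poly (g_poly E) x3 = 0\<close> unfolding t unfolding AB by (simp add: flexes_def)
  qed
  show "third E A B \<in> flexes E" "fst (third E A B) \<noteq> fst A" "fst (third E A B) \<noteq> fst B"
    using *[OF A B ne] *[OF B A] ne third_commute[OF ne, of E] by auto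
qed

lemma point_add_flex_self:
  assumes "A \<in> flexes E"
  shows "point_add E (case_prod Affine A) (case_prod Affine A) = case_prod Affine (neg E A)"
proof -
  obtain x y where A: "A = (x, y)" by (metis surj_pair)
  have Y: "2 * y + a1 E * x + a3 E \<noteq> 0" using flex_not_two_torsion assms A by simp
  then have Y': "y + y + a1 E * x + a3 E \<noteq> 0" unfolding mult_2 .
  have "((3 * x^2 + 2 * a2 E * x + a4 E - a1 E * y) / (2 * y + a1 E * x + a3 E))^2 +
    a1 E * ((3 * x^2 + 2 * a2 E * x + a4 E - a1 E * y) / (2 * y + a1 E * x + a3 E)) - a2 E - x - x = x"
    using flex_slope[of x y E] assms Y by (simp add: A)
  then show ?thesis
    using Y' by (simp add: A neg_def Let_def)
qed

lemma point_add_eq_Infinity: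
  "point_add E (Affine x y) (Affine x' y') = Infinity \<longleftrightarrow> x = x' \<and> y + y' + a1 E * x' + a3 E = 0"
  by (simp add: Let_def)

lemma point_mult_3: "point_mult E 3 (Affine x y) = point_add E (Affine x y) (point_add E (Affine x y) (Affine x y))"
  by (simp add: point_mult_def numeral_3_eq_3 del: point_add.simps(3))

text \<open>Tripling gives \<open>Infinity\<close> exactly if doubling keeps the
  \<open>x\<close>-coordinate, and by \<open>tangent_identity\<close> the change of the
  \<open>x\<close>-coordinate is a nonzero multiple of \<open>g\<close>.\<close>

lemma torsion_3: "torsion E 3 = insert Infinity (case_prod Affine ` flexes E)"
proof -
  have *: "Affine x y \<in> torsion E 3 \<longleftrightarrow> (x, y) \<in> flexes E" for x y
  proof (cases "weq E x y = 0")
    case w: True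
    show ?thesis
    proof (cases "y + y + a1 E * x + a3 E = 0")
      \<comment> \<open>The point has order two, so three times the point is the point
        itself.\<close>
      case True
      then have "(x, y) \<notin> flexes E" using flex_not_two_torsion[of x y] unfolding mult_2 by blast
      then show ?thesis using True by (simp add: torsion_def point_mult_3)
    next
      case False
      define l where "l = (3 * x^2 + 2 * a2 E * x + a4 E - a1 E * y) / (2 * y + a1 E * x + a3 E)"
      define x3 where "x3 = l^2 + a1 E * l - a2 E - x - x"
      have Y: "2 * y + a1 E * x + a3 E \<noteq> 0" using False unfolding mult_2 .
      have lY: "l * (2 * y + a1 E * x + a3 E) = 3 * x^2 + 2 * a2 E * x + a4 E - a1 E * y"
        using Y by (simp add: l_def)
      have "(x3 - x) * (2 * y + a1 E * x + a3 E)^2 = - poly (g_poly E) x"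
        using tangent_identity[where E=E and x=x and y=y] w lY unfolding x3_def by Groebner_Basis.algebra
      then have "x3 = x \<longleftrightarrow> poly (g_poly E) x = 0" using Y by auto
      moreover have "point_add E (Affine x y) (Affine x y) = Affine x3 (- (l * (x3 - x) + y) - a1 E * x3 - a3 E)"
        using False by (simp add: Let_def x3_def l_def)
      then have "point_mult E 3 (Affine x y) = Infinity \<longleftrightarrow> x3 = x"
        unfolding point_mult_3 by (auto simp: point_add_eq_Infinity simp del: point_add.simps(3))
      ultimately show ?thesis using w by (simp add: torsion_def curve_points_def flexes_def)
    qed
  qed (auto simp: torsion_def curve_points_def flexes_def)
  have "Infinity \<in> torsion E 3"
    by (simp add: torsion_def curve_points_def point_mult_def numeral_3_eq_3)
  moreover have "P \<in> torsion E 3 \<longleftrightarrow> P \<in> insert Infinity (case_prod Affine ` flexes E)" for P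
    using * calculation by (cases P) auto
  ultimately show ?thesis by blast
qed

end

text \<open>By Vieta's formulas, \<open>4 * b8 = b2 * b6 - b4^2\<close> becomes
  \<open>d^2 + d * d' + d'^2 = 0\<close>: the two resolvents differ by a primitive third root of
  unity. As \<open>d - d'\<close> is a product of differences of roots, this also separates
  roots.\<close>

lemma resolvents:
  fixes x1 x2 x3 x4 :: "'a::field"
  assumes 3: "(3::'a) \<noteq> 0"
    and g: "g_poly E = smult 3 ([:- x1, 1:] * [:- x2, 1:] * [:- x3, 1:] * [:- x4, 1:])"
  defines "d \<equiv> b4 E - 3 * (x1 * x2 + x3 * x4)" and "d' \<equiv> b4 E - 3 * (x1 * x3 + x2 * x4)"
  assumes "d \<noteq> 0"
  shows "d' ^ 3 = d ^ 3" "d' \<noteq> d" "x1 \<noteq> x4" "x2 \<noteq> x3" "d - d' = 3 * (x1 - x4) * (x3 - x2)"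
proof -
  have e: "b8 E = 3 * (x1 * x2 * x3 * x4)" "3 * b6 E = 3 * - (x1*x2*x3 + x1*x2*x4 + x1*x3*x4 + x2*x3*x4)"
    "3 * b4 E = 3 * (x1*x2 + x1*x3 + x1*x4 + x2*x3 + x2*x4 + x3*x4)" "b2 E = - 3 * (x1 + x2 + x3 + x4)"
    using g unfolding g_poly_def by (simp_all add: algebra_simps)
  have b4: "b4 E = x1*x2 + x1*x3 + x1*x4 + x2*x3 + x2*x4 + x3*x4"
    using e(3) 3 unfolding mult_cancel_left by blast
  have b6: "b6 E = - (x1*x2*x3 + x1*x2*x4 + x1*x3*x4 + x2*x3*x4)"
    using e(2) 3 unfolding mult_cancel_left by blast
  have rel: "4 * b8 E = b2 E * b6 E - (b4 E)^2" by (rule b_relation)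
  have sq: "d^2 + d * d' + d'^2 = 0"
    using rel unfolding e(1,4) b6 unfolding d_def d'_def b4 by Groebner_Basis.algebra
  then show "d' ^ 3 = d ^ 3" by Groebner_Basis.algebra
  show ne: "d' \<noteq> d"
  proof
    assume "d' = d"
    then have "3 * d^2 = 0" using sq by (simp add: power2_eq_square)
    with 3 \<open>d \<noteq> 0\<close> show False by simp
  qed
  show *: "d - d' = 3 * (x1 - x4) * (x3 - x2)"
    unfolding d_def d'_def by Groebner_Basis.algebra
  then show "x1 \<noteq> x4" "x2 \<noteq> x3" using ne by auto
qed

section \<open>Groups of two by two matrices over the field with three elements\<close>

lemma is_isoI:
  assumes "bij_betw f (carrier H) (carrier G)"
    and "\<And>x y. x \<in> carrier H \<Longrightarrow> y \<in> carrier H \<Longrightarrow> x \<otimes>\<^bsub>H\<^esub> y \<in> carrier H"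
    and "\<And>x y. x \<in> carrier H \<Longrightarrow> y \<in> carrier H \<Longrightarrow> f (x \<otimes>\<^bsub>H\<^esub> y) = f x \<otimes>\<^bsub>G\<^esub> f y"
  shows "G \<cong> H"
proof -
  let ?h = "inv_into (carrier H) f"
  have inv: "bij_betw ?h (carrier G) (carrier H)"
    by (rule bij_betw_inv_into[OF assms(1)])
  have "?h (x \<otimes>\<^bsub>G\<^esub> y) = ?h x \<otimes>\<^bsub>H\<^esub> ?h y" if "x \<in> carrier G" "y \<in> carrier G" for x y
  proof -
    have "?h x \<in> carrier H" "?h y \<in> carrier H" using inv that by (meson bij_betwE)+
    moreover have "f (?h x) = x" "f (?h y) = y"
      using assms(1) that by (auto simp: bij_betw_inv_into_right)
    ultimately show ?thesis
      using assms(2,3)[of "?h x" "?h y"] bij_betw_inv_into_left[OF assms(1)] by metis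
  qed
  then have "?h \<in> iso G H"
    using inv by (auto simp: iso_def hom_def dest: bij_betwE)
  then show ?thesis unfolding is_iso_def by blast
qed

lemma f3_cases: "(x::3) = 0 \<or> x = 1 \<or> x = 2"
  using exhaust_3[of x] by auto

text \<open>Unfolding quantifiers with this rule turns a statement about all matrices into 81 ground
  instances that the simplifier evaluates.\<close>

lemma f3_all: "(\<forall>x::3. P x) \<longleftrightarrow> P 0 \<and> P 1 \<and> P 2"
  using f3_cases by metis

lemma f3_simps [simp]: "(3::3) = 0" "(4::3) = 1" "(2::3) \<noteq> 0" "(2::3) \<noteq> 1" "(1::3) \<noteq> 2" "(0::3) \<noteq> 2"
  "- (1::3) = 2" "- (2::3) = 1"
proof -
  show 3: "(3::3) = 0" by simp
  have "(4::3) = 3 + 1" by simp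
  then show "(4::3) = 1" unfolding 3 by simp
  have 2: "(2::3) = - 1" using 3 by (simp add: eq_neg_iff_add_eq_0)
  then show "(2::3) \<noteq> 0" by simp
  then show "(0::3) \<noteq> 2" by simp
  show "- (1::3) = 2" "- (2::3) = 1" by (simp_all add: 2)
  have "(2::3) = 1 + 1" by simp
  then show "(2::3) \<noteq> 1" by (metis add_cancel_right_right zero_neq_one)
  then show "(1::3) \<noteq> 2" by metis
qed

text \<open>\<open>Quad a b c d\<close> stands for the matrix with rows \<open>(a, b)\<close> and \<open>(c, d)\<close>.\<close>

datatype quad = Quad 3 3 3 3

fun qmul :: "quad \<Rightarrow> quad \<Rightarrow> quad" (infixl \<open>\<star>\<close> 70) where
  "Quad a b c d \<star> Quad a' b' c' d' = Quad (a * a' + b * c') (a * b' + b * d') (c * a' + d * c') (c * b' + d * d')"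

fun qdet :: "quad \<Rightarrow> 3" where
  "qdet (Quad a b c d) = a * d - b * c"

abbreviation qI :: quad where "qI \<equiv> Quad 1 0 0 1"
abbreviation qM :: quad where "qM \<equiv> Quad 2 0 0 2"

lemma qmul_assoc: "A \<star> B \<star> C = A \<star> (B \<star> C)"
  by (cases A; cases B; cases C) (simp add: algebra_simps)

lemma qmul_one [simp]: "qI \<star> A = A" "A \<star> qI = A"
  by (cases A; simp)+

lemma qdet_qmul: "qdet (A \<star> B) = qdet A * qdet B"
  by (cases A; cases B) (simp add: algebra_simps)

text \<open>Stabilisers of the first basis vector, of the line that it spans, of the pair of
  coordinate axes, and of the partition of the four lines into the axes and the diagonals.\<close>

fun fixes_vector :: "quad \<Rightarrow> bool" where
  "fixes_vector (Quad a b c d) \<longleftrightarrow> a = 1 \<and> c = 0"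
fun fixes_line :: "quad \<Rightarrow> bool" where
  "fixes_line (Quad a b c d) \<longleftrightarrow> c = 0"
fun fixes_axes :: "quad \<Rightarrow> bool" where
  "fixes_axes (Quad a b c d) \<longleftrightarrow> b = 0 \<and> c = 0 \<or> a = 0 \<and> d = 0"
text \<open>The columns, which are the images of the axes, have to be orthogonal for the form
  \<open>x^2 + y^2\<close>. This form is anisotropic over the field with three elements, so
  orthogonality pairs off the four lines, and the pairs are exactly the axes and the
  diagonals.\<close>

fun fixes_partition :: "quad \<Rightarrow> bool" where
  "fixes_partition (Quad a b c d) \<longleftrightarrow> a * b + c * d = 0"

primrec qpow :: "quad \<Rightarrow> nat \<Rightarrow> quad" where
  "qpow A 0 = qI"
| "qpow A (Suc n) = A \<star> qpow A n"

lemma qpow_add: "qpow A (m + n) = qpow A m \<star> qpow A n"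
  by (induction m) (simp_all add: qmul_assoc)

lemma qpow_mult: "qpow A n = qI \<Longrightarrow> qpow A (n * m) = qI"
  by (induction m) (simp_all add: qpow_add)

lemma qpow_mod:
  assumes "qpow A n = qI"
  shows "qpow A (m mod n) = qpow A m"
proof -
  have "qpow A m = qpow A (n * (m div n) + m mod n)" by simp
  also have "\<dots> = qpow A (m mod n)" unfolding qpow_add qpow_mult[OF assms] by simp
  finally show ?thesis ..
qed

definition quad_monoid :: "quad set \<Rightarrow> quad monoid" where
  "quad_monoid R = \<lparr>carrier = R, mult = (\<star>), one = qI\<rparr>"

lemma quad_monoid_simps [simp]: "carrier (quad_monoid R) = R" "x \<otimes>\<^bsub>quad_monoid R\<^esub> y = x \<star> y"
  by (simp_all add: quad_monoid_def)

lemma cyclic_iso: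
  assumes R: "R = qpow A ` {..<n}" and n: "0 < n" and pow: "qpow A n = qI" and inj: "inj_on (qpow A) {..<n}"
  shows "quad_monoid R \<cong> integer_mod_group n"
proof (rule is_isoI[where f = "\<lambda>k. qpow A (nat k)"])
  have c: "carrier (integer_mod_group n) = int ` {..<n}"
    using n by (auto simp: carrier_integer_mod_group image_iff Bex_def)
      (metis of_nat_less_iff zero_le_imp_eq_int)
  show "bij_betw (\<lambda>k. qpow A (nat k)) (carrier (integer_mod_group n)) (carrier (quad_monoid R))"
    unfolding c bij_betw_def R using inj by (auto simp: inj_on_def image_image)
  fix x y assume xy: "x \<in> carrier (integer_mod_group n)" "y \<in> carrier (integer_mod_group n)"
  then obtain i j where ij: "x = int i" "y = int j" unfolding c by blast
  have "nat ((x + y) mod int n) = (i + j) mod n"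
    unfolding ij by (metis nat_int of_nat_add zmod_int)
  then show "qpow A (nat (x \<otimes>\<^bsub>integer_mod_group n\<^esub> y)) = qpow A (nat x) \<otimes>\<^bsub>quad_monoid R\<^esub> qpow A (nat y)"
    using pow by (simp add: ij qpow_mod qpow_add)
  show "x \<otimes>\<^bsub>integer_mod_group n\<^esub> y \<in> carrier (integer_mod_group n)"
    using n by (simp add: carrier_integer_mod_group)
qed

text \<open>The map \<open>(a, i) \<mapsto> r^a f^i\<close> is onto \<open>R\<close>, and counting
  makes it injective. The exponent \<open>k\<close> may be negative, so \<open>m\<close> stands for
  its residue as a natural number.\<close>

lemma cyclic_by_2_iso:
  assumes R: "R = qpow r ` {..<n} \<union> (\<lambda>a. qpow r a \<star> f) ` {..<n}" and card: "card R = 2 * n" and n: "0 < n"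
    and pow: "qpow r n = qI" and sq: "f \<star> f = qI" and conj: "f \<star> r = qpow r m \<star> f" and m: "int m = k mod int n"
  shows "quad_monoid R \<cong> cyclic_by_2 n k"
proof (rule is_isoI[where f = "\<lambda>(a, i). qpow r (nat a) \<star> qpow f i"])
  let ?C = "{0..<int n} \<times> {0..<2::nat}" and ?h = "\<lambda>(a, i). qpow r (nat a) \<star> qpow f i"
  have car: "carrier (cyclic_by_2 n k) = ?C" by (simp add: cyclic_by_2_def)
  have i2: "i = 0 \<or> i = 1" if "i \<in> {0..<2::nat}" for i using that by auto
  have img: "?h ` ?C = R"
  proof (rule antisym)
    show "?h ` ?C \<subseteq> R"
    proof
      fix x assume "x \<in> ?h ` ?C"
      then obtain a i where *: "a \<in> {0..<int n}" "i \<in> {0..<2}" "x = qpow r (nat a) \<star> qpow f i" by auto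
      then have "nat a < n" by auto
      with i2[OF *(2)] *(3) show "x \<in> R" unfolding R by auto
    qed
    show "R \<subseteq> ?h ` ?C"
    proof
      fix x assume "x \<in> R"
      then obtain a where "a < n" "x = qpow r a \<or> x = qpow r a \<star> f" unfolding R by auto
      then have "x = ?h (int a, 0) \<or> x = ?h (int a, 1)" "(int a, 0) \<in> ?C" "(int a, 1) \<in> ?C" by auto
      then show "x \<in> ?h ` ?C" by blast
    qed
  qed
  have "inj_on ?h ?C"
    by (rule eq_card_imp_inj_on) (simp_all add: img card)
  then show "bij_betw ?h (carrier (cyclic_by_2 n k)) (carrier (quad_monoid R))"
    using img by (simp add: bij_betw_def car)
  have swap: "f \<star> qpow r b = qpow r (m * b) \<star> f" for b
  proof (induction b)
    case (Suc b)
    have "f \<star> qpow r (Suc b) = qpow r m \<star> (f \<star> qpow r b)"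
      using conj by (simp add: qmul_assoc[symmetric])
    then show ?case unfolding Suc by (simp add: qmul_assoc[symmetric] qpow_add)
  qed simp
  fix x y assume xy: "x \<in> carrier (cyclic_by_2 n k)" "y \<in> carrier (cyclic_by_2 n k)"
  obtain a i b j where ab: "x = (a, i)" "y = (b, j)" by (metis surj_pair)
  have a: "0 \<le> a" "0 \<le> b" and ij: "i \<in> {0..<2}" "j \<in> {0..<2}" using xy by (auto simp: car ab)
  show "x \<otimes>\<^bsub>cyclic_by_2 n k\<^esub> y \<in> carrier (cyclic_by_2 n k)"
    using n by (simp add: cyclic_by_2_def ab)
  have e: "nat ((a + c * b) mod int n) = (nat a + nat (c mod int n) * nat b) mod n" for c
  proof -
    have "int ((nat a + nat (c mod int n) * nat b) mod n) = (a + (c mod int n) * b) mod int n"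
      using a n by (simp add: zmod_int)
    also have "\<dots> = (a + c * b) mod int n" by (metis mod_add_right_eq mod_mult_left_eq)
    finally show ?thesis by (metis nat_int)
  qed
  have f2: "qpow f ((i + j) mod 2) = qpow f i \<star> qpow f j" if "i \<in> {0..<2}" "j \<in> {0..<2}" for i j
    using i2[OF that(1)] i2[OF that(2)] sq by (auto simp: numeral_2_eq_2)
  have "qpow r (nat ((a + k ^ i * b) mod int n)) \<star> qpow f i = qpow r (nat a) \<star> (qpow f i \<star> qpow r (nat b))"
    using i2[OF ij(1)]
  proof
    assume "i = 0"
    then show ?thesis
      using a pow by (simp add: nat_mod_distrib nat_add_distrib qpow_mod qpow_add)
  next
    assume "i = 1"
    have "nat (k mod int n) = m" using m by linarith
    then show ?thesis
      using e[of k] pow \<open>i = 1\<close> swap by (simp add: qpow_mod qpow_add qmul_assoc)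
  qed
  then have "qpow r (nat ((a + k ^ i * b) mod int n)) \<star> qpow f ((i + j) mod 2) =
    qpow r (nat a) \<star> qpow f i \<star> (qpow r (nat b) \<star> qpow f j)"
    unfolding f2[OF ij] by (metis qmul_assoc)
  then show "?h (x \<otimes>\<^bsub>cyclic_by_2 n k\<^esub> y) = ?h x \<otimes>\<^bsub>quad_monoid R\<^esub> ?h y"
    by (simp add: cyclic_by_2_def ab)
qed

text \<open>Explicit lists make the statements about these classes computable. The stabiliser of the
  partition is a Sylow 2-subgroup of order 16. Inside it lie \<open>quads_Q8\<close> with
  determinant 1, whose elements in \<open>quads_diag\<close> exchange axes and diagonals, and
  outside determinant 1 the involutions \<open>quads_refl\<close> and the elements
  \<open>quads_order8\<close>. The elements of determinant 1 outside \<open>quads_Q8\<close> are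
  those of order three and their negatives.\<close>

definition quads_Q8 :: "quad list" where
  "quads_Q8 = [qI, qM, Quad 0 2 1 0, Quad 0 1 2 0, Quad 1 1 1 2, Quad 2 2 2 1, Quad 2 1 1 1, Quad 1 2 2 2]"
definition quads_diag :: "quad list" where
  "quads_diag = [Quad 1 1 1 2, Quad 2 2 2 1, Quad 1 2 2 2, Quad 2 1 1 1]"
definition quads_refl :: "quad list" where
  "quads_refl = [Quad 1 0 0 2, Quad 2 0 0 1, Quad 0 1 1 0, Quad 0 2 2 0]"
definition quads_order8 :: "quad list" where
  "quads_order8 = [Quad 1 1 2 1, Quad 1 2 1 1, Quad 2 1 2 2, Quad 2 2 1 2]"
definition quads_order3 :: "quad list" where
  "quads_order3 = [Quad 1 1 0 1, Quad 1 2 0 1, Quad 1 0 1 1, Quad 1 0 2 1, Quad 0 1 2 2, Quad 0 2 1 2, Quad 2 1 2 0, Quad 2 2 1 0]"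

lemmas quads_defs = quads_Q8_def quads_diag_def quads_refl_def quads_order8_def quads_order3_def

lemma Q8_iff: "qdet A = 1 \<and> fixes_partition A \<longleftrightarrow> A \<in> set quads_Q8"
proof -
  have "\<forall>a b c d. qdet (Quad a b c d) = 1 \<and> fixes_partition (Quad a b c d) \<longleftrightarrow> Quad a b c d \<in> set quads_Q8"
    unfolding quads_defs f3_all by simp
  then show ?thesis by (cases A) blast
qed

lemma det2_iff: "qdet A = 2 \<and> fixes_partition A \<longleftrightarrow> A \<in> set quads_refl \<or> A \<in> set quads_order8"
proof -
  have "\<forall>a b c d. qdet (Quad a b c d) = 2 \<and> fixes_partition (Quad a b c d) \<longleftrightarrow>
    Quad a b c d \<in> set quads_refl \<or> Quad a b c d \<in> set quads_order8"
    unfolding quads_defs f3_all by simp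
  then show ?thesis by (cases A) blast
qed

lemma order3_iff: "qdet A = 1 \<and> \<not> fixes_partition A \<longleftrightarrow> A \<in> set quads_order3 \<or> qM \<star> A \<in> set quads_order3"
proof -
  have "\<forall>a b c d. qdet (Quad a b c d) = 1 \<and> \<not> fixes_partition (Quad a b c d) \<longleftrightarrow>
    Quad a b c d \<in> set quads_order3 \<or> qM \<star> Quad a b c d \<in> set quads_order3"
    unfolding quads_defs f3_all by simp
  then show ?thesis by (cases A) blast
qed

text \<open>An element of order three permutes the three partitions cyclically, so one of its powers
  carries the standard partition to the one that \<open>B\<close> maps to the standard
  partition.\<close>

lemma order3_translates:
  assumes "A \<in> set quads_order3" "qdet B \<noteq> 0"
  shows "fixes_partition B \<or> fixes_partition (B \<star> A) \<or> fixes_partition (B \<star> A \<star> A)"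
proof -
  have "\<forall>A \<in> set quads_order3. \<forall>a b c d. qdet (Quad a b c d) \<noteq> 0 \<longrightarrow> fixes_partition (Quad a b c d) \<or>
     fixes_partition (Quad a b c d \<star> A) \<or> fixes_partition (Quad a b c d \<star> A \<star> A)"
    unfolding quads_defs f3_all by simp
  then show ?thesis using assms by (cases B) blast
qed

section \<open>Subgroups of the general linear group\<close>

text \<open>Inverses are powers here, because there are only finitely many matrices.\<close>

locale quad_subgroup =
  fixes R :: "quad set"
  assumes one: "qI \<in> R" and closed: "A \<in> R \<Longrightarrow> B \<in> R \<Longrightarrow> A \<star> B \<in> R"
    and det: "A \<in> R \<Longrightarrow> qdet A \<noteq> 0"
begin

lemma pow_closed: "A \<in> R \<Longrightarrow> qpow A n \<in> R"
  by (induction n) (use one closed in auto)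

text \<open>\<open>R\<close> contains all powers of \<open>A\<close>, so an upper bound
  \<open>S\<close> consisting of powers of \<open>A\<close> suffices. The explicit list
  \<open>ks\<close> lets the conditions on the powers be evaluated.\<close>

lemma cyclic:
  assumes "A \<in> R" and ks: "[0..<n] = ks" and sub: "R \<subseteq> S"
    and *: "S \<subseteq> set (map (qpow A) ks) \<and> distinct (map (qpow A) ks) \<and> qpow A n = qI" and "0 < n"
  shows "quad_monoid R \<cong> integer_mod_group n"
proof (rule cyclic_iso)
  show "qpow A n = qI" "0 < n" using assms by blast+
  have ks': "set ks = {..<n}" by (simp add: ks[symmetric] atLeast0LessThan)
  have "R \<subseteq> qpow A ` {..<n}" using sub * unfolding set_map ks' by blast
  then show "R = qpow A ` {..<n}" using pow_closed[OF assms(1)] by blast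
  show "inj_on (qpow A) {..<n}" using * ks' unfolding distinct_map by simp
qed

lemma by_2:
  assumes "r \<in> R" "f \<in> R" and ks: "[0..<n] = ks"
    and sub: "R \<subseteq> S"
    and *: "S \<subseteq> set (map (qpow r) ks @ map (\<lambda>a. qpow r a \<star> f) ks) \<and>
      distinct (map (qpow r) ks @ map (\<lambda>a. qpow r a \<star> f) ks) \<and>
      qpow r n = qI \<and> f \<star> f = qI \<and> f \<star> r = qpow r m \<star> f"
    and "0 < n" "int m = k mod int n"
  shows "quad_monoid R \<cong> cyclic_by_2 n k"
proof (rule cyclic_by_2_iso)
  show "qpow r n = qI" "0 < n" "f \<star> f = qI" "f \<star> r = qpow r m \<star> f" "int m = k mod int n"
    using assms by blast+
  have ks': "set ks = {..<n}" "length ks = n"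
    by (simp_all add: ks[symmetric] atLeast0LessThan)
  have "R \<subseteq> qpow r ` {..<n} \<union> (\<lambda>a. qpow r a \<star> f) ` {..<n}"
    using sub * unfolding set_append set_map ks'(1) by blast
  then show R: "R = qpow r ` {..<n} \<union> (\<lambda>a. qpow r a \<star> f) ` {..<n}"
    using pow_closed[OF assms(1)] closed[OF _ assms(2)] by blast
  then have "R = set (map (qpow r) ks @ map (\<lambda>a. qpow r a \<star> f) ks)" by (simp add: ks')
  then show "card R = 2 * n"
    using distinct_card[of "map (qpow r) ks @ map (\<lambda>a. qpow r a \<star> f) ks"] * ks' by simp
qed

lemma upt_simps:
  "[0..<2] = [0, 1]" "[0..<3] = [0, 1, 2]" "[0..<4] = [0, 1, 2, 3]" "[0..<6] = [0, 1, 2, 3, 4, 5]"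
  "[0..<8] = [0, 1, 2, 3, 4, 5, 6, 7]"
  by (simp_all add: upt_rec)

lemma qpow_numeral: "qpow A (numeral k) = A \<star> qpow A (pred_numeral k)"
  by (simp add: numeral_eq_Suc)

lemma det_cases: "A \<in> R \<Longrightarrow> qdet A = 1 \<or> qdet A = 2"
  using det f3_cases by blast

lemma Q8_mem: "A \<in> R \<Longrightarrow> qdet A = 1 \<Longrightarrow> fixes_partition A \<Longrightarrow> A \<in> set quads_Q8"
  using Q8_iff by blast

section \<open>Subgroups of the quaternion group\<close>

lemma C2_case:
  assumes "\<And>A. A \<in> R \<Longrightarrow> qdet A = 1 \<and> fixes_partition A \<and> fixes_line A" "R \<noteq> {qI}"
  shows "quad_monoid R \<cong> integer_mod_group 2"
proof -
  have sub: "A \<in> {qI, qM}" if "A \<in> R" for A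
    using Q8_mem[OF that] assms(1)[OF that] by (auto simp: quads_defs)
  then have "qM \<in> R" using assms(2) one by blast
  then show ?thesis
  proof (rule cyclic[OF _ upt_simps(1)])
    show "R \<subseteq> {qI, qM}" using sub by blast
    show "{qI, qM} \<subseteq> set (map (qpow qM) [0, 1]) \<and> distinct (map (qpow qM) [0, 1]) \<and> qpow qM 2 = qI"
      by (simp add: qpow_numeral)
  qed simp
qed

lemma C4_case_axes:
  assumes "\<And>A. A \<in> R \<Longrightarrow> qdet A = 1 \<and> fixes_partition A \<and> fixes_axes A"
    and "B \<in> R" "\<not> fixes_line B"
  shows "quad_monoid R \<cong> integer_mod_group 4"
proof -
  have sub: "A \<in> {qI, qM, Quad 0 2 1 0, Quad 0 1 2 0}" if "A \<in> R" for A
    using Q8_mem[OF that] assms(1)[OF that] by (auto simp: quads_defs)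
  have "B \<in> {Quad 0 2 1 0, Quad 0 1 2 0}" using sub[OF assms(2)] assms(3) by auto
  moreover have "\<forall>B\<in>{Quad 0 2 1 0, Quad 0 1 2 0}. {qI, qM, Quad 0 2 1 0, Quad 0 1 2 0} \<subseteq>
      set (map (qpow B) [0, 1, 2, 3]) \<and> distinct (map (qpow B) [0, 1, 2, 3]) \<and> qpow B 4 = qI"
    by (simp add: qpow_numeral)
  ultimately have *: "{qI, qM, Quad 0 2 1 0, Quad 0 1 2 0} \<subseteq>
      set (map (qpow B) [0, 1, 2, 3]) \<and> distinct (map (qpow B) [0, 1, 2, 3]) \<and> qpow B 4 = qI"
    by blast
  have "R \<subseteq> {qI, qM, Quad 0 2 1 0, Quad 0 1 2 0}" using sub by blast
  from cyclic[OF assms(2) upt_simps(3) this *] show ?thesis by simp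
qed

text \<open>The elements of the quaternion group that fix the pair of axes form a subgroup of index
  two, which meets \<open>R\<close> at most in \<open>1\<close> and \<open>-1\<close>. So
  \<open>R\<close> has at most four elements, and \<open>B\<close> has order four.\<close>

lemma C4_case_diagonal:
  assumes Q: "\<And>A. A \<in> R \<Longrightarrow> qdet A = 1 \<and> fixes_partition A"
    and B: "B \<in> R" "\<not> fixes_axes B" and stab: "\<And>A. A \<in> R \<Longrightarrow> fixes_axes A \<Longrightarrow> fixes_line A"
  shows "quad_monoid R \<cong> integer_mod_group 4"
proof -
  have "B \<in> set quads_Q8" using Q8_mem Q B by blast
  then have diag: "B \<in> set quads_diag"
    using B(2) by (auto simp: quads_defs)
  have "A \<in> set (map (qpow B) [0, 1, 2, 3])" if A: "A \<in> R" for A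
  proof -
    have "A \<in> set quads_Q8" "fixes_axes A \<longrightarrow> fixes_line A" "fixes_axes (B \<star> A) \<longrightarrow> fixes_line (B \<star> A)"
      using Q8_mem Q stab A closed[OF B(1) A] by blast+
    moreover have "\<forall>B\<in>set quads_diag. \<forall>A\<in>set quads_Q8. (fixes_axes A \<longrightarrow> fixes_line A) \<longrightarrow>
        (fixes_axes (B \<star> A) \<longrightarrow> fixes_line (B \<star> A)) \<longrightarrow> A \<in> set (map (qpow B) [0, 1, 2, 3])"
      by (simp add: quads_defs qpow_numeral)
    ultimately show ?thesis using diag by blast
  qed
  then have sub: "R \<subseteq> set (map (qpow B) [0, 1, 2, 3])" by blast
  have "\<forall>B\<in>set quads_diag. set (map (qpow B) [0, 1, 2, 3]) \<subseteq> set (map (qpow B) [0, 1, 2, 3]) \<and>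
      distinct (map (qpow B) [0, 1, 2, 3]) \<and> qpow B 4 = qI"
    by (simp add: quads_defs qpow_numeral)
  from cyclic[OF B(1) upt_simps(3) sub bspec[OF this diag]] show ?thesis by simp
qed

text \<open>An element other than \<open>1\<close> and \<open>-1\<close> has order four, and any
  element outside the cyclic group that it generates completes it to a generating pair.\<close>

lemma Q8_subset:
  assumes "A \<in> R" "A \<in> set quads_Q8" "B \<in> R" "B \<in> set quads_Q8"
    "A \<notin> {qI, qM}" "B \<notin> {qI, qM, A, qM \<star> A}"
  shows "set quads_Q8 \<subseteq> R"
proof -
  have "\<forall>A\<in>set quads_Q8. \<forall>B\<in>set quads_Q8. A \<notin> {qI, qM} \<longrightarrow> B \<notin> {qI, qM, A, qM \<star> A} \<longrightarrow>
     set quads_Q8 \<subseteq> {qI, A, A \<star> A, A \<star> (A \<star> A), B, B \<star> (B \<star> B), A \<star> B, B \<star> A}"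
    by (simp add: quads_defs)
  then have "set quads_Q8 \<subseteq> {qI, A, A \<star> A, A \<star> (A \<star> A), B, B \<star> (B \<star> B), A \<star> B, B \<star> A}"
    using assms(2,4,5,6) by blast
  also have "\<dots> \<subseteq> R" using assms one closed by auto
  finally show ?thesis .
qed

lemma Q8_case:
  assumes Q: "\<And>A. A \<in> R \<Longrightarrow> qdet A = 1 \<and> fixes_partition A"
    and B: "B \<in> R" "\<not> fixes_axes B" and A: "A \<in> R" "fixes_axes A" "\<not> fixes_line A"
  shows "quad_monoid R \<cong> quaternion_group"
proof -
  have "A \<in> set quads_Q8" "B \<in> set quads_Q8" using Q8_mem Q A B by blast+
  moreover have "A \<notin> {qI, qM}" using A by auto
  moreover have "B \<notin> {qI, qM, A, qM \<star> A}"
  proof -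
    have "fixes_axes qI" "fixes_axes qM" by simp_all
    moreover have "fixes_axes (qM \<star> A)" using A(2) by (cases A) auto
    ultimately show ?thesis using B(2) A(2) by blast
  qed
  ultimately have "set quads_Q8 \<subseteq> R" using Q8_subset[of A B] A B by blast
  then have R: "R = set quads_Q8" using Q8_mem Q by blast
  \<comment> \<open>The linear map that sends \<open>1\<close> to the identity, \<open>i\<close> to
    \<open>Quad 0 2 1 0\<close>, \<open>j\<close> to \<open>Quad 1 1 1 2\<close> and
    \<open>k\<close> to their product \<open>Quad 2 1 1 1\<close>; it reflects that the quaternions
    split modulo 3.\<close>
  let ?f = "\<lambda>(a, b, c, d). Quad (of_int (a + c + 2 * d)) (of_int (c + d - b)) (of_int (b + c + d)) (of_int (a + 2 * c + d))"
  show ?thesis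
  proof (rule is_isoI[where f = ?f])
    have "?f ` carrier quaternion_group = set quads_Q8"
      by (simp add: quaternion_group_def quads_defs)
    moreover have "inj_on ?f (carrier quaternion_group)"
      by (simp add: quaternion_group_def)
    ultimately show "bij_betw ?f (carrier quaternion_group) (carrier (quad_monoid R))"
      by (simp add: bij_betw_def R)
    fix x y assume "x \<in> carrier quaternion_group" "y \<in> carrier quaternion_group"
    moreover have "\<forall>x\<in>carrier quaternion_group. \<forall>y\<in>carrier quaternion_group.
        x \<otimes>\<^bsub>quaternion_group\<^esub> y \<in> carrier quaternion_group \<and>
        ?f (x \<otimes>\<^bsub>quaternion_group\<^esub> y) = ?f x \<otimes>\<^bsub>quad_monoid R\<^esub> ?f y"
      by (simp add: quaternion_group_def)
    ultimately show "x \<otimes>\<^bsub>quaternion_group\<^esub> y \<in> carrier quaternion_group"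
      "?f (x \<otimes>\<^bsub>quaternion_group\<^esub> y) = ?f x \<otimes>\<^bsub>quad_monoid R\<^esub> ?f y"
      by blast+
  qed
qed

section \<open>Elements of order three, and the groups that contain SL2\<close>

lemma order3_exists:
  assumes "A \<in> R" "qdet A = 1" "\<not> fixes_partition A"
  shows "\<exists>B\<in>R. B \<in> set quads_order3"
proof (cases "A \<in> set quads_order3")
  case False
  then have "qM \<star> A \<in> set quads_order3" using order3_iff assms by blast
  \<comment> \<open>An element of order six has cube \<open>-1\<close>, so its negative, of order
    three, is its fourth power.\<close>
  moreover have "qM \<star> A = A \<star> (A \<star> (A \<star> A))"
  proof -
    have "qM \<star> (qM \<star> A) = A" by (simp flip: qmul_assoc)
    moreover have "\<forall>B\<in>set quads_order3. qM \<star> (qM \<star> B) = (qM \<star> B) \<star> ((qM \<star> B) \<star> ((qM \<star> B) \<star> (qM \<star> B)))"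
      by (simp add: quads_defs)
    ultimately show ?thesis using \<open>qM \<star> A \<in> set quads_order3\<close> by metis
  qed
  ultimately show ?thesis using assms closed by metis
qed (use assms in blast)

lemma order3_facts:
  assumes "A \<in> set quads_order3"
  shows "A \<star> (A \<star> A) = qI" "qdet A = 1"
proof -
  have "\<forall>A\<in>set quads_order3. A \<star> (A \<star> A) = qI \<and> qdet A = 1" by (simp add: quads_defs)
  from bspec[OF this assms] show "A \<star> (A \<star> A) = qI" "qdet A = 1" by blast+
qed

text \<open>The part of \<open>R\<close> with determinant 1 is covered by three cosets of its
  intersection with the quaternion group, represented by the powers of \<open>A\<close>; note that
  \<open>A \<star> A\<close> is the inverse of \<open>A\<close>.\<close>

lemma order3_translate_mem:
  assumes "A \<in> R" "A \<in> set quads_order3" "B \<in> R" "qdet B = 1"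
  shows "\<exists>C\<in>R. qdet C = 1 \<and> fixes_partition C \<and> (B = C \<or> B = C \<star> (A \<star> A) \<or> B = C \<star> A)"
proof -
  note o = order3_facts[OF assms(2)]
  have e: "B = B \<star> A \<star> (A \<star> A)" "B = B \<star> A \<star> A \<star> A" using o by (simp_all add: qmul_assoc)
  have m: "B \<star> A \<in> R" "B \<star> A \<star> A \<in> R" "qdet (B \<star> A) = 1" "qdet (B \<star> A \<star> A) = 1"
    using assms o closed by (auto simp: qdet_qmul)
  have "qdet B \<noteq> 0" using assms(4) by simp
  then consider "fixes_partition B" | "fixes_partition (B \<star> A)" | "fixes_partition (B \<star> A \<star> A)"
    using order3_translates[OF assms(2)] by blast
  then show ?thesis
  proof cases
    case 1
    then show ?thesis using assms(3,4) by blast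
  next
    case 2
    have "B = B \<star> A \<or> B = B \<star> A \<star> (A \<star> A) \<or> B = B \<star> A \<star> A"
      by (rule disjI2, rule disjI1, rule e(1))
    with m(1,3) 2 show ?thesis by (intro bexI[where x = "B \<star> A"] conjI)
  next
    case 3
    have "B = B \<star> A \<star> A \<or> B = B \<star> A \<star> A \<star> (A \<star> A) \<or> B = B \<star> A \<star> A \<star> A"
      by (rule disjI2, rule disjI2, rule e(2))
    with m(2,4) 3 show ?thesis by (intro bexI[where x = "B \<star> A \<star> A"] conjI)
  qed
qed

lemma C3_case:
  assumes d: "\<And>A. A \<in> R \<Longrightarrow> qdet A = 1" and B: "B \<in> R" "\<not> fixes_partition B"
    and N: "\<And>A. A \<in> R \<Longrightarrow> fixes_partition A \<Longrightarrow> fixes_vector A"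
  shows "quad_monoid R \<cong> integer_mod_group 3"
proof -
  obtain A where A: "A \<in> R" "A \<in> set quads_order3" using order3_exists[OF B(1) d[OF B(1)] B(2)] by blast
  have triv: "C = qI" if "C \<in> R" "fixes_partition C" for C
    using Q8_mem[OF that(1) d[OF that(1)] that(2)] N[OF that] by (auto simp: quads_defs)
  have "C \<in> {qI, A, A \<star> A}" if C: "C \<in> R" for C
  proof -
    obtain D where D: "D \<in> R" "fixes_partition D" "C = D \<or> C = D \<star> (A \<star> A) \<or> C = D \<star> A"
      using order3_translate_mem[OF A C d[OF C]] by blast
    show ?thesis using D(3) unfolding triv[OF D(1,2)] by auto
  qed
  then have sub: "R \<subseteq> {qI, A, A \<star> A}" by blast
  have "\<forall>A\<in>set quads_order3. {qI, A, A \<star> A} \<subseteq> set (map (qpow A) [0, 1, 2]) \<and>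
      distinct (map (qpow A) [0, 1, 2]) \<and> qpow A 3 = qI"
    by (simp add: quads_defs qpow_numeral)
  from cyclic[OF A(1) upt_simps(2) sub bspec[OF this A(2)]] show ?thesis by simp
qed

lemma C6_case:
  assumes d: "\<And>A. A \<in> R \<Longrightarrow> qdet A = 1" and B: "B \<in> R" "\<not> fixes_partition B"
    and N: "\<And>A. A \<in> R \<Longrightarrow> fixes_partition A \<Longrightarrow> fixes_line A"
    and C: "C \<in> R" "fixes_partition C" "\<not> fixes_vector C"
  shows "quad_monoid R \<cong> integer_mod_group 6"
proof -
  obtain A where A: "A \<in> R" "A \<in> set quads_order3" using order3_exists[OF B(1) d[OF B(1)] B(2)] by blast
  have triv: "D = qI \<or> D = qM" if "D \<in> R" "fixes_partition D" for D
    using Q8_mem[OF that(1) d[OF that(1)] that(2)] N[OF that] by (auto simp: quads_defs)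
  have M: "qM \<in> R" using triv[OF C(1,2)] C(1,3) by auto
  have mem: "D \<in> {qI, A, A \<star> A, qM, qM \<star> A, qM \<star> (A \<star> A)}" if D: "D \<in> R" for D
  proof -
    obtain Y where Y: "Y \<in> R" "fixes_partition Y" "D = Y \<or> D = Y \<star> (A \<star> A) \<or> D = Y \<star> A"
      using order3_translate_mem[OF A D d[OF D]] by blast
    show ?thesis using Y(3) triv[OF Y(1,2)] by (elim disjE) simp_all
  qed
  have r: "qM \<star> A \<in> R" using closed[OF M A(1)] .
  have "\<forall>A\<in>set quads_order3. {qI, A, A \<star> A, qM, qM \<star> A, qM \<star> (A \<star> A)} \<subseteq>
      set (map (qpow (qM \<star> A)) [0, 1, 2, 3, 4, 5]) \<and>
      distinct (map (qpow (qM \<star> A)) [0, 1, 2, 3, 4, 5]) \<and> qpow (qM \<star> A) 6 = qI"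
    by (simp add: quads_defs qpow_numeral)
  then have *: "{qI, A, A \<star> A, qM, qM \<star> A, qM \<star> (A \<star> A)} \<subseteq>
      set (map (qpow (qM \<star> A)) [0, 1, 2, 3, 4, 5]) \<and>
      distinct (map (qpow (qM \<star> A)) [0, 1, 2, 3, 4, 5]) \<and> qpow (qM \<star> A) 6 = qI"
    using A(2) by (rule bspec)
  have "R \<subseteq> {qI, A, A \<star> A, qM, qM \<star> A, qM \<star> (A \<star> A)}" using mem by blast
  from cyclic[OF r upt_simps(4) this *] show ?thesis by simp
qed

text \<open>Conjugation by an element of order three permutes the three cyclic subgroups of order
  four, so \<open>C\<close> and its conjugate generate the quaternion group.\<close>

lemma Q8_subset_if_order3:
  assumes A: "A \<in> R" "A \<in> set quads_order3"
    and C: "C \<in> R" "qdet C = 1" "fixes_partition C" "\<not> fixes_axes C"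
  shows "set quads_Q8 \<subseteq> R"
proof (rule Q8_subset[of C "A \<star> (C \<star> (A \<star> A))"])
  show "C \<in> R" by fact
  show Q: "C \<in> set quads_Q8" by (rule Q8_mem[OF C(1-3)])
  show "A \<star> (C \<star> (A \<star> A)) \<in> R" using closed[OF A(1) closed[OF C(1) closed[OF A(1) A(1)]]] .
  have "C \<in> set quads_diag"
    using Q C(4) by (auto simp: quads_defs)
  moreover have "\<forall>C\<in>set quads_diag. \<forall>A\<in>set quads_order3. A \<star> (C \<star> (A \<star> A)) \<in> set quads_Q8 \<and> C \<notin> {qI, qM} \<and>
      A \<star> (C \<star> (A \<star> A)) \<notin> {qI, qM, C, qM \<star> C}"
    by (simp add: quads_defs)
  ultimately show "A \<star> (C \<star> (A \<star> A)) \<in> set quads_Q8" "C \<notin> {qI, qM}"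
    "A \<star> (C \<star> (A \<star> A)) \<notin> {qI, qM, C, qM \<star> C}"
    using A(2) by blast+
qed

lemma SL2_subset:
  assumes B: "B \<in> R" "qdet B = 1" "\<not> fixes_partition B"
    and C: "C \<in> R" "qdet C = 1" "fixes_partition C" "\<not> fixes_axes C"
  shows "{A. qdet A = 1} \<subseteq> R"
proof
  fix D assume "D \<in> {A. qdet A = 1}"
  then have D: "qdet D = 1" by simp
  obtain A where A: "A \<in> R" "A \<in> set quads_order3" using order3_exists[OF B] by blast
  note o = order3_facts[OF A(2)]
  have Q: "Y \<in> R" if "qdet Y = 1" "fixes_partition Y" for Y
    using Q8_subset_if_order3[OF A C] Q8_iff that by blast
  have e: "D = D \<star> A \<star> (A \<star> A)" "D = D \<star> A \<star> A \<star> A" using o by (simp_all add: qmul_assoc)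
  have d: "qdet (D \<star> A) = 1" "qdet (D \<star> A \<star> A) = 1"
    using D o by (auto simp: qdet_qmul)
  have "qdet D \<noteq> 0" using D by simp
  then consider "fixes_partition D" | "fixes_partition (D \<star> A)" | "fixes_partition (D \<star> A \<star> A)"
    using order3_translates[OF A(2)] by blast
  then show "D \<in> R"
  proof cases
    case 1
    then show ?thesis using Q D by blast
  next
    case 2
    from closed[OF Q[OF d(1) this] closed[OF A(1) A(1)]] show ?thesis using e(1) by argo
  next
    case 3
    from closed[OF Q[OF d(2) this] A(1)] show ?thesis using e(2) by argo
  qed
qed

lemma GL2_subset:
  assumes B: "B \<in> R" "qdet B = 1" "\<not> fixes_partition B"
    and C: "C \<in> R" "qdet C = 1" "fixes_partition C" "\<not> fixes_axes C"
    and T: "T \<in> R" "qdet T \<noteq> 1"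
  shows "R = {A. qdet A \<noteq> 0}"
proof (rule antisym)
  show "{A. qdet A \<noteq> 0} \<subseteq> R"
  proof
    fix D assume "D \<in> {A. qdet A \<noteq> 0}"
    then have "qdet D = 1 \<or> qdet D = 2" using f3_cases[of "qdet D"] by simp
    then show "D \<in> R"
    proof
      assume D: "qdet D = 2"
      obtain a b c d where abcd: "T = Quad a b c d" by (cases T)
      have dT: "qdet T = 2" using det_cases[OF T(1)] T(2) by blast
      \<comment> \<open>The inverse of \<open>T\<close>: its determinant is \<open>-1\<close>, so
        this is the adjugate with opposite sign.\<close>
      define T' where "T' = Quad (2 * d) b c (2 * a)"
      have T': "T' \<star> T = qI" "qdet T' = 2"
      proof -
        have "\<forall>a b c d::3. a * d - b * c = 2 \<longrightarrow> 2 * d * a + b * c = 1 \<and> 2 * d * b + b * d = 0 \<and>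
            c * a + 2 * a * c = 0 \<and> c * b + 2 * a * d = 1"
          unfolding f3_all by simp
        moreover have "a * d - b * c = 2" using dT by (simp add: abcd)
        ultimately have *: "2 * d * a + b * c = 1" "2 * d * b + b * d = 0" "c * a + 2 * a * c = 0" "c * b + 2 * a * d = 1"
          by blast+
        then show "T' \<star> T = qI" by (simp add: T'_def abcd)
        then have "qdet T' * 2 = 1" using qdet_qmul[of T' T] dT by simp
        then show "qdet T' = 2" using f3_cases[of "qdet T'"] by (elim disjE) simp_all
      qed
      have "D \<star> T' \<in> R"
        using SL2_subset[OF B C] D T'(2) qdet_qmul[of D T'] by (simp add: subset_iff)
      from closed[OF this T(1)] have "D \<star> T' \<star> T \<in> R" .
      then show "D \<in> R" by (simp add: qmul_assoc T'(1))
    qed (use SL2_subset[OF B C] in blast)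
  qed
qed (use det in blast)

end

section \<open>Groups with elements of determinant -1\<close>

fun act :: "quad \<Rightarrow> 3 \<times> 3 \<Rightarrow> 3 \<times> 3" where
  "act (Quad a b c d) (i, j) = (a * i + b * j, c * i + d * j)"

context quad_subgroup
begin

lemma Q8_line: "A \<in> R \<Longrightarrow> qdet A = 1 \<Longrightarrow> fixes_partition A \<Longrightarrow> fixes_line A \<Longrightarrow> A \<in> {qI, qM}"
  using Q8_mem[of A] by (auto simp: quads_defs)

lemma det2_mem: "A \<in> R \<Longrightarrow> qdet A \<noteq> 1 \<Longrightarrow> fixes_partition A \<Longrightarrow> A \<in> set (quads_refl @ quads_order8)"
  using det2_iff[of A] det_cases[of A] by auto

lemma refl_sq: "\<forall>T\<in>set quads_refl. T \<star> T = qI" "\<forall>T\<in>set quads_order8. \<not> fixes_line (T \<star> T)"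
  by (simp_all add: quads_defs)

text \<open>In the stabiliser of the partition, an element of determinant \<open>-1\<close> is a
  reflection or has order eight. In the latter case its square has order four and moves every line,
  contrary to \<open>N\<close>.\<close>

lemma refl_mem:
  assumes T: "T \<in> R" "qdet T \<noteq> 1" "fixes_partition T"
    and N: "\<And>A. A \<in> R \<Longrightarrow> qdet A = 1 \<Longrightarrow> fixes_partition A \<Longrightarrow> fixes_line A"
  shows "T \<in> set quads_refl"
proof -
  have "qdet T = 2" using det_cases T by blast
  then have "qdet (T \<star> T) = 1" by (simp add: qdet_qmul)
  moreover have "T \<in> set (quads_refl @ quads_order8)" using det2_mem T by blast
  moreover have "\<forall>T\<in>set (quads_refl @ quads_order8). fixes_partition (T \<star> T)"
    by (simp add: quads_defs)
  ultimately have "fixes_line (T \<star> T)" using N[OF closed[OF T(1) T(1)]] by blast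
  then show ?thesis
    using refl_sq(2) \<open>T \<in> set (quads_refl @ quads_order8)\<close> by auto
qed

text \<open>The hypothesis \<open>red\<close> is what additive reduction says about
  \<open>R\<close>: a fixed vector is a rational point of order three, a vector fixed up to sign is
  a rational root of \<open>g\<close>, and the two must lie on one line.\<close>

lemma trivial_impossible:
  assumes red: "\<And>v1 v2 w1 w2. \<forall>A\<in>R. act A (v1, v2) = (v1, v2) \<Longrightarrow>
      \<forall>A\<in>R. act A (w1, w2) \<in> {(w1, w2), (2 * w1, 2 * w2)} \<Longrightarrow> v1 * w2 - v2 * w1 = 0"
  shows "R \<noteq> {qI}"
  using red[of 1 0 0 1] by auto

text \<open>If \<open>-1\<close> were missing, \<open>R\<close> would consist of the identity and
  one reflection, whose two eigenlines contradict \<open>red\<close>.\<close>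

lemma minus_one_mem:
  assumes par: "\<And>A. A \<in> R \<Longrightarrow> fixes_partition A"
    and N: "\<And>A. A \<in> R \<Longrightarrow> qdet A = 1 \<Longrightarrow> fixes_line A"
    and T: "T \<in> R" "qdet T \<noteq> 1"
    and red: "\<And>v1 v2 w1 w2. \<forall>A\<in>R. act A (v1, v2) = (v1, v2) \<Longrightarrow>
      \<forall>A\<in>R. act A (w1, w2) \<in> {(w1, w2), (2 * w1, 2 * w2)} \<Longrightarrow> v1 * w2 - v2 * w1 = 0"
  shows "qM \<in> R"
proof (rule ccontr)
  assume M: "qM \<notin> R"
  have Tr: "T \<in> set quads_refl" using refl_mem[OF T par[OF T(1)] N] .
  have triv: "A = qI" if "A \<in> R" "qdet A = 1" for A
    using Q8_line[OF that par[OF that(1)] N[OF that]] M that(1) by blast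
  have "A \<in> {qI, T}" if A: "A \<in> R" for A
  proof (cases "qdet A = 1")
    case True
    then show ?thesis using triv A by blast
  next
    case False
    then have "qdet (T \<star> A) = 1"
      using det_cases[OF A] det_cases[OF T(1)] T(2) by (simp add: qdet_qmul)
    from triv[OF closed[OF T(1) A] this] have "T \<star> (T \<star> A) = T" by simp
    then show ?thesis using refl_sq(1) Tr by (metis insertCI qmul_assoc qmul_one(1))
  qed
  then have R: "R = {qI, T}" using one T by blast
  have i: "act qI v = v" for v by (cases v) simp
  show False
  proof -
    \<comment> \<open>For each reflection, one of the four instances of \<open>red\<close> consists
      of a fixed and a negated eigenvector.\<close>
    consider "T = Quad 1 0 0 2" | "T = Quad 2 0 0 1" | "T = Quad 0 1 1 0" | "T = Quad 0 2 2 0"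
      using Tr by (auto simp: quads_defs)
    then show False
      using red[of 1 0 0 1] red[of 0 1 1 0] red[of 1 1 1 2] red[of 1 2 1 1] unfolding R
      by cases (simp_all add: i)
  qed
qed

lemma C2xC2_case:
  assumes par: "\<And>A. A \<in> R \<Longrightarrow> fixes_partition A"
    and N: "\<And>A. A \<in> R \<Longrightarrow> qdet A = 1 \<Longrightarrow> fixes_line A"
    and T: "T \<in> R" "qdet T \<noteq> 1" and M: "qM \<in> R"
  shows "quad_monoid R \<cong> integer_mod_group 2 \<times>\<times> integer_mod_group 2"
proof -
  have Tr: "T \<in> set quads_refl" using refl_mem[OF T par[OF T(1)] N] .
  have sub: "A \<in> {qI, T, qM, qM \<star> T}" if A: "A \<in> R" for A
  proof (cases "qdet A = 1")
    case True
    then show ?thesis using Q8_line[OF A True par[OF A] N[OF A True]] by blast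
  next
    case False
    then have "qdet (A \<star> T) = 1"
      using det_cases[OF A] det_cases[OF T(1)] T(2) by (simp add: qdet_qmul)
    from Q8_line[OF closed[OF A T(1)] this par N] have "A \<star> T \<in> {qI, qM}"
      using closed[OF A T(1)] \<open>qdet (A \<star> T) = 1\<close> by blast
    then have mem: "A \<star> T \<star> T \<in> {T, qM \<star> T}" by auto
    have "A \<star> T \<star> T = A" using refl_sq(1) Tr by (simp add: qmul_assoc)
    from mem[unfolded this] show ?thesis by blast
  qed
  then have R: "R = {qI, T, qM, qM \<star> T}" using one T(1) M closed[OF M T(1)] by blast
  let ?f = "\<lambda>(x, y). (if x = 0 then qI else qM) \<star> (if y = 0 then qI else T)"
  have car: "carrier (integer_mod_group 2 \<times>\<times> integer_mod_group 2) = {(0, 0), (0, 1), (1, 0), (1, 1)}"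
    by (auto simp: carrier_integer_mod_group DirProd_def)
  show ?thesis
  proof (rule is_isoI[where f = ?f])
    have "\<forall>T\<in>set quads_refl. distinct [qI, T, qM, qM \<star> T]" by (simp add: quads_defs)
    then have d: "distinct [qI, T, qM, qM \<star> T]" using Tr by blast
    show "bij_betw ?f (carrier (integer_mod_group 2 \<times>\<times> integer_mod_group 2)) (carrier (quad_monoid R))"
      unfolding car R bij_betw_def using d by auto
    fix x y assume xy: "x \<in> carrier (integer_mod_group 2 \<times>\<times> integer_mod_group 2)"
      "y \<in> carrier (integer_mod_group 2 \<times>\<times> integer_mod_group 2)"
    then show "x \<otimes>\<^bsub>integer_mod_group 2 \<times>\<times> integer_mod_group 2\<^esub> y
        \<in> carrier (integer_mod_group 2 \<times>\<times> integer_mod_group 2)"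
      unfolding car by auto
    have "\<forall>T\<in>set quads_refl. \<forall>x\<in>{(0, 0), (0, 1), (1, 0), (1, 1)}. \<forall>y\<in>{(0, 0), (0, 1), (1, 0), (1, 1)}.
        (\<lambda>(x, y). (if x = 0 then qI else qM) \<star> (if y = 0 then qI else T))
          (x \<otimes>\<^bsub>integer_mod_group 2 \<times>\<times> integer_mod_group 2\<^esub> y) =
        (case x of (x, y) \<Rightarrow> (if x = 0 then qI else qM) \<star> (if y = 0 then qI else T)) \<star>
        (case y of (x, y) \<Rightarrow> (if x = 0 then qI else qM) \<star> (if y = 0 then qI else T))"
      by (simp add: quads_defs)
    from bspec[OF bspec[OF bspec[OF this Tr] xy(1)[unfolded car]] xy(2)[unfolded car]]
    show "?f (x \<otimes>\<^bsub>integer_mod_group 2 \<times>\<times> integer_mod_group 2\<^esub> y) = ?f x \<otimes>\<^bsub>quad_monoid R\<^esub> ?f y"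
      unfolding quad_monoid_simps .
  qed
qed

text \<open>All reflections in the stabiliser of the partition fix the pair of axes, so
  \<open>B\<close> has order eight. For \<open>A\<close> of determinant \<open>-1\<close>, the
  product \<open>A \<star> B\<close> has determinant 1 and fixes the axes, which leaves only powers
  of \<open>B\<close> for \<open>A\<close>.\<close>

lemma C8_case:
  assumes par: "\<And>A. A \<in> R \<Longrightarrow> fixes_partition A"
    and N: "\<And>A. A \<in> R \<Longrightarrow> qdet A = 1 \<Longrightarrow> fixes_axes A"
    and B: "B \<in> R" "\<not> fixes_axes B"
  shows "quad_monoid R \<cong> integer_mod_group 8"
proof -
  have dB: "qdet B \<noteq> 1" using N B by blast
  have refl: "\<forall>T\<in>set quads_refl. fixes_axes T" by (simp add: quads_defs)
  then have B8: "B \<in> set quads_order8"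
    using det2_mem[OF B(1) dB par[OF B(1)]] B(2) by auto
  have 1: "\<forall>A\<in>set quads_Q8. fixes_axes A \<longrightarrow> (\<forall>B\<in>set quads_order8. A \<in> set (map (qpow B) [0, 1, 2, 3, 4, 5, 6, 7]))"
    by (simp add: quads_defs qpow_numeral)
  have 2: "\<forall>A\<in>set (quads_refl @ quads_order8). \<forall>B\<in>set quads_order8. fixes_axes (A \<star> B) \<longrightarrow>
      A \<in> set (map (qpow B) [0, 1, 2, 3, 4, 5, 6, 7])"
    by (simp add: quads_defs qpow_numeral)
  have "A \<in> set (map (qpow B) [0, 1, 2, 3, 4, 5, 6, 7])" if A: "A \<in> R" for A
  proof (cases "qdet A = 1")
    case True
    then show ?thesis using 1 B8 Q8_mem[OF A True par[OF A]] N[OF A True] by blast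
  next
    case False
    then have "qdet (A \<star> B) = 1"
      using det_cases[OF A] det_cases[OF B(1)] dB by (simp add: qdet_qmul)
    then show ?thesis using 2 B8 det2_mem[OF A False par[OF A]] N[OF closed[OF A B(1)]] by blast
  qed
  then have sub: "R \<subseteq> set (map (qpow B) [0, 1, 2, 3, 4, 5, 6, 7])" by blast
  have "\<forall>B\<in>set quads_order8. set (map (qpow B) [0, 1, 2, 3, 4, 5, 6, 7]) \<subseteq> set (map (qpow B) [0, 1, 2, 3, 4, 5, 6, 7]) \<and>
      distinct (map (qpow B) [0, 1, 2, 3, 4, 5, 6, 7]) \<and> qpow B 8 = qI"
    by (simp add: quads_defs qpow_numeral)
  from cyclic[OF B(1) upt_simps(5) sub bspec[OF this B8]] show ?thesis by simp
qed

text \<open>Elements of order eight exchange axes and diagonals. Without them \<open>R\<close> lies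
  in the stabiliser of the pair of axes, the dihedral group of monomial matrices.\<close>

lemma D4_case:
  assumes par: "\<And>A. A \<in> R \<Longrightarrow> fixes_partition A" and ax: "\<And>A. A \<in> R \<Longrightarrow> fixes_axes A"
    and T: "T \<in> R" "qdet T \<noteq> 1" and A: "A \<in> R" "qdet A = 1" "\<not> fixes_line A"
  shows "quad_monoid R \<cong> dihedral_group 4"
proof -
  let ?S = "{qI, qM, Quad 0 2 1 0, Quad 0 1 2 0} \<union> set quads_refl"
  have 8: "\<forall>T\<in>set quads_order8. \<not> fixes_axes T" by (simp add: quads_defs)
  have refl: "B \<in> set quads_refl" if "B \<in> R" "qdet B \<noteq> 1" for B
    using det2_mem[OF that par[OF that(1)]] ax[OF that(1)] 8 by auto
  have Q: "B \<in> {qI, qM, Quad 0 2 1 0, Quad 0 1 2 0}" if "B \<in> R" "qdet B = 1" for B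
    using Q8_mem[OF that par[OF that(1)]] ax[OF that(1)] by (auto simp: quads_defs)
  have sub: "R \<subseteq> ?S" using refl Q by blast
  have A4: "A \<in> set [Quad 0 2 1 0, Quad 0 1 2 0]" using Q[OF A(1,2)] A(3) by auto
  have "\<forall>A\<in>set [Quad 0 2 1 0, Quad 0 1 2 0]. \<forall>T\<in>set quads_refl.
      ?S \<subseteq> set (map (qpow A) [0, 1, 2, 3] @ map (\<lambda>a. qpow A a \<star> T) [0, 1, 2, 3]) \<and>
      distinct (map (qpow A) [0, 1, 2, 3] @ map (\<lambda>a. qpow A a \<star> T) [0, 1, 2, 3]) \<and>
      qpow A 4 = qI \<and> T \<star> T = qI \<and> T \<star> A = qpow A 3 \<star> T"
    by (simp add: quads_defs qpow_numeral)
  from by_2[OF A(1) T(1) upt_simps(3) sub bspec[OF bspec[OF this A4] refl[OF T]], of "-1"]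
  show ?thesis unfolding dihedral_group_def by simp
qed

lemma SD16_case:
  assumes par: "\<And>A. A \<in> R \<Longrightarrow> fixes_partition A"
    and T: "T \<in> R" "qdet T \<noteq> 1" and C: "C \<in> R" "qdet C = 1" "\<not> fixes_axes C"
  shows "quad_monoid R \<cong> semidihedral_group 4" "Quad 0 2 1 0 \<in> R"
proof -
  have T': "T \<in> set (quads_refl @ quads_order8)" using det2_mem[OF T par[OF T(1)]] .
  have "C \<in> set quads_Q8" using Q8_mem[OF C(1,2) par[OF C(1)]] .
  then have C': "C \<in> set quads_diag" using C(3) by (auto simp: quads_defs)
  \<comment> \<open>The order of \<open>T\<close> is 2 or 8, so \<open>qpow T 7\<close> is its
    inverse. Conjugation by \<open>T\<close> carries \<open>C\<close> into a different cyclic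
    subgroup of order four, and together they generate the quaternion group.\<close>
  let ?C = "T \<star> (C \<star> qpow T 7)"
  have "\<forall>T\<in>set (quads_refl @ quads_order8). \<forall>C\<in>set quads_diag. T \<star> (C \<star> qpow T 7) \<in> set quads_Q8 \<and>
      T \<star> (C \<star> qpow T 7) \<notin> {qI, qM, C, qM \<star> C} \<and> C \<notin> {qI, qM}"
    by (simp add: quads_defs qpow_numeral)
  then have *: "?C \<in> set quads_Q8" "?C \<notin> {qI, qM, C, qM \<star> C}" "C \<notin> {qI, qM}"
    using T' C' by blast+
  have "?C \<in> R" using closed[OF T(1) closed[OF C(1) pow_closed[OF T(1)]]] .
  from Q8_subset[OF C(1) \<open>C \<in> set quads_Q8\<close> this *(1,3,2)] have Q: "set quads_Q8 \<subseteq> R" .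
  then show "Quad 0 2 1 0 \<in> R" by (auto simp: quads_defs)
  have "\<forall>T\<in>set (quads_refl @ quads_order8). \<forall>D\<in>set (quads_refl @ quads_order8).
      D \<star> qpow T 7 \<in> set quads_Q8 \<and> D \<star> qpow T 7 \<star> T = D"
    by (simp add: quads_defs qpow_numeral)
  then have "D \<in> R" if "D \<in> set (quads_refl @ quads_order8)" for D
    using T' that Q closed[OF _ T(1), of "D \<star> qpow T 7"] by (metis subset_iff)
  then have D: "set (quads_refl @ quads_order8) \<subseteq> R" by blast
  \<comment> \<open>An element of order eight and a reflection with \<open>f r f = r^3\<close>, the
    semidihedral relation for \<open>2^(4 - 2) - 1 = 3\<close>.\<close>
  let ?r = "Quad 1 1 2 1" and ?f = "Quad 1 0 0 2"
  have rf: "?r \<in> R" "?f \<in> R" using D by (auto simp: quads_defs)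
  have sub: "R \<subseteq> set quads_Q8 \<union> set (quads_refl @ quads_order8)"
    using Q8_mem det2_mem par by blast
  have "set quads_Q8 \<union> set (quads_refl @ quads_order8) \<subseteq>
      set (map (qpow ?r) [0, 1, 2, 3, 4, 5, 6, 7] @ map (\<lambda>a. qpow ?r a \<star> ?f) [0, 1, 2, 3, 4, 5, 6, 7]) \<and>
      distinct (map (qpow ?r) [0, 1, 2, 3, 4, 5, 6, 7] @ map (\<lambda>a. qpow ?r a \<star> ?f) [0, 1, 2, 3, 4, 5, 6, 7]) \<and>
      qpow ?r 8 = qI \<and> ?f \<star> ?f = qI \<and> ?f \<star> ?r = qpow ?r 3 \<star> ?f"
    by (simp add: quads_defs qpow_numeral)
  from by_2[OF rf upt_simps(5) sub this, of 3]
  show "quad_monoid R \<cong> semidihedral_group 4" unfolding semidihedral_group_def by simp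
qed

text \<open>Matrices of determinant \<open>-1\<close> act on the three partitions as transpositions,
  and two different transpositions have a three-cycle as product. Since \<open>S \<star> S\<close>
  is the inverse of \<open>S\<close>, the conjugated conditions say that the second or the third
  partition is fixed.\<close>

lemma transposition_product:
  defines "S \<equiv> Quad 1 1 0 1"
  assumes A: "qdet A = 2" "\<not> fixes_partition A"
  shows "fixes_partition (S \<star> S \<star> A \<star> S) \<or> fixes_partition (S \<star> A \<star> S \<star> S)"
    and "qdet B = 2 \<Longrightarrow> fixes_partition (S \<star> S \<star> A \<star> S) \<Longrightarrow> \<not> fixes_partition (S \<star> S \<star> B \<star> S) \<Longrightarrow>
      \<not> fixes_partition (A \<star> B)"
    and "qdet B = 2 \<Longrightarrow> fixes_partition (S \<star> A \<star> S \<star> S) \<Longrightarrow> \<not> fixes_partition (S \<star> B \<star> S \<star> S) \<Longrightarrow>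
      \<not> fixes_partition (A \<star> B)"
proof -
  \<comment> \<open>The matrices of determinant \<open>-1\<close> that move the standard partition,
    sorted by the partition that they fix.\<close>
  define L2 where "L2 = [Quad 0 1 1 1, Quad 0 2 2 2, Quad 1 0 1 2, Quad 1 1 0 2, Quad 1 2 2 0, Quad 2 0 2 1,
    Quad 2 1 1 0, Quad 2 2 0 1]"
  define L3 where "L3 = [Quad 0 1 1 2, Quad 0 2 2 1, Quad 1 0 2 2, Quad 1 1 1 0, Quad 1 2 0 2, Quad 2 0 1 1,
    Quad 2 1 0 1, Quad 2 2 2 0]"
  have "\<forall>a b c d. qdet (Quad a b c d) = 2 \<and> \<not> fixes_partition (Quad a b c d) \<longrightarrow>
      Quad a b c d \<in> set L2 \<or> Quad a b c d \<in> set L3"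
    unfolding f3_all L2_def L3_def by simp
  then have A': "A \<in> set L2 \<or> A \<in> set L3" using A by (cases A) blast
  have 2: "\<forall>A\<in>set L2. fixes_partition (S \<star> S \<star> A \<star> S) \<and> \<not> fixes_partition (S \<star> A \<star> S \<star> S)"
    unfolding L2_def S_def by simp
  have 3: "\<forall>A\<in>set L3. fixes_partition (S \<star> A \<star> S \<star> S) \<and> \<not> fixes_partition (S \<star> S \<star> A \<star> S)"
    unfolding L3_def S_def by simp
  show "fixes_partition (S \<star> S \<star> A \<star> S) \<or> fixes_partition (S \<star> A \<star> S \<star> S)"
    using A' 2 3 by blast
  have 4: "\<forall>A\<in>set L2. \<forall>a b c d. qdet (Quad a b c d) = 2 \<longrightarrow> \<not> fixes_partition (S \<star> S \<star> Quad a b c d \<star> S) \<longrightarrow>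
      \<not> fixes_partition (A \<star> Quad a b c d)"
    unfolding L2_def S_def f3_all by simp
  have 5: "\<forall>A\<in>set L3. \<forall>a b c d. qdet (Quad a b c d) = 2 \<longrightarrow> \<not> fixes_partition (S \<star> Quad a b c d \<star> S \<star> S) \<longrightarrow>
      \<not> fixes_partition (A \<star> Quad a b c d)"
    unfolding L3_def S_def f3_all by simp
  show "\<not> fixes_partition (A \<star> B)"
    if "qdet B = 2" "fixes_partition (S \<star> S \<star> A \<star> S)" "\<not> fixes_partition (S \<star> S \<star> B \<star> S)"
    using A' 3 4 that by (cases B) blast
  show "\<not> fixes_partition (A \<star> B)"
    if "qdet B = 2" "fixes_partition (S \<star> A \<star> S \<star> S)" "\<not> fixes_partition (S \<star> B \<star> S \<star> S)"
    using A' 2 5 that by (cases B) blast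
qed

text \<open>The three partitions of the set of lines into two pairs are permuted by conjugation with
  \<open>Quad 1 1 0 1\<close>; if none of them is fixed, then there is a three-cycle.\<close>

lemma three_cycle_exists:
  defines "S \<equiv> Quad 1 1 0 1"
  assumes 1: "\<exists>A\<in>R. \<not> fixes_partition A" and 2: "\<exists>A\<in>R. \<not> fixes_partition (S \<star> S \<star> A \<star> S)"
    and 3: "\<exists>A\<in>R. \<not> fixes_partition (S \<star> A \<star> S \<star> S)"
  shows "\<exists>A\<in>R. qdet A = 1 \<and> \<not> fixes_partition A"
proof (rule ccontr)
  assume no: "\<not> ?thesis"
  note prod = transposition_product[folded S_def]
  \<comment> \<open>The quaternion group acts trivially on all three partitions, so the elements
    that move the second or the third one have determinant 2.\<close>
  have conj: "\<forall>A\<in>set quads_Q8. fixes_partition (S \<star> S \<star> A \<star> S) \<and> fixes_partition (S \<star> A \<star> S \<star> S)"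
    by (simp add: quads_defs S_def)
  have Q: "A \<in> set quads_Q8" if "A \<in> R" "qdet A = 1" for A
    using no Q8_mem that by blast
  have d2: "qdet A = 2" if "A \<in> R" "A \<notin> set quads_Q8" for A
    using det_cases[OF that(1)] Q that by blast
  obtain A where A: "A \<in> R" "\<not> fixes_partition A" using 1 by blast
  have dA: "qdet A = 2" using det_cases[OF A(1)] no A by blast
  have contra: False if B: "B \<in> R" "qdet B = 2" "\<not> fixes_partition (A \<star> B)" for B
  proof -
    have "qdet (A \<star> B) = 1" using dA B(2) by (simp add: qdet_qmul)
    then show False using no closed[OF A(1) B(1)] B(3) by blast
  qed
  from prod(1)[OF dA A(2)] show False
  proof
    assume *: "fixes_partition (S \<star> S \<star> A \<star> S)"
    obtain B where B: "B \<in> R" "\<not> fixes_partition (S \<star> S \<star> B \<star> S)" using 2 by blast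
    have "qdet B = 2" using d2 B conj by blast
    then show False using contra[OF B(1)] prod(2)[OF dA A(2) _ * B(2)] by blast
  next
    assume *: "fixes_partition (S \<star> A \<star> S \<star> S)"
    obtain B where B: "B \<in> R" "\<not> fixes_partition (S \<star> B \<star> S \<star> S)" using 3 by blast
    have "qdet B = 2" using d2 B conj by blast
    then show False using contra[OF B(1)] prod(3)[OF dA A(2) _ * B(2)] by blast
  qed
qed

text \<open>Multiplying \<open>T\<close> by a power of \<open>A\<close> gives an element that fixes
  the partition, hence a reflection \<open>U\<close>. The square of \<open>U \<star> A\<close> lies
  in the quaternion group and fixes a line by \<open>N\<close>, which forces \<open>U\<close> to
  invert \<open>A\<close>.\<close>

lemma reflection_exists:
  assumes A: "A \<in> R" "A \<in> set quads_order3" and T: "T \<in> R" "qdet T \<noteq> 1"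
    and N: "\<And>A. A \<in> R \<Longrightarrow> qdet A = 1 \<Longrightarrow> fixes_partition A \<Longrightarrow> fixes_line A"
  shows "\<exists>U\<in>R. U \<in> set quads_refl \<and> U \<star> A = A \<star> (A \<star> U)"
proof -
  have d: "qdet A = 1" using order3_facts[OF A(2)] by blast
  have "qdet (T \<star> A) \<noteq> 1" "qdet (T \<star> A \<star> A) \<noteq> 1" using T(2) by (simp_all add: qdet_qmul d)
  moreover have "T \<star> A \<in> R" "T \<star> A \<star> A \<in> R" using closed A(1) T(1) by simp_all
  ultimately have "\<exists>U\<in>R. qdet U \<noteq> 1 \<and> fixes_partition U"
    using order3_translates[OF A(2) det[OF T(1)]] T by blast
  then obtain U where U: "U \<in> R" "qdet U \<noteq> 1" "fixes_partition U" by blast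
  then have U': "U \<in> set quads_refl" using refl_mem N by blast
  have "\<forall>A\<in>set quads_order3. \<forall>U\<in>set quads_refl. fixes_partition (U \<star> A \<star> (U \<star> A)) \<and> qdet (U \<star> A \<star> (U \<star> A)) = 1 \<and>
      (fixes_line (U \<star> A \<star> (U \<star> A)) \<longrightarrow> U \<star> A = A \<star> (A \<star> U))"
    by (simp add: quads_defs)
  then have "fixes_partition (U \<star> A \<star> (U \<star> A))" "qdet (U \<star> A \<star> (U \<star> A)) = 1"
    "fixes_line (U \<star> A \<star> (U \<star> A)) \<longrightarrow> U \<star> A = A \<star> (A \<star> U)" using A(2) U' by blast+
  then show ?thesis using U U' N[OF closed[OF closed[OF U(1) A(1)] closed[OF U(1) A(1)]]] by blast
qed

lemma reflection_coset:
  assumes U: "U \<in> R" "U \<in> set quads_refl" and B: "B \<in> R" "qdet B \<noteq> 1"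
  shows "\<exists>D\<in>R. qdet D = 1 \<and> B = D \<star> U"
proof -
  have "\<forall>U\<in>set quads_refl. qdet U = 2" by (simp add: quads_defs)
  then have "qdet (B \<star> U) = 1" using det_cases[OF B(1)] B(2) U(2) by (simp add: qdet_qmul)
  moreover have "B = B \<star> U \<star> U" using refl_sq(1) U(2) by (simp add: qmul_assoc)
  ultimately show ?thesis using closed[OF B(1) U(1)] by blast
qed

lemma D3_case:
  assumes C: "C \<in> R" "qdet C = 1" "\<not> fixes_partition C" and T: "T \<in> R" "qdet T \<noteq> 1"
    and N: "\<And>A. A \<in> R \<Longrightarrow> qdet A = 1 \<Longrightarrow> fixes_partition A \<Longrightarrow> fixes_vector A"
  shows "quad_monoid R \<cong> dihedral_group 3"
proof -
  obtain A where A: "A \<in> R" "A \<in> set quads_order3" using order3_exists[OF C] by blast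
  have triv: "B = qI" if "B \<in> R" "qdet B = 1" "fixes_partition B" for B
    using Q8_mem[OF that] N[OF that] by (auto simp: quads_defs)
  have line: "fixes_line B" if "fixes_vector B" for B using that by (cases B) simp
  obtain U where U: "U \<in> R" "U \<in> set quads_refl" and UA: "U \<star> A = A \<star> (A \<star> U)"
    using reflection_exists[OF A T line[OF N]] by blast
  have det1: "B \<in> {qI, A, A \<star> A}" if B: "B \<in> R" "qdet B = 1" for B
  proof -
    obtain D where D: "D \<in> R" "qdet D = 1" "fixes_partition D" "B = D \<or> B = D \<star> (A \<star> A) \<or> B = D \<star> A"
      using order3_translate_mem[OF A B] by blast
    show ?thesis using D(4) unfolding triv[OF D(1-3)] by auto
  qed
  let ?S = "{qI, A, A \<star> A, U, A \<star> U, A \<star> (A \<star> U)}"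
  have "B \<in> ?S" if B: "B \<in> R" for B
  proof (cases "qdet B = 1")
    case True
    then show ?thesis using det1[OF B] by blast
  next
    case False
    then obtain D where D: "D \<in> R" "qdet D = 1" "B = D \<star> U" using reflection_coset[OF U B] by blast
    show ?thesis using det1[OF D(1,2)] unfolding D(3) by (auto simp: qmul_assoc)
  qed
  then have sub: "R \<subseteq> ?S" by blast
  have "\<forall>A\<in>set quads_order3. \<forall>U\<in>set quads_refl. U \<star> A = A \<star> (A \<star> U) \<longrightarrow>
      {qI, A, A \<star> A, U, A \<star> U, A \<star> (A \<star> U)} \<subseteq> set (map (qpow A) [0, 1, 2] @ map (\<lambda>a. qpow A a \<star> U) [0, 1, 2]) \<and>
      distinct (map (qpow A) [0, 1, 2] @ map (\<lambda>a. qpow A a \<star> U) [0, 1, 2]) \<and>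
      qpow A 3 = qI \<and> U \<star> U = qI \<and> U \<star> A = qpow A 2 \<star> U"
    by (simp add: quads_defs qpow_numeral)
  from by_2[OF A(1) U(1) upt_simps(2) sub bspec[OF bspec[OF this A(2)] U(2), THEN mp, OF UA], of "-1"]
  show ?thesis unfolding dihedral_group_def by simp
qed

lemma D6_case:
  assumes C: "C \<in> R" "qdet C = 1" "\<not> fixes_partition C" and T: "T \<in> R" "qdet T \<noteq> 1"
    and N: "\<And>A. A \<in> R \<Longrightarrow> qdet A = 1 \<Longrightarrow> fixes_partition A \<Longrightarrow> fixes_line A"
    and B: "B \<in> R" "qdet B = 1" "fixes_partition B" "\<not> fixes_vector B"
  shows "quad_monoid R \<cong> dihedral_group 6"
proof -
  obtain A where A: "A \<in> R" "A \<in> set quads_order3" using order3_exists[OF C] by blast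
  have triv: "D = qI \<or> D = qM" if "D \<in> R" "qdet D = 1" "fixes_partition D" for D
    using Q8_line[OF that N[OF that]] by blast
  have M: "qM \<in> R" using triv[OF B(1-3)] B(1,4) by auto
  obtain U where U: "U \<in> R" "U \<in> set quads_refl" and UA: "U \<star> A = A \<star> (A \<star> U)"
    using reflection_exists[OF A T N] by blast
  let ?S0 = "{qI, A, A \<star> A, qM, qM \<star> A, qM \<star> (A \<star> A)}"
  have det1: "B \<in> ?S0" if B: "B \<in> R" "qdet B = 1" for B
  proof -
    obtain D where D: "D \<in> R" "qdet D = 1" "fixes_partition D" "B = D \<or> B = D \<star> (A \<star> A) \<or> B = D \<star> A"
      using order3_translate_mem[OF A B] by blast
    show ?thesis using D(4) triv[OF D(1-3)] by (elim disjE) simp_all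
  qed
  let ?S = "?S0 \<union> (\<lambda>B. B \<star> U) ` ?S0"
  have "B \<in> ?S" if B: "B \<in> R" for B
  proof (cases "qdet B = 1")
    case True
    then show ?thesis using det1[OF B] by blast
  next
    case False
    then obtain D where D: "D \<in> R" "qdet D = 1" "B = D \<star> U" using reflection_coset[OF U B] by blast
    show ?thesis using det1[OF D(1,2)] unfolding D(3) by blast
  qed
  then have sub: "R \<subseteq> ?S" by blast
  have r: "qM \<star> A \<in> R" using closed[OF M A(1)] .
  have "\<forall>A\<in>set quads_order3. \<forall>U\<in>set quads_refl. U \<star> A = A \<star> (A \<star> U) \<longrightarrow>
      {qI, A, A \<star> A, qM, qM \<star> A, qM \<star> (A \<star> A)} \<union> (\<lambda>B. B \<star> U) ` {qI, A, A \<star> A, qM, qM \<star> A, qM \<star> (A \<star> A)} \<subseteq>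
      set (map (qpow (qM \<star> A)) [0, 1, 2, 3, 4, 5] @ map (\<lambda>a. qpow (qM \<star> A) a \<star> U) [0, 1, 2, 3, 4, 5]) \<and>
      distinct (map (qpow (qM \<star> A)) [0, 1, 2, 3, 4, 5] @ map (\<lambda>a. qpow (qM \<star> A) a \<star> U) [0, 1, 2, 3, 4, 5]) \<and>
      qpow (qM \<star> A) 6 = qI \<and> U \<star> U = qI \<and> U \<star> (qM \<star> A) = qpow (qM \<star> A) 5 \<star> U"
    by (simp add: quads_defs qpow_numeral)
  from by_2[OF r U(1) upt_simps(4) sub bspec[OF bspec[OF this A(2)] U(2), THEN mp, OF UA], of "-1"]
  show ?thesis unfolding dihedral_group_def by simp
qed

end

section \<open>Comparison with the matrix groups\<close>

primrec to_mat :: "quad \<Rightarrow> 3^2^2" where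
  "to_mat (Quad a b c d) = vector [vector [a, b], vector [c, d]]"

abbreviation entry :: "3^2^2 \<Rightarrow> 2 \<Rightarrow> 2 \<Rightarrow> 3" where
  "entry M i j \<equiv> vec_nth (vec_nth M i) j"

lemma mat2_eq_iff:
  "M = N \<longleftrightarrow> entry M 1 1 = entry N 1 1 \<and> entry M 1 2 = entry N 1 2 \<and> entry M 2 1 = entry N 2 1 \<and> entry M 2 2 = entry N 2 2"
  unfolding vec_eq_iff forall_2 by (rule conj_assoc)

lemma to_mat_mult: "to_mat (A \<star> B) = to_mat A ** to_mat B"
  by (cases A; cases B) (simp add: mat2_eq_iff matrix_matrix_mult_def sum_2 vector_2)

lemma to_mat_one: "to_mat qI = mat 1"
  by (simp add: mat2_eq_iff mat_def vector_2)

lemma det_to_mat: "det (to_mat A) = qdet A"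
  by (cases A) (simp add: det_2 vector_2)

lemma inj_to_mat: "inj to_mat"
proof (rule injI)
  fix A B assume "to_mat A = to_mat B"
  then show "A = B" by (cases A; cases B) (simp add: mat2_eq_iff vector_2)
qed

lemma surj_to_mat: "\<exists>A. M = to_mat A"
  by (rule exI[of _ "Quad (entry M 1 1) (entry M 1 2) (entry M 2 1) (entry M 2 2)"]) (simp add: mat2_eq_iff vector_2)

lemma invertible_to_mat: "invertible (to_mat A) \<longleftrightarrow> qdet A \<noteq> 0"
proof
  assume "invertible (to_mat A)"
  then obtain N where "to_mat A ** N = mat 1" unfolding invertible_def by blast
  then have "det (to_mat A) * det N = 1" by (metis det_mul det_I)
  then show "qdet A \<noteq> 0" by (auto simp: det_to_mat)
next
  assume d: "qdet A \<noteq> 0"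
  have "\<forall>a b c d. qdet (Quad a b c d) \<noteq> 0 \<longrightarrow>
      Quad a b c d \<star> Quad (d * qdet (Quad a b c d)) (- b * qdet (Quad a b c d)) (- c * qdet (Quad a b c d)) (a * qdet (Quad a b c d)) = qI \<and>
      Quad (d * qdet (Quad a b c d)) (- b * qdet (Quad a b c d)) (- c * qdet (Quad a b c d)) (a * qdet (Quad a b c d)) \<star> Quad a b c d = qI"
    unfolding f3_all by simp
  then obtain B where "A \<star> B = qI" "B \<star> A = qI" using d by (cases A) blast
  then show "invertible (to_mat A)"
    unfolding invertible_def by (metis to_mat_mult to_mat_one)
qed

lemma to_mat_iso:
  assumes "\<And>A. to_mat A \<in> carrier G \<longleftrightarrow> A \<in> R" "mult G = (**)"
    and closed: "\<And>A B. A \<in> R \<Longrightarrow> B \<in> R \<Longrightarrow> A \<star> B \<in> R"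
  shows "quad_monoid R \<cong> G"
proof -
  have "carrier G = to_mat ` R"
  proof (intro equalityI subsetI)
    fix M assume "M \<in> carrier G"
    then show "M \<in> to_mat ` R" using surj_to_mat[of M] assms(1) by blast
  qed (use assms(1) in blast)
  then have "bij_betw to_mat R (carrier G)"
    using inj_to_mat by (metis bij_betw_imageI inj_on_subset subset_UNIV)
  then have "to_mat \<in> iso (quad_monoid R) G"
    by (intro isoI homI) (auto simp: assms(2) to_mat_mult assms(1))
  then show ?thesis unfolding is_iso_def by blast
qed

lemma SL2_iso: "quad_monoid {A. qdet A = 1} \<cong> SL2_F3"
  by (rule to_mat_iso) (simp_all add: SL2_F3_def det_to_mat qdet_qmul)

lemma GL2_iso: "quad_monoid {A. qdet A \<noteq> 0} \<cong> GL2_F3"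
proof (rule to_mat_iso)
  have "\<forall>a b::3. a \<noteq> 0 \<longrightarrow> b \<noteq> 0 \<longrightarrow> a * b \<noteq> 0" unfolding f3_all by simp
  then show "A \<star> B \<in> {A. qdet A \<noteq> 0}" if "A \<in> {A. qdet A \<noteq> 0}" "B \<in> {A. qdet A \<noteq> 0}" for A B
    using that by (simp add: qdet_qmul)
qed (simp_all add: GL2_F3_def invertible_to_mat)

section \<open>Additive reduction and rational points of order three\<close>

locale valued_subfield =
  fixes K :: "'a::field set" and v :: "'a \<Rightarrow> int"
  assumes K: "is_subfield K" and v: "discrete_valuation_on K v"
begin

lemma v_mult: "x \<in> K \<Longrightarrow> y \<in> K \<Longrightarrow> x \<noteq> 0 \<Longrightarrow> y \<noteq> 0 \<Longrightarrow> v (x * y) = v x + v y"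
  and v_add: "x \<in> K \<Longrightarrow> y \<in> K \<Longrightarrow> x \<noteq> 0 \<Longrightarrow> y \<noteq> 0 \<Longrightarrow> x + y \<noteq> 0 \<Longrightarrow> min (v x) (v y) \<le> v (x + y)"
  using v by (auto simp: discrete_valuation_on_def)

lemma v_one: "v 1 = 0"
  using v_mult[of 1 1] is_subfieldD[OF K] by simp

lemma v_minus: "x \<in> K \<Longrightarrow> x \<noteq> 0 \<Longrightarrow> v (- x) = v x"
proof -
  assume x: "x \<in> K" "x \<noteq> 0"
  have m: "(-1) \<in> K" using is_subfieldD[OF K] by blast
  have "2 * v (- 1) = 0"
    using v_mult[OF m m] v_one by simp
  then show ?thesis
    using v_mult[OF m x(1)] x by simp
qed

lemma v_inverse: "x \<in> K \<Longrightarrow> x \<noteq> 0 \<Longrightarrow> v (inverse x) = - v x"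
  using v_mult[of x "inverse x"] v_one is_subfieldD(6)[OF K] by simp

lemma v_power: "x \<in> K \<Longrightarrow> x \<noteq> 0 \<Longrightarrow> v (x ^ n) = int n * v x"
  by (induction n) (simp_all add: v_one v_mult is_subfieldD(9)[OF K] algebra_simps)

text \<open>The powers of the maximal ideal, including fractional ones; 0 is added separately
  because \<open>v 0\<close> carries no meaning.\<close>

definition ideal_pow :: "int \<Rightarrow> 'a set" where
  "ideal_pow n = {x \<in> K. x = 0 \<or> n \<le> v x}"

lemma ideal_pow_K: "x \<in> ideal_pow n \<Longrightarrow> x \<in> K"
  by (simp add: ideal_pow_def)

lemma valuation_ring_eq: "valuation_ring K v = ideal_pow 0"
  by (simp add: valuation_ring_def ideal_pow_def)

lemma maximal_ideal_eq: "maximal_ideal K v = ideal_pow 1"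
  by (auto simp: maximal_ideal_def ideal_pow_def)

lemma ideal_pow_zero: "0 \<in> ideal_pow n"
  using is_subfieldD[OF K] by (simp add: ideal_pow_def)

lemma ideal_pow_add: "x \<in> ideal_pow n \<Longrightarrow> y \<in> ideal_pow n \<Longrightarrow> x + y \<in> ideal_pow n"
  using v_add[of x y] is_subfieldD(3)[OF K, of x y]
  by (cases "x = 0"; cases "y = 0"; cases "x + y = 0") (auto simp: ideal_pow_def min_def split: if_splits)

lemma ideal_pow_minus: "x \<in> ideal_pow n \<Longrightarrow> - x \<in> ideal_pow n"
  using v_minus[of x] is_subfieldD(5)[OF K, of x] by (auto simp: ideal_pow_def)

lemma ideal_pow_diff: "x \<in> ideal_pow n \<Longrightarrow> y \<in> ideal_pow n \<Longrightarrow> x - y \<in> ideal_pow n"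
  using ideal_pow_add[of x n "- y"] ideal_pow_minus by simp

lemma ideal_pow_mult: "x \<in> ideal_pow m \<Longrightarrow> y \<in> ideal_pow n \<Longrightarrow> x * y \<in> ideal_pow (m + n)"
  using v_mult[of x y] is_subfieldD(4)[OF K, of x y] by (auto simp: ideal_pow_def)

lemma ideal_pow_mono: "x \<in> ideal_pow m \<Longrightarrow> n \<le> m \<Longrightarrow> x \<in> ideal_pow n"
  by (auto simp: ideal_pow_def)

lemma ideal_pow_absorb: "x \<in> ideal_pow 0 \<Longrightarrow> y \<in> ideal_pow n \<Longrightarrow> x * y \<in> ideal_pow n"
  "y \<in> ideal_pow n \<Longrightarrow> x \<in> ideal_pow 0 \<Longrightarrow> y * x \<in> ideal_pow n"
  using ideal_pow_mult[of x 0 y n] ideal_pow_mult[of y n x 0] by simp_all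

lemma ideal_pow_one: "1 \<in> ideal_pow 0" "1 \<notin> ideal_pow 1"
  using is_subfieldD[OF K] by (simp_all add: ideal_pow_def v_one)

lemma ideal_pow_numeral: "numeral k \<in> ideal_pow 0"
proof -
  have "of_nat n \<in> ideal_pow 0" for n
    by (induction n) (auto simp: ideal_pow_zero ideal_pow_one ideal_pow_add)
  from this[of "numeral k"] show ?thesis by simp
qed

lemma ideal_pow_power: "x \<in> ideal_pow 0 \<Longrightarrow> x ^ n \<in> ideal_pow 0"
  by (induction n) (auto simp: ideal_pow_one ideal_pow_absorb)

lemmas integral = ideal_pow_add ideal_pow_diff ideal_pow_minus ideal_pow_absorb(2) ideal_pow_numeral
  ideal_pow_power ideal_pow_zero ideal_pow_one(1)

lemma prime: "x \<in> ideal_pow 0 \<Longrightarrow> y \<in> ideal_pow 0 \<Longrightarrow> x * y \<in> ideal_pow 1 \<Longrightarrow> x \<in> ideal_pow 1 \<or> y \<in> ideal_pow 1"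
  using v_mult[of x y] by (auto simp: ideal_pow_def)

lemma prime_power: "x \<in> ideal_pow 0 \<Longrightarrow> x ^ n \<in> ideal_pow 1 \<Longrightarrow> x \<in> ideal_pow 1"
proof (induction n)
  case (Suc n)
  then show ?case using prime[of x "x ^ n"] ideal_pow_power by auto
qed (simp add: ideal_pow_one)

lemma inverse_mem: "x \<in> K \<Longrightarrow> x \<notin> ideal_pow 0 \<Longrightarrow> inverse x \<in> ideal_pow 1"
  using v_inverse[of x] is_subfieldD(6)[OF K, of x] by (auto simp: ideal_pow_def)

lemma integral_if_root:
  assumes "x \<in> K" and "a \<in> ideal_pow 0" "a \<notin> ideal_pow 1"
    and "b \<in> ideal_pow 0" "c \<in> ideal_pow 0" "d \<in> ideal_pow 0" "e \<in> ideal_pow 0"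
    and root: "a * x^4 + b * x^3 + c * x^2 + d * x + e = 0"
  shows "x \<in> ideal_pow 0"
proof (rule ccontr)
  assume "x \<notin> ideal_pow 0"
  define z where "z = inverse x"
  have z: "z \<in> ideal_pow 1" and "x \<noteq> 0"
    using inverse_mem[OF assms(1) \<open>x \<notin> ideal_pow 0\<close>] \<open>x \<notin> ideal_pow 0\<close> ideal_pow_zero by (auto simp: z_def)
  then have z0: "z \<in> ideal_pow 0" using ideal_pow_mono by force
  have xz: "x * z = 1" using \<open>x \<noteq> 0\<close> by (simp add: z_def)
  \<comment> \<open>The equation divided by \<open>x^4\<close>: a root of negative valuation would
    make the unit \<open>a\<close> divisible by \<open>z\<close>.\<close>
  have "a = z * - (b + (c + (d + e * z) * z) * z)"
    using root xz by Groebner_Basis.algebra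
  moreover have "z * - (b + (c + (d + e * z) * z) * z) \<in> ideal_pow 1"
    using assms(4-7) z z0 by (intro integral) auto
  ultimately show False using assms(3) by simp
qed

lemma integral_if_monic_root:
  assumes "x \<in> K" "b \<in> ideal_pow 0" "c \<in> ideal_pow 0" and root: "x^2 + b * x + c = 0"
  shows "x \<in> ideal_pow 0"
proof (rule integral_if_root[OF assms(1) ideal_pow_one, of b c 0 0])
  \<comment> \<open>The quadratic equation is multiplied by \<open>x^2\<close> to fit the quartic
    criterion.\<close>
  have "1 * x^4 + b * x^3 + c * x^2 + 0 * x + 0 = x^2 * (x^2 + b * x + c)"
    by (simp add: algebra_simps eval_nat_numeral)
  then show "1 * x^4 + b * x^3 + c * x^2 + 0 * x + 0 = 0" using root by simp
qed (use assms ideal_pow_zero in auto)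

text \<open>The reduced curve has a cusp at \<open>(x, y)\<close> with tangent slope
  \<open>c\<close>, and it turns out to be \<open>y^2 = x^3\<close> with its cusp at the origin.
  Since 2 may lie in the maximal ideal, the coordinates cannot be solved for directly; instead
  \<open>c\<close> is shown to vanish in the residue field, and \<open>a\<close>, \<open>x\<close>,
  \<open>y\<close>, \<open>b\<close> follow in turn.\<close>

lemma deuring_cusp:
  assumes 3: "3 \<notin> ideal_pow 1"
    and int: "a \<in> ideal_pow 0" "b \<in> ideal_pow 0" "x \<in> ideal_pow 0" "y \<in> ideal_pow 0" "c \<in> ideal_pow 0"
    and m: "a + 2 * c \<in> ideal_pow 1" "3 * x + c^2 \<in> ideal_pow 1" "2 * y + a * x + b \<in> ideal_pow 1"
      "a * y - 3 * x^2 \<in> ideal_pow 1" "y^2 + a * x * y + b * y - x^3 \<in> ideal_pow 1"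
  shows "a \<in> ideal_pow 1" "b \<in> ideal_pow 1"
proof -
  define al where "al = a + 2 * c"
  define be where "be = 3 * x + c^2"
  define ga where "ga = 2 * y + a * x + b"
  define ep where "ep = a * y - 3 * x^2"
  define om where "om = y^2 + a * x * y + b * y - x^3"
  note defs = al_def be_def ga_def ep_def om_def
  have m: "al \<in> ideal_pow 1" "be \<in> ideal_pow 1" "ga \<in> ideal_pow 1" "ep \<in> ideal_pow 1" "om \<in> ideal_pow 1"
    unfolding defs by (fact m)+
  have "c * (c * x - 2 * y) = ep - al * y + be * x"
    unfolding defs by Groebner_Basis.algebra
  also have "\<dots> \<in> ideal_pow 1" using m int by (intro integral)
  finally have "c \<in> ideal_pow 1 \<or> c * x - 2 * y \<in> ideal_pow 1"
    using int by (intro prime) (auto intro!: integral)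
  moreover have "c \<in> ideal_pow 1" if d: "c * x - 2 * y \<in> ideal_pow 1"
  proof -
    define de where "de = c * x - 2 * y"
    have d: "de \<in> ideal_pow 1" using d by (simp add: de_def)
    have de0: "de \<in> ideal_pow 0" using d ideal_pow_mono by force
    have "x^3 = de * (2 * c * x - de) + ga * (4 * y) - om * 4 - be * x^2"
      unfolding defs de_def by Groebner_Basis.algebra
    also have "\<dots> \<in> ideal_pow 1" using m int d de0 by (intro integral)
    finally have x: "x \<in> ideal_pow 1" using prime_power int by blast
    have "c^2 = be - x * 3" by (simp add: be_def)
    also have "\<dots> \<in> ideal_pow 1" using x m by (intro integral)
    finally show ?thesis using prime_power int by blast
  qed
  ultimately have c: "c \<in> ideal_pow 1" by blast
  have "a = al - c * 2" by (simp add: al_def)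
  also have "\<dots> \<in> ideal_pow 1" using c m by (intro integral)
  finally show "a \<in> ideal_pow 1" .
  have "3 * x = be - c * c" by (simp add: be_def power2_eq_square)
  also have "\<dots> \<in> ideal_pow 1" using c int m by (intro integral)
  finally have x: "x \<in> ideal_pow 1" using prime[OF ideal_pow_numeral int(3)] 3 by blast
  have "y^2 = ga * y - x * x^2 - om"
    unfolding defs by Groebner_Basis.algebra
  also have "\<dots> \<in> ideal_pow 1" using x int m by (intro integral)
  finally have y: "y \<in> ideal_pow 1" using prime_power int by blast
  have "b = ga - y * 2 - x * a" by (simp add: ga_def)
  also have "\<dots> \<in> ideal_pow 1" using x y int m by (intro integral)
  finally show "b \<in> ideal_pow 1" .
qed

text \<open>With \<open>v b\<close> equal to 1 or 2, the outer terms have valuations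
  \<open>3 * k\<close> and \<open>2 * v b\<close>, which never agree, and the middle terms have a
  valuation above the smaller of the two. So a single term dominates.\<close>

lemma deuring_no_root:
  assumes 3: "3 \<notin> ideal_pow 1" and a: "a \<in> ideal_pow 1" and b: "b \<in> ideal_pow 1" "b \<notin> ideal_pow 3"
    and z: "z \<in> ideal_pow 0"
  shows "3 * z^3 + a^2 * z^2 + 3 * a * b * z + 3 * b^2 \<noteq> 0"
proof
  assume root: "3 * z^3 + a^2 * z^2 + 3 * a * b * z + 3 * b^2 = 0"
  have 3: "(3::'a) \<noteq> 0" "v 3 = 0" "3 \<in> K"
    using 3 ideal_pow_numeral[of "num.Bit1 num.One"] ideal_pow_zero[of 1] by (auto simp: ideal_pow_def)
  have v3: "v (3 * x ^ n) = int n * v x" if "x \<in> K" "x \<noteq> 0" for x n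
    using v_mult[of 3 "x ^ n"] v_power[OF that, of n] that 3 is_subfieldD(9)[OF K that(1)] by simp
  have bK: "b \<in> K" "b \<noteq> 0" "v b = 1 \<or> v b = 2" using b is_subfieldD(1)[OF K] by (auto simp: ideal_pow_def)
  have z0: "z \<noteq> 0" using root bK 3 by auto
  have zK: "z \<in> K" "0 \<le> v z" using z z0 by (auto simp: ideal_pow_def)
  define k where "k = v z"
  have zk: "z \<in> ideal_pow k" using zK by (simp add: ideal_pow_def k_def)
  have bb: "b \<in> ideal_pow (v b)" using bK by (simp add: ideal_pow_def)
  have t1: "3 * z^3 \<in> ideal_pow (3 * k)"
    using v3[OF zK(1) z0, of 3] 3 is_subfieldD[OF K] zK by (auto simp: ideal_pow_def k_def)
  have t2: "a^2 * z^2 \<in> ideal_pow (2 + 2 * k)"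
    using ideal_pow_mult[OF ideal_pow_mult[OF a a] ideal_pow_mult[OF zk zk]] by (simp add: power2_eq_square)
  have t3: "3 * a * b * z \<in> ideal_pow (1 + v b + k)"
    using ideal_pow_mult[OF ideal_pow_mult[OF ideal_pow_absorb(1)[OF ideal_pow_numeral a] bb] zk] .
  have t4: "3 * b^2 \<in> ideal_pow (2 * v b)"
    using v3[OF bK(1,2), of 2] 3 is_subfieldD[OF K] bK by (auto simp: ideal_pow_def)
  have "3 * b^2 = - (3 * z^3 + a^2 * z^2 + 3 * a * b * z)" "3 * z^3 = - (a^2 * z^2 + 3 * a * b * z + 3 * b^2)"
    using root by Groebner_Basis.algebra+
  note e = this
  have w: "v (3 * b^2) = 2 * v b" "3 * b^2 \<noteq> 0" "v (3 * z^3) = 3 * k" "3 * z^3 \<noteq> 0"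
    using v3[OF bK(1,2), of 2] v3[OF zK(1) z0, of 3] 3 bK z0 by (auto simp: k_def)
  have B: "n \<le> 2 * v b" if "3 * z^3 + a^2 * z^2 + 3 * a * b * z \<in> ideal_pow n" for n
    using ideal_pow_minus[OF that] w(1,2) unfolding e(1)[symmetric] by (simp add: ideal_pow_def)
  have Z: "n \<le> 3 * k" if "a^2 * z^2 + 3 * a * b * z + 3 * b^2 \<in> ideal_pow n" for n
    using ideal_pow_minus[OF that] w(3,4) unfolding e(2)[symmetric] by (simp add: ideal_pow_def)
  have B': "n \<le> 2 * v b" if "n \<le> 3 * k" "n \<le> 2 + 2 * k" "n \<le> 1 + v b + k" for n
    using B ideal_pow_add[OF ideal_pow_add] ideal_pow_mono[OF t1 that(1)] ideal_pow_mono[OF t2 that(2)]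
      ideal_pow_mono[OF t3 that(3)] by blast
  have Z': "n \<le> 3 * k" if "n \<le> 2 * v b" "n \<le> 2 + 2 * k" "n \<le> 1 + v b + k" for n
    using Z ideal_pow_add[OF ideal_pow_add] ideal_pow_mono[OF t4 that(1)] ideal_pow_mono[OF t2 that(2)]
      ideal_pow_mono[OF t3 that(3)] by blast
  have k: "0 \<le> k" using zK by (simp add: k_def)
  show False
    \<comment> \<open>\<open>B'\<close> excludes large \<open>k\<close>, where the constant term
      dominates, and \<open>Z'\<close> small \<open>k\<close>, where the cubic term does; the
      numbers are one more than the valuation \<open>2 * v b\<close> for \<open>B'\<close> and
      bounds above \<open>3 * k\<close> for \<open>Z'\<close>.\<close>
    using Z'[of 2] Z'[of 4] B'[of 3] B'[of 5] k bK(3) by auto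
qed

lemma three_not_mem:
  assumes "residue_char K v \<noteq> 3"
  shows "3 \<notin> ideal_pow 1"
proof
  assume three: "3 \<in> ideal_pow 1"
  define n where "n = residue_char K v"
  have "0 < n \<and> of_nat n \<in> ideal_pow 1"
    unfolding n_def residue_char_def maximal_ideal_eq by (rule LeastI[of _ 3]) (use three in simp)
  moreover have "n \<le> 3"
    unfolding n_def residue_char_def maximal_ideal_eq by (rule Least_le) (use three in simp)
  ultimately have "n = 1 \<or> n = 2" "of_nat n \<in> ideal_pow 1" using assms by (auto simp: n_def)
  then have "1 \<in> ideal_pow 1" using ideal_pow_diff[OF three, of 2] by auto
  then show False using ideal_pow_one by blast
qed

text \<open>Translating a rational flex to the origin gives an integral model with only \<open>a1\<close> and \<open>a3\<close>
  nonzero. Additive reduction makes both of them divisible by a uniformiser, and minimality bounds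
  the valuation of \<open>a3\<close> by 2; then the Newton polygon of the remaining cubic has no integral slope.\<close>

lemma minimal_cusp_unique_rational_flex:
  assumes 3: "3 \<notin> ideal_pow 1" and minimal: "minimal_weierstrass K v W" and cusp: "cusp_mod K v W xc yc"
    and disc: "disc W \<noteq> 0"
    and P: "(x, y) \<in> flexes W" "x \<in> K" "y \<in> K" "2 * y + a1 W * x + a3 W \<noteq> 0"
    and Q: "poly (g_poly W) x' = 0" "x' \<in> K"
  shows "x' = x"
proof (rule ccontr)
  assume ne: "x' \<noteq> x"
  have W: "a1 W \<in> ideal_pow 0" "a2 W \<in> ideal_pow 0" "a3 W \<in> ideal_pow 0" "a4 W \<in> ideal_pow 0" "a6 W \<in> ideal_pow 0"
    using minimal by (auto simp: minimal_weierstrass_def coeffs_in_def valuation_ring_eq)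
  have bint: "b2 W \<in> ideal_pow 0" "b4 W \<in> ideal_pow 0" "b6 W \<in> ideal_pow 0" "b8 W \<in> ideal_pow 0"
    unfolding b_defs using W by (auto intro!: integral)
  have g_int: "u \<in> ideal_pow 0" if "poly (g_poly W) u = 0" "u \<in> K" for u
  proof (rule integral_if_root[OF that(2) ideal_pow_numeral 3])
    show "3 * u^4 + b2 W * u^3 + (3 * b4 W) * u^2 + (3 * b6 W) * u + b8 W = 0"
      using that(1) by (simp add: poly_g_poly)
  qed (use bint in \<open>auto intro!: integral\<close>)
  have x: "x \<in> ideal_pow 0" and x': "x' \<in> ideal_pow 0" using g_int P Q by (auto simp: flexes_def)
  have w: "weq W x y = 0" using P by (simp add: flexes_def)
  have y: "y \<in> ideal_pow 0"
  proof (rule integral_if_monic_root[OF P(3)])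
    show "y^2 + (a1 W * x + a3 W) * y + - (x^3 + a2 W * x^2 + a4 W * x + a6 W) = 0"
      using w by (simp add: weq_def algebra_simps)
  qed (use W x in \<open>auto intro!: integral\<close>)
  define l where "l = (3 * x^2 + 2 * a2 W * x + a4 W - a1 W * y) / (2 * y + a1 W * x + a3 W)"
  have KW: "a1 W \<in> K" "a2 W \<in> K" "a3 W \<in> K" "a4 W \<in> K" using W ideal_pow_K by blast+
  have lK: "l \<in> K"
    unfolding l_def using KW P by (auto intro!: is_subfieldD[OF K])
  have slope: "l^2 + a1 W * l = a2 W + 3 * x"
    using flex_slope[OF P(1,4)] by (simp add: l_def)
  have l: "l \<in> ideal_pow 0"
  proof (rule integral_if_monic_root[OF lK])
    show "l^2 + a1 W * l + - (a2 W + 3 * x) = 0" using slope by simp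
  qed (use W x in \<open>auto intro!: integral\<close>)
  define a where "a = a1 W + 2 * l"
  define b where "b = 2 * y + a1 W * x + a3 W"
  have D: "change_vars 1 x l y W = Weierstrass a 0 b 0 0"
    using flex_deuring[OF P(1,4)] by (simp add: l_def a_def b_def)
  have ab: "a \<in> ideal_pow 0" "b \<in> ideal_pow 0"
    unfolding a_def b_def using W x y l by (auto intro!: integral)
  have tang: "l * (2 * y + a1 W * x + a3 W) = 3 * x^2 + 2 * a2 W * x + a4 W - a1 W * y"
    using P(4) by (simp add: l_def)
  obtain c where sing: "xc \<in> ideal_pow 0" "yc \<in> ideal_pow 0" "weq W xc yc \<in> ideal_pow 1"
    "a1 W * yc - (3 * xc^2 + 2 * a2 W * xc + a4 W) \<in> ideal_pow 1" "2 * yc + a1 W * xc + a3 W \<in> ideal_pow 1"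
    and c: "c \<in> ideal_pow 0" "a1 W + 2 * c \<in> ideal_pow 1" "a2 W + 3 * xc + c^2 \<in> ideal_pow 1"
    using cusp unfolding cusp_mod_def singular_mod_def valuation_ring_eq maximal_ideal_eq by blast
  \<comment> \<open>The cusp in the coordinates of the Deuring model, where its tangent slope
    becomes \<open>c - l\<close>.\<close>
  define p where "p = xc - x"
  define q where "q = yc - y - l * p"
  have am: "a \<in> ideal_pow 1" and bm: "b \<in> ideal_pow 1"
  proof -
    have pq: "p \<in> ideal_pow 0" "q \<in> ideal_pow 0" "c - l \<in> ideal_pow 0"
      unfolding p_def q_def using x y l sing c by (auto intro!: integral)
    have 1: "a + 2 * (c - l) \<in> ideal_pow 1" using c(2) by (simp add: a_def algebra_simps)
    define e1 where "e1 = a1 W + 2 * c"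
    define e2 where "e2 = a2 W + 3 * xc + c^2"
    define e3 where "e3 = a1 W * yc - (3 * xc^2 + 2 * a2 W * xc + a4 W)"
    define e4 where "e4 = 2 * yc + a1 W * xc + a3 W"
    have e: "e1 \<in> ideal_pow 1" "e2 \<in> ideal_pow 1" "e3 \<in> ideal_pow 1" "e4 \<in> ideal_pow 1"
      using sing c by (simp_all add: e1_def e2_def e3_def e4_def)
    have "3 * p + (c - l)^2 = e2 - e1 * l"
      unfolding p_def e1_def e2_def using slope by Groebner_Basis.algebra
    also have "\<dots> \<in> ideal_pow 1" using e l by (intro integral)
    finally have 2: "3 * p + (c - l)^2 \<in> ideal_pow 1" .
    have "2 * q + a * p + b = 2 * yc + a1 W * xc + a3 W"
      unfolding p_def q_def a_def b_def by Groebner_Basis.algebra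
    then have 3: "2 * q + a * p + b \<in> ideal_pow 1" using sing by simp
    have "a * q - 3 * p^2 = e3 + e4 * l"
      unfolding e3_def e4_def p_def q_def a_def using slope tang by Groebner_Basis.algebra
    also have "\<dots> \<in> ideal_pow 1" using e l by (intro integral)
    finally have 4: "a * q - 3 * p^2 \<in> ideal_pow 1" .
    have "weq W xc yc = weq (Weierstrass a 0 b 0 0) p q"
      using change_vars_weq[of 1 W p x q l y] unfolding D by (simp add: p_def q_def algebra_simps)
    then have 5: "q^2 + a * p * q + b * q - p^3 \<in> ideal_pow 1" using sing by (simp add: weq_def)
    show "a \<in> ideal_pow 1" "b \<in> ideal_pow 1"
      using deuring_cusp[OF assms(1) ab pq 1 2 3 4 5] by blast+
  qed
  \<comment> \<open>Otherwise a uniformiser \<open>u\<close> could be scaled out, \<open>u\<close>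
    dividing \<open>a\<close> and \<open>u^3\<close> dividing \<open>b\<close>, which lowers the
    valuation of the discriminant by 12.\<close>
  have "b \<notin> ideal_pow 3"
  proof
    assume b3: "b \<in> ideal_pow 3"
    obtain u where u: "u \<in> K" "u \<noteq> 0" "v u = 1"
      using v unfolding discrete_valuation_on_def by (metis (no_types) Diff_iff UNIV_I imageE singletonI)
    have vu: "v (inverse u) = - 1" "inverse u \<in> K" using v_inverse[OF u(1,2)] u(3) is_subfieldD(6)[OF K u(1)] by auto
    then have "inverse u \<in> ideal_pow (- 1)" by (simp add: ideal_pow_def)
    then have i: "inverse u \<in> ideal_pow (- 1)" "inverse (u^3) \<in> ideal_pow (- 3)"
      using v_inverse[of "u^3"] v_power[OF u(1,2), of 3] u is_subfieldD[OF K] by (auto simp: ideal_pow_def)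
    define D' where "D' = change_vars u x l y W"
    \<comment> \<open>These numerators vanish in the model with scaling factor 1 and do not involve
      the factor, so they vanish for \<open>u\<close> too.\<close>
    have "a2 W - l * a1 W + 3 * x - l^2 = 0" 
      "a4 W - l * a3 W + 2 * x * a2 W - (y + x * l) * a1 W + 3 * x^2 - 2 * l * y = 0"
      "a6 W + x * a4 W + x^2 * a2 W + x^3 - y * a3 W - y^2 - x * y * a1 W = 0"
      using D by (simp_all add: change_vars_def)
    then have D': "D' = Weierstrass (a * inverse u) 0 (b * inverse (u^3)) 0 0"
      by (simp add: D'_def change_vars_def a_def b_def divide_inverse algebra_simps)
    have "a * inverse u \<in> ideal_pow 0" "b * inverse (u^3) \<in> ideal_pow 0"
      using ideal_pow_mult[OF am i(1)] ideal_pow_mult[OF b3 i(2)] by simp_all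
    then have "coeffs_in (valuation_ring K v) D'"
      by (simp add: D' coeffs_in_def valuation_ring_eq ideal_pow_zero)
    moreover have "D' \<in> weierstrass_models K W"
      unfolding weierstrass_models_def D'_def using u P lK by blast
    ultimately have le: "v (disc W) \<le> v (disc D')"
      using minimal by (simp add: minimal_weierstrass_def)
    have e: "disc W = u^12 * disc D'" unfolding D'_def by (rule change_vars_disc[OF u(2)])
    have "disc W \<in> K" unfolding disc_def using bint ideal_pow_K by (auto intro!: is_subfieldD[OF K])
    have "disc D' = disc W / u^12" using e u(2) by simp
    then have "disc D' \<in> K" using \<open>disc W \<in> K\<close> u is_subfieldD[OF K] by simp
    have "v (disc W) = 12 + v (disc D')"
      unfolding e using v_mult[of "u^12" "disc D'"] v_power[OF u(1,2), of 12] \<open>disc D' \<in> K\<close> disc e u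
        is_subfieldD(9)[OF K u(1)] by auto
    with le show False by simp
  qed
  moreover have "3 * (x' - x)^3 + a^2 * (x' - x)^2 + 3 * a * b * (x' - x) + 3 * b^2 = 0"
    using change_vars_g_poly[of 1 W "x' - x" x l y] Q(1) ne unfolding D by (simp add: g_poly_deuring)
  moreover have "x' - x \<in> ideal_pow 0" using x x' by (intro integral)
  ultimately show False using deuring_no_root[OF assms(1) am bm] by blast
qed

end

lemma three_nonzero:
  fixes K :: "'a::field set"
  assumes "nonarch_local_field K v" "residue_char K v \<noteq> 3"
  shows "(3::'a) \<noteq> 0"
proof -
  interpret valued_subfield K v
    using assms(1) by unfold_locales (auto simp: nonarch_local_field_def intro: is_subfield_if_subfield)
  show ?thesis using three_not_mem[OF assms(2)] ideal_pow_zero[of 1] by auto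
qed

text \<open>The cusp is given on some minimal model over \<open>K\<close>. A change of variables
  over \<open>K\<close> maps rational flexes and rational roots of \<open>g\<close> to such, so the
  question can be settled there.\<close>

lemma additive_unique_rational_flex:
  fixes K :: "'a::field set"
  assumes "nonarch_local_field K v" "residue_char K v \<noteq> 3" "additive_reduction K v E" "disc E \<noteq> 0"
    and P: "(x, y) \<in> flexes E" "x \<in> K" "y \<in> K" "2 * y + a1 E * x + a3 E \<noteq> 0"
    and Q: "poly (g_poly E) x' = 0" "x' \<in> K"
  shows "x' = x"
proof -
  have K: "is_subfield K" using assms(1) by (auto simp: nonarch_local_field_def intro: is_subfield_if_subfield)
  interpret valued_subfield K v
    using assms(1) K by unfold_locales (auto simp: nonarch_local_field_def)
  note 3 = three_not_mem[OF assms(2)]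
  obtain W xc yc where W: "W \<in> weierstrass_models K E" "minimal_weierstrass K v W" "cusp_mod K v W xc yc"
    using assms(3) by (auto simp: additive_reduction_def)
  obtain u r s t where u: "W = change_vars u r s t E" "u \<in> K" "r \<in> K" "s \<in> K" "t \<in> K" "u \<noteq> 0"
    using W(1) by (auto simp: weierstrass_models_def)
  define px where "px z = (z - r) / u^2" for z
  define py where "py = (y - s * u^2 * px x - t) / u^3"
  have px: "u^2 * px z + r = z" for z using u(6) by (simp add: px_def)
  have py: "u^3 * py + s * u^2 * px x + t = y" using u(6) by (simp add: py_def)
  have g: "poly (g_poly E) z = u^8 * poly (g_poly W) (px z)" for z
    using change_vars_g_poly[OF u(6), of E "px z" r s t] by (simp add: px u(1))
  have pxK: "px z \<in> K" if "z \<in> K" for z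
    unfolding px_def using that u by (auto intro!: is_subfieldD[OF K])
  have "px x' = px x"
  proof (rule minimal_cusp_unique_rational_flex[OF 3 W(2,3)])
    show "disc W \<noteq> 0" using change_vars_disc[OF u(6), of E r s t] assms(4) by (auto simp: u(1))
    have "weq W (px x) py = 0"
      using change_vars_weq[OF u(6), of E "px x" r py s t] P(1) u(6) unfolding px py
      by (simp add: flexes_def u(1))
    then show "(px x, py) \<in> flexes W" using g[of x] P(1) u(6) by (simp add: flexes_def)
    show "px x \<in> K" "px x' \<in> K" using pxK P Q by blast+
    show "py \<in> K" unfolding py_def using pxK[OF P(2)] P u by (auto intro!: is_subfieldD[OF K])
    have "2 * y + a1 E * x + a3 E = u^3 * (2 * py + a1 W * px x + a3 W)"
      using change_vars_coeffs(1,3)[OF u(6,1)] px[of x] py by Groebner_Basis.algebra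
    then show "2 * py + a1 W * px x + a3 W \<noteq> 0" using P(4) by auto
    show "poly (g_poly W) (px x') = 0" using g[of x'] Q(1) u(6) by simp
  qed
  then show ?thesis using px by metis
qed

section \<open>The Galois action on the points of order three\<close>

definition pt :: "'a \<times> 'a \<Rightarrow> 'a point" where
  "pt = (\<lambda>(x, y). Affine x y)"

lemma pt_inj [simp]: "pt A = pt B \<longleftrightarrow> A = B" "pt A \<noteq> Infinity" "Infinity \<noteq> pt A"
  by (auto simp: pt_def split: prod.splits)

text \<open>All six orders are listed, so that the addition table can be verified by rewriting
  alone.\<close>

definition sums_to_zero :: "'a::field weierstrass \<Rightarrow> 'a \<times> 'a \<Rightarrow> 'a \<times> 'a \<Rightarrow> 'a \<times> 'a \<Rightarrow> bool" where
  "sums_to_zero E A B C \<longleftrightarrow>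
     point_add E (pt A) (pt B) = pt (neg E C) \<and> point_add E (pt B) (pt A) = pt (neg E C) \<and>
     point_add E (pt A) (pt C) = pt (neg E B) \<and> point_add E (pt C) (pt A) = pt (neg E B) \<and>
     point_add E (pt B) (pt C) = pt (neg E A) \<and> point_add E (pt C) (pt B) = pt (neg E A)"

lemma card_roots_le_4:
  assumes "(3::'a::field) \<noteq> 0"
  shows "finite {x::'a. poly (g_poly E) x = 0}" "card {x::'a. poly (g_poly E) x = 0} \<le> 4"
proof -
  have d: "Polynomial.degree (g_poly E) = 4" "g_poly E \<noteq> 0"
    using assms by (auto simp: g_poly_def)
  show "finite {x. poly (g_poly E) x = 0}" using d by (simp add: poly_roots_finite)
  show "card {x. poly (g_poly E) x = 0} \<le> 4" using card_poly_roots_bound[OF d(2)] d(1) by simp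
qed

locale flex_basis =
  fixes E :: "'a::field weierstrass" and P Q :: "'a \<times> 'a"
  assumes three: "(3::'a) \<noteq> 0" and nz: "psi2_nonzero E"
    and P: "P \<in> flexes E" and Q: "Q \<in> flexes E" and PQ: "fst P \<noteq> fst Q"
begin

text \<open>The third points on the lines through \<open>P\<close>, \<open>Q\<close> and through \<open>P\<close>, \<open>-Q\<close>, so that \<open>P + Q = -C1\<close> and
  \<open>P - Q = -C2\<close> in the group law.\<close>

definition C1 where "C1 = third E P Q"
definition C2 where "C2 = third E P (neg E Q)"

lemma third6:
  assumes "A \<in> flexes E" "B \<in> flexes E" "fst A \<noteq> fst B" "third E A B = C"
  shows "third E B A = C" "third E A C = B" "third E C A = B" "third E B C = A" "third E C B = A"
proof -
  note t = third_flex[OF nz assms(1-3), unfolded assms(4)]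
  show BA: "third E B A = C" using third_commute[OF assms(3)] assms(4) by metis
  show AC: "third E A C = B" using third_third[OF assms(3)] t(2) assms(4) by metis
  show "third E C A = B" using third_commute[of A C E] AC t(2) by metis
  show BC: "third E B C = A" using third_third[of B A E] assms(3) t(3) BA by metis
  show "third E C B = A" using third_commute[of B C E] BC t(3) by metis
qed

lemma sums_to_zeroI:
  assumes "A \<in> flexes E" "B \<in> flexes E" "fst A \<noteq> fst B" "third E A B = C"
  shows "sums_to_zero E A B C" "sums_to_zero E (neg E A) (neg E B) (neg E C)"
proof -
  have *: "sums_to_zero E A B C"
    if "A \<in> flexes E" "B \<in> flexes E" "fst A \<noteq> fst B" "third E A B = C" for A B C
  proof -
    note t = third_flex[OF nz that(1-3), unfolded that(4)]
    show ?thesis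
      unfolding sums_to_zero_def pt_def
      using point_add_third[of A B E] point_add_third[of B A E] point_add_third[of A C E]
        point_add_third[of C A E] point_add_third[of B C E] point_add_third[of C B E]
        third6[OF that] that(3,4) t(2,3) by metis
  qed
  show "sums_to_zero E A B C" using *[OF assms] .
  show "sums_to_zero E (neg E A) (neg E B) (neg E C)"
    by (rule *) (use assms third_neg[of A B E] in auto)
qed

lemma C1: "C1 \<in> flexes E" "fst C1 \<noteq> fst P" "fst C1 \<noteq> fst Q"
  using third_flex[OF nz P Q PQ] by (simp_all add: C1_def)

lemma C2: "C2 \<in> flexes E" "fst C2 \<noteq> fst P" "fst C2 \<noteq> fst Q"
  using third_flex[OF nz P, of "neg E Q"] Q PQ by (simp_all add: C2_def)

text \<open>Equal abscissas would mean that \<open>P + Q\<close> and \<open>P - Q\<close> agree up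
  to sign, so that \<open>Q\<close> or \<open>P\<close> would be its own negative.\<close>

lemma C12: "fst C1 \<noteq> fst C2"
proof
  assume "fst C1 = fst C2"
  note t1 = third6[OF P Q PQ C1_def[symmetric]]
  have t2: "third E P C2 = neg E Q" "third E (neg E Q) C2 = P"
    using third6[OF P _ _ C2_def[symmetric]] Q PQ by simp_all
  from flexes_same_x[OF C1(1) C2(1) \<open>fst C1 = fst C2\<close>] show False
  proof
    assume "C2 = C1"
    then have "neg E Q = Q" using t1 t2 by simp
    then show False using neg_neq[OF nz Q] by simp
  next
    assume "C2 = neg E C1"
    then have "neg E (third E Q C1) = P" using t2(2) third_neg[of Q C1 E] C1 by metis
    then have "neg E P = P" using t1 by simp
    then show False using neg_neq[OF nz P] by simp
  qed
qed

lemma roots_eq: "{x. poly (g_poly E) x = 0} = {fst P, fst Q, fst C1, fst C2}"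
proof -
  have "{fst P, fst Q, fst C1, fst C2} \<subseteq> {x. poly (g_poly E) x = 0}"
    using P Q C1(1) C2(1) by (auto simp: flexes_def)
  moreover have "card {fst P, fst Q, fst C1, fst C2} = 4"
    using PQ C1 C2 C12 by auto
  ultimately show ?thesis
    using card_roots_le_4[OF three, of E] by (metis card_seteq)
qed

lemma flexes_eq: "flexes E = {P, neg E P, Q, neg E Q, C1, neg E C1, C2, neg E C2}"
proof
  show "flexes E \<subseteq> {P, neg E P, Q, neg E Q, C1, neg E C1, C2, neg E C2}"
  proof
    fix A assume A: "A \<in> flexes E"
    then have "fst A \<in> {fst P, fst Q, fst C1, fst C2}"
      unfolding roots_eq[symmetric] by (auto simp: flexes_def)
    then show "A \<in> {P, neg E P, Q, neg E Q, C1, neg E C1, C2, neg E C2}"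
      using flexes_same_x[OF P A] flexes_same_x[OF Q A] flexes_same_x[OF C1(1) A] flexes_same_x[OF C2(1) A]
      by auto
  qed
qed (use P Q C1 C2 in auto)

text \<open>The expected value comes from \<open>C1 + C2 = - 2 P = P\<close>. Instead of
  associativity, the list of all eight flexes is used: the remaining candidates would force two
  different points to coincide.\<close>

lemma third_C1_C2: "third E C1 C2 = neg E P"
proof -
  define D where "D = third E C1 C2"
  have D: "D \<in> flexes E" "fst D \<noteq> fst C1" "fst D \<noteq> fst C2"
    using third_flex[OF nz C1(1) C2(1) C12] by (simp_all add: D_def)
  note t1 = third6[OF P Q PQ C1_def[symmetric]]
  have Q': "neg E Q \<in> flexes E" "fst P \<noteq> fst (neg E Q)" using Q PQ by simp_all
  note t2 = third6[OF P Q' C2_def[symmetric]]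
  note t3 = third6[OF C1(1) C2(1) C12 D_def[symmetric]]
  have "D \<noteq> P" using t3(2) t1(3) C2(3) by auto
  moreover have "D \<noteq> Q" using t3(2) t1(5) C2(2) by auto
  moreover have "D \<noteq> neg E Q" using t3(4) t2(5) C1(2) by auto
  ultimately show ?thesis
    using D unfolding flexes_eq D_def[symmetric] by auto
qed

lemma third_C1_neg_C2: "third E C1 (neg E C2) = neg E Q"
proof -
  define D where "D = third E C1 (neg E C2)"
  have C2': "neg E C2 \<in> flexes E" "fst C1 \<noteq> fst (neg E C2)" using C2 C12 by simp_all
  have D: "D \<in> flexes E" "fst D \<noteq> fst C1" "fst D \<noteq> fst C2"
    using third_flex[OF nz C1(1) C2'] by (simp_all add: D_def)
  note t1 = third6[OF P Q PQ C1_def[symmetric]]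
  have Q': "neg E Q \<in> flexes E" "fst P \<noteq> fst (neg E Q)" using Q PQ by simp_all
  note t2 = third6[OF P Q' C2_def[symmetric]]
  note t3 = third6[OF C1(1) C2' D_def[symmetric]]
  have nx: "neg E C2 = A \<Longrightarrow> fst C2 = fst A" for A by auto
  have "D \<noteq> P" using t3(2) t1(3) nx[of Q] C2(3) by auto
  moreover have "D \<noteq> Q" using t3(2) t1(5) nx[of P] C2(2) by auto
  moreover have "D \<noteq> neg E P"
  proof
    assume "D = neg E P"
    then have "C1 = neg E (third E C2 P)" using t3(4) third_neg[OF C2(2), of E] by metis
    then show False using t2(3) C1(3) by auto
  qed
  ultimately show ?thesis
    using D unfolding flexes_eq D_def[symmetric] by auto
qed

text \<open>The point \<open>i P + j Q\<close>, written out as a table; that the table is additive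
  is then a check of 81 sums.\<close>

definition phi :: "3 \<Rightarrow> 3 \<Rightarrow> 'a point" where
  "phi i j = (if i = 0 then (if j = 0 then Infinity else if j = 1 then pt Q else pt (neg E Q))
     else if i = 1 then (if j = 0 then pt P else if j = 1 then pt (neg E C1) else pt (neg E C2))
     else (if j = 0 then pt (neg E P) else if j = 1 then pt C2 else pt C1))"

lemma point_add_Infinity: "point_add E S Infinity = S"
  by (cases S) auto

lemma phi_add: "point_add E (phi i j) (phi k l) = phi (i + k) (j + l)"
proof -
  have Q': "neg E Q \<in> flexes E" "fst P \<noteq> fst (neg E Q)" using Q PQ by simp_all
  have C2': "neg E C2 \<in> flexes E" "fst C1 \<noteq> fst (neg E C2)" using C2 C12 by simp_all
  note s = sums_to_zeroI[OF P Q PQ C1_def[symmetric]] sums_to_zeroI[OF P Q' C2_def[symmetric]]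
    sums_to_zeroI[OF C1(1) C2(1) C12 third_C1_C2] sums_to_zeroI[OF C1(1) C2' third_C1_neg_C2]
  note s = s[unfolded sums_to_zero_def neg_simps]
  have d: "point_add E (pt A) (pt A) = pt (neg E A)" if "A \<in> flexes E" for A
    using point_add_flex_self[OF nz that] by (simp add: pt_def)
  have n: "point_add E (pt A) (pt (neg E A)) = Infinity" "point_add E (pt (neg E A)) (pt A) = Infinity" for A
    using point_add_neg[of E A] point_add_neg[of E "neg E A"] by (simp_all add: pt_def)
  have "\<forall>i j k l. point_add E (phi i j) (phi k l) = phi (i + k) (j + l)"
    unfolding f3_all phi_def using P Q C1(1) C2(1)
    by (simp add: s d n point_add_Infinity)
  then show ?thesis by blast
qed

lemma phi_inj: "phi i j = phi k l \<longleftrightarrow> i = k \<and> j = l"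
proof -
  have n: "neg E A \<noteq> A" "A \<noteq> neg E A" if "A \<in> flexes E" for A
    using neg_neq[OF nz that] by auto
  have x: "A \<noteq> B" "neg E A \<noteq> B" "B \<noteq> neg E A" "B \<noteq> A" if "fst A \<noteq> fst B" for A B :: "'a \<times> 'a"
    using that by auto
  note x' = x[OF PQ] x[OF C1(2)] x[OF C1(3)] x[OF C2(2)] x[OF C2(3)] x[OF C12]
    x[OF PQ[symmetric]] x[OF C1(2)[symmetric]] x[OF C1(3)[symmetric]] x[OF C2(2)[symmetric]]
    x[OF C2(3)[symmetric]] x[OF C12[symmetric]]
  have "\<forall>i j k l. phi i j = phi k l \<longleftrightarrow> i = k \<and> j = l"
    unfolding f3_all phi_def
    using P Q C1(1) C2(1) by (simp add: n x')
  then show ?thesis by blast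
qed

lemma phi_surj: "A \<in> flexes E \<Longrightarrow> \<exists>i j. pt A = phi i j"
proof -
  assume "A \<in> flexes E"
  moreover have "phi 1 0 = pt P" "phi 2 0 = pt (neg E P)" "phi 0 1 = pt Q" "phi 0 2 = pt (neg E Q)"
    "phi 2 2 = pt C1" "phi 1 1 = pt (neg E C1)" "phi 2 1 = pt C2" "phi 1 2 = pt (neg E C2)"
    by (simp_all add: phi_def)
  ultimately show ?thesis unfolding flexes_eq by (metis insertE singletonD)
qed

lemma phi_flex: "phi i j = Infinity \<or> (\<exists>A\<in>flexes E. phi i j = pt A)"
  using P Q C1 C2 by (auto simp: phi_def)

text \<open>The default 0 at \<open>Infinity\<close> is fixed by all automorphisms, which keeps
  equivariance free of exceptions.\<close>

definition xco :: "3 \<times> 3 \<Rightarrow> 'a" where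
  "xco = (\<lambda>(i, j). case phi i j of Infinity \<Rightarrow> 0 | Affine x y \<Rightarrow> x)"

lemma xco_simps [simp]:
  "xco (1, 0) = fst P" "xco (2, 0) = fst P" "xco (0, 1) = fst Q" "xco (0, 2) = fst Q"
  "xco (1, 1) = fst C1" "xco (2, 2) = fst C1" "xco (1, 2) = fst C2" "xco (2, 1) = fst C2"
proof -
  have "(case pt A of Infinity \<Rightarrow> 0 | Affine x y \<Rightarrow> x) = fst A" for A :: "'a \<times> 'a"
    by (simp add: pt_def split: prod.splits)
  then show "xco (1, 0) = fst P" "xco (2, 0) = fst P" "xco (0, 1) = fst Q" "xco (0, 2) = fst Q"
    "xco (1, 1) = fst C1" "xco (2, 2) = fst C1" "xco (1, 2) = fst C2" "xco (2, 1) = fst C2"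
    by (simp_all add: xco_def phi_def)
qed

end

section \<open>From automorphisms to matrices\<close>

locale torsion_galois = flex_basis E P Q for E :: "'a::field weierstrass" and P Q +
  fixes K L :: "'a set"
  assumes ac: "alg_closed_type TYPE('a)" and K: "is_subfield K" and coeffs: "coeffs_in K E"
    and L_def: "L = torsion_field K E 3"
begin

definition coords :: "'a list" where
  "coords = map fst [P, neg E P, Q, neg E Q, C1, neg E C1, C2, neg E C2] @
     map snd [P, neg E P, Q, neg E Q, C1, neg E C1, C2, neg E C2]"

lemma set_coords: "set coords = fst ` flexes E \<union> snd ` flexes E"
  unfolding coords_def flexes_eq set_append by (simp only: set_map list.set)

lemma L_eq: "L = adjoin K (set coords)"
proof -
  have "(\<Union>{{x, y} |x y. Affine x y \<in> torsion E 3}) = set coords"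
  proof (rule Set.set_eqI)
    fix z
    have t: "Affine x y \<in> torsion E 3 \<longleftrightarrow> (x, y) \<in> flexes E" for x y
      unfolding torsion_3[OF nz] by auto
    have "z \<in> (\<Union>{{x, y} |x y. Affine x y \<in> torsion E 3}) \<longleftrightarrow> (\<exists>x y. (x, y) \<in> flexes E \<and> (z = x \<or> z = y))"
      unfolding t by blast
    also have "\<dots> \<longleftrightarrow> z \<in> set coords"
      unfolding set_coords Un_iff image_iff by (auto simp: Bex_def)
    finally show "z \<in> (\<Union>{{x, y} |x y. Affine x y \<in> torsion E 3}) \<longleftrightarrow> z \<in> set coords" .
  qed
  then show ?thesis unfolding L_def torsion_field_def by (rule arg_cong)
qed

lemma L: "is_subfield L" "K \<subseteq> L" "set coords \<subseteq> L"
  using adjoin_incl[of K "set coords"] by (auto simp: L_eq adjoin_is_subfield)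

lemma coeffs_K: "a1 E \<in> K" "a2 E \<in> K" "a3 E \<in> K" "a4 E \<in> K" "a6 E \<in> K"
  "b2 E \<in> K" "b4 E \<in> K" "b6 E \<in> K" "b8 E \<in> K"
proof -
  show a: "a1 E \<in> K" "a2 E \<in> K" "a3 E \<in> K" "a4 E \<in> K" "a6 E \<in> K"
    using coeffs by (auto simp: coeffs_in_def)
  show "b2 E \<in> K" "b4 E \<in> K" "b6 E \<in> K" "b8 E \<in> K"
    unfolding b_defs using a by (auto intro!: is_subfieldD[OF K])
qed

lemma flex_mem: "A \<in> flexes E \<Longrightarrow> fst A \<in> L" "A \<in> flexes E \<Longrightarrow> snd A \<in> L"
  using L(3) set_coords by auto

definition pmap :: "('a \<Rightarrow> 'a) \<Rightarrow> 'a \<times> 'a \<Rightarrow> 'a \<times> 'a" where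
  "pmap \<sigma> A = (\<sigma> (fst A), \<sigma> (snd A))"

definition smap :: "('a \<Rightarrow> 'a) \<Rightarrow> 'a point \<Rightarrow> 'a point" where
  "smap \<sigma> S = (case S of Infinity \<Rightarrow> Infinity | Affine x y \<Rightarrow> Affine (\<sigma> x) (\<sigma> y))"

lemma smap_pt: "smap \<sigma> (pt A) = pt (pmap \<sigma> A)" "smap \<sigma> Infinity = Infinity"
  by (auto simp: smap_def pt_def pmap_def split: prod.splits)

context
  fixes \<sigma>
  assumes hom: "hom_on L \<sigma>" and fixed: "\<And>u. u \<in> K \<Longrightarrow> \<sigma> u = u"
begin

lemma coeffs_L: "a1 E \<in> L" "a2 E \<in> L" "a3 E \<in> L" "a4 E \<in> L" "a6 E \<in> L" "b2 E \<in> L" "b4 E \<in> L" "b6 E \<in> L" "b8 E \<in> L"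
  using coeffs_K L(2) by auto

lemmas hom_simps = hom_onD[OF L(1) hom] is_subfieldD[OF L(1)] coeffs_L coeffs_K[THEN fixed]

lemma pmap_flex: "A \<in> flexes E \<Longrightarrow> pmap \<sigma> A \<in> flexes E"
proof -
  assume A: "A \<in> flexes E"
  obtain x y where xy: "A = (x, y)" by (metis surj_pair)
  have m: "x \<in> L" "y \<in> L" using flex_mem[OF A] by (simp_all add: xy)
  have "\<sigma> (weq E x y) = weq E (\<sigma> x) (\<sigma> y)"
    unfolding weq_def using m by (simp add: hom_simps)
  moreover have "\<sigma> (poly (g_poly E) x) = poly (g_poly E) (\<sigma> x)"
    unfolding poly_g_poly using m by (simp add: hom_simps)
  ultimately show ?thesis
    using A by (simp add: flexes_def xy pmap_def hom_simps)
qed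

lemma pmap_neg: "A \<in> flexes E \<Longrightarrow> pmap \<sigma> (neg E A) = neg E (pmap \<sigma> A)"
proof -
  assume A: "A \<in> flexes E"
  obtain x y where xy: "A = (x, y)" by (metis surj_pair)
  have m: "x \<in> L" "y \<in> L" using flex_mem[OF A] by (simp_all add: xy)
  then show ?thesis by (simp add: xy neg_def pmap_def hom_simps)
qed

lemma pmap_third: "A \<in> flexes E \<Longrightarrow> B \<in> flexes E \<Longrightarrow> pmap \<sigma> (third E A B) = third E (pmap \<sigma> A) (pmap \<sigma> B)"
proof -
  assume A: "A \<in> flexes E" and B: "B \<in> flexes E"
  obtain x y x' y' where xy: "A = (x, y)" "B = (x', y')" by (metis surj_pair)
  have m: "x \<in> L" "y \<in> L" "x' \<in> L" "y' \<in> L" using flex_mem[OF A] flex_mem[OF B] by (simp_all add: xy)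
  then show ?thesis by (simp add: xy third_def Let_def pmap_def hom_simps)
qed

lemma pmap_fst_eq: "A \<in> flexes E \<Longrightarrow> B \<in> flexes E \<Longrightarrow> fst (pmap \<sigma> A) = fst (pmap \<sigma> B) \<longleftrightarrow> fst A = fst B"
  unfolding pmap_def fst_conv by (rule inj_on_eq_iff[OF hom_on_inj[OF L(1) hom] flex_mem(1) flex_mem(1)])

text \<open>Addition of flexes needs only lines through two of them, tangents at one, and opposite
  points; in each case the formula has coefficients in \<open>K\<close>.\<close>

lemma smap_add:
  assumes "S = Infinity \<or> (\<exists>A\<in>flexes E. S = pt A)" "T = Infinity \<or> (\<exists>A\<in>flexes E. T = pt A)"
  shows "smap \<sigma> (point_add E S T) = point_add E (smap \<sigma> S) (smap \<sigma> T)"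
proof (cases "S = Infinity \<or> T = Infinity")
  case True
  then show ?thesis by (auto simp: smap_pt point_add_Infinity)
next
  case False
  then obtain A B where AB: "A \<in> flexes E" "S = pt A" "B \<in> flexes E" "T = pt B"
    using assms by blast
  note p = pmap_flex[OF AB(1)] pmap_flex[OF AB(3)]
  show ?thesis
  proof (cases "fst A = fst B")
    case False
    then have ne: "fst (pmap \<sigma> A) \<noteq> fst (pmap \<sigma> B)" using pmap_fst_eq[OF AB(1,3)] by simp
    have 1: "point_add E (pt A) (pt B) = pt (neg E (third E A B))"
      using point_add_third[OF False] by (simp add: pt_def)
    have 2: "point_add E (pt (pmap \<sigma> A)) (pt (pmap \<sigma> B)) = pt (neg E (third E (pmap \<sigma> A) (pmap \<sigma> B)))"
      using point_add_third[OF ne] by (simp add: pt_def)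
    show ?thesis
      unfolding AB(2,4) smap_pt 1 2 pmap_neg[OF third_flex(1)[OF nz AB(1,3) False]] pmap_third[OF AB(1,3)] ..
  next
    case True
    then consider "B = A" | "B = neg E A" using flexes_same_x[OF AB(1,3)] by blast
    then show ?thesis
    proof cases
      case 1
      have d: "point_add E (pt C) (pt C) = pt (neg E C)" if "C \<in> flexes E" for C
        using point_add_flex_self[OF nz that] by (simp add: pt_def)
      show ?thesis
        unfolding AB(2,4) 1 d[OF AB(1)] smap_pt d[OF p(1)] pmap_neg[OF AB(1)] ..
    next
      case 2
      have d: "point_add E (pt C) (pt (neg E C)) = Infinity" for C
        using point_add_neg[of E C] by (simp add: pt_def)
      show ?thesis
        unfolding AB(2,4) 2 d smap_pt pmap_neg[OF AB(1)] ..
    qed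
  qed
qed

lemma smap_phi_add: "smap \<sigma> (phi (i + k) (j + l)) = point_add E (smap \<sigma> (phi i j)) (smap \<sigma> (phi k l))"
  unfolding phi_add[symmetric] by (rule smap_add; rule phi_flex)

lemma smap_phi_exists: "\<exists>k l. smap \<sigma> (phi i j) = phi k l"
proof (cases "phi i j = Infinity")
  case True
  have "phi 0 0 = Infinity" by (simp add: phi_def)
  then have "smap \<sigma> (phi i j) = phi 0 0" using True smap_pt(2) by simp
  then show ?thesis by blast
next
  case False
  then obtain A where A: "A \<in> flexes E" "phi i j = pt A" using phi_flex[of i j] by blast
  show ?thesis unfolding A(2) smap_pt(1) by (rule phi_surj[OF pmap_flex[OF A(1)]])
qed

text \<open>An additive map of the plane over a prime field is linear; the images of
  \<open>P\<close> and \<open>Q\<close> form the columns.\<close>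

lemma matrix_exists: "\<exists>A. \<forall>i j. smap \<sigma> (phi i j) = case_prod phi (act A (i, j))"
proof -
  obtain a c b d where abcd: "smap \<sigma> (phi 1 0) = phi a c" "smap \<sigma> (phi 0 1) = phi b d"
    using smap_phi_exists[of 1 0] smap_phi_exists[of 0 1] by blast
  have z: "smap \<sigma> (phi 0 0) = phi 0 0" by (simp add: phi_def smap_pt)
  have "smap \<sigma> (phi 2 0) = phi (a * 2) (c * 2)" "smap \<sigma> (phi 0 2) = phi (b * 2) (d * 2)"
    using smap_phi_add[of 1 1 0 0] smap_phi_add[of 0 0 1 1] by (simp_all add: abcd phi_add mult.commute)
  then have "\<forall>i. smap \<sigma> (phi i 0) = phi (a * i) (c * i)" "\<forall>j. smap \<sigma> (phi 0 j) = phi (b * j) (d * j)"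
    unfolding f3_all using abcd z by simp_all
  then have "smap \<sigma> (phi i j) = phi (a * i + b * j) (c * i + d * j)" for i j
    using smap_phi_add[of i 0 0 j] by (simp add: phi_add)
  then show ?thesis by (intro exI[of _ "Quad a b c d"]) simp
qed

end

definition rho :: "('a \<Rightarrow> 'a) \<Rightarrow> quad" where
  "rho \<sigma> = (SOME A. \<forall>i j. smap \<sigma> (phi i j) = case_prod phi (act A (i, j)))"

abbreviation G where "G \<equiv> galois_group K L"

lemma rho: "\<sigma> \<in> carrier G \<Longrightarrow> smap \<sigma> (case_prod phi u) = case_prod phi (act (rho \<sigma>) u)"
proof -
  assume s: "\<sigma> \<in> carrier G"
  have "\<exists>A. \<forall>i j. smap \<sigma> (phi i j) = case_prod phi (act A (i, j))"
    by (rule matrix_exists[OF galois_groupD(1,2)[OF s]])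
  then have "\<forall>i j. smap \<sigma> (phi i j) = case_prod phi (act (rho \<sigma>) (i, j))"
    unfolding rho_def by (rule someI_ex)
  then show ?thesis by (cases u) simp
qed

sublocale splitting_field K L coords
proof (rule splitting_field.intro)
  show "alg_closed_type TYPE('a)" "is_subfield K" "L = adjoin K (set coords)"
    by (rule ac, rule K, rule L_eq)
  let ?xs = "map fst [P, neg E P, Q, neg E Q, C1, neg E C1, C2, neg E C2]"
    and ?ys = "map snd [P, neg E P, Q, neg E Q, C1, neg E C1, C2, neg E C2]"
  have sx: "set ?xs = fst ` flexes E" and sy: "set ?ys = snd ` flexes E"
    unfolding flexes_eq by (simp_all only: set_map list.set)
  show "separable_seq K coords"
    unfolding coords_def
  proof (rule separable_seq_append[OF separable_seqI K separable_seqI])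
    fix x assume "x \<in> set ?xs"
    then obtain y where "(x, y) \<in> flexes E" unfolding sx by (metis imageE prod.collapse)
    then have root: "poly (g_poly E) x = 0" by (simp add: flexes_def)
    have g: "g_poly E \<in> polys_over K"
      unfolding g_poly_def by (intro polys_over_closed(1,9)[OF K] coeffs_K is_subfieldD(4,11)[OF K])
    have "g_poly E \<noteq> 0" using three by (simp add: g_poly_def)
    moreover have "\<forall>y. poly (g_poly E) y = 0 \<longrightarrow> poly (pderiv (g_poly E)) y \<noteq> 0"
      unfolding pderiv_g_poly using nz three by (simp add: psi2_nonzero_def)
    ultimately show "separable_over K x"
      unfolding separable_over_def by (intro bexI[OF _ g] conjI root)
  next
    fix y assume "y \<in> set ?ys"
    then obtain x where xy: "(x, y) \<in> flexes E" unfolding sy by (metis imageE prod.collapse)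
    define F where "F = adjoin K (set ?xs)"
    \<comment> \<open>The curve equation as a quadratic in \<open>y\<close> over the field of the
      \<open>x\<close>-coordinates. Its derivative \<open>2 * y + a1 * x + a3\<close> vanishes at no
      flex.\<close>
    let ?p = "[:- (x^3 + a2 E * x^2 + a4 E * x + a6 E), a1 E * x + a3 E, 1:]"
    have F: "is_subfield F" unfolding F_def by (rule adjoin_is_subfield)
    have sub: "K \<union> set ?xs \<subseteq> F" unfolding F_def by (rule adjoin_incl)
    note incl = order_trans[OF Un_upper1 sub] order_trans[OF Un_upper2 sub]
    have "x \<in> set ?xs" unfolding sx by (rule image_eqI[OF _ xy]) simp
    note m = subsetD[OF incl(2) this] coeffs_K[THEN subsetD[OF incl(1)]]
    have p: "?p \<in> polys_over F"
      by (intro polys_over_closed(1,9)[OF F] m is_subfieldD(2-5,9)[OF F])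
    have val: "poly ?p z = weq E x z" for z
      by (simp add: weq_def algebra_simps power2_eq_square)
    have der: "poly (pderiv ?p) z = 2 * z + a1 E * x + a3 E" for z
      by (simp add: pderiv_pCons algebra_simps)
    have "\<forall>z. poly ?p z = 0 \<longrightarrow> poly (pderiv ?p) z \<noteq> 0"
      unfolding der val
    proof (intro allI impI)
      fix z assume "weq E x z = 0"
      then have "(x, z) \<in> flexes E" using xy by (simp add: flexes_def)
      then show "2 * z + a1 E * x + a3 E \<noteq> 0" by (rule flex_not_two_torsion[OF nz])
    qed
    moreover have "poly ?p y = 0" unfolding val using xy by (simp add: flexes_def)
    moreover have "?p \<noteq> 0" by simp
    ultimately have "separable_over F y"
      unfolding separable_over_def by (intro bexI[OF _ p] conjI)
    then show "separable_over (adjoin K (set ?xs)) y" unfolding F_def .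
  qed
  fix \<tau> x assume t: "hom_on L \<tau>" "\<And>u. u \<in> K \<Longrightarrow> \<tau> u = u" and "x \<in> set coords"
  then obtain A where A: "A \<in> flexes E" "x = fst A \<or> x = snd A" unfolding set_coords by blast
  have "pmap \<tau> A \<in> flexes E" by (rule pmap_flex[OF t A(1)])
  moreover have "\<tau> x = fst (pmap \<tau> A) \<or> \<tau> x = snd (pmap \<tau> A)" using A(2) by (auto simp: pmap_def)
  ultimately show "\<tau> x \<in> set coords" unfolding set_coords by (metis UnI1 UnI2 image_eqI)
qed

lemma act_mult: "act (A \<star> B) u = act A (act B u)"
  by (cases A; cases B; cases u) (simp add: algebra_simps)

lemma phi_prod_inj: "case_prod phi u = case_prod phi w \<longleftrightarrow> u = w"
  using phi_inj by (cases u; cases w) simp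

lemma act_eqI: "(\<And>u. act A u = act B u) \<Longrightarrow> A = B"
proof -
  assume "\<And>u. act A u = act B u"
  from this[of "(1, 0)"] this[of "(0, 1)"] show "A = B" by (cases A; cases B) simp
qed

lemma rho_mult:
  assumes "\<sigma> \<in> carrier G" "\<tau> \<in> carrier G"
  shows "rho (\<sigma> \<otimes>\<^bsub>G\<^esub> \<tau>) = rho \<sigma> \<star> rho \<tau>"
proof (rule act_eqI)
  fix u
  let ?c = "compose L \<sigma> \<tau>"
  have c: "?c \<in> carrier G" by (rule galois_group_closed[OF L(1) assms L(2)])
  have s: "smap ?c S = smap \<sigma> (smap \<tau> S)" if S: "S = Infinity \<or> (\<exists>A\<in>flexes E. S = pt A)" for S
  proof (cases "S = Infinity")
    case False
    then obtain A where A: "A \<in> flexes E" "S = pt A" using S by blast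
    show ?thesis using flex_mem[OF A(1)] by (simp add: A(2) smap_pt pmap_def compose_def)
  qed (simp add: smap_def)
  have "case_prod phi (act (rho ?c) u) = smap ?c (case_prod phi u)" using rho[OF c] by simp
  also have "\<dots> = smap \<sigma> (smap \<tau> (case_prod phi u))"
    by (rule s) (use phi_flex in \<open>cases u; simp\<close>)
  also have "\<dots> = case_prod phi (act (rho \<sigma>) (act (rho \<tau>) u))"
    using rho[OF assms(1)] rho[OF assms(2)] by simp
  finally show "act (rho (\<sigma> \<otimes>\<^bsub>G\<^esub> \<tau>)) u = act (rho \<sigma> \<star> rho \<tau>) u"
    unfolding phi_prod_inj act_mult galois_group_mult[OF assms] .
qed

lemma rho_inj: "inj_on rho (carrier G)"
proof (rule inj_onI)
  fix \<sigma> \<tau> assume s: "\<sigma> \<in> carrier G" and t: "\<tau> \<in> carrier G" and eq: "rho \<sigma> = rho \<tau>"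
  have p: "pmap \<sigma> A = pmap \<tau> A" if A: "A \<in> flexes E" for A
  proof -
    obtain i j where "pt A = case_prod phi (i, j)" using phi_surj[OF A] by auto
    then have "smap \<sigma> (pt A) = smap \<tau> (pt A)" using rho[OF s, of "(i, j)"] rho[OF t, of "(i, j)"] eq by simp
    then show ?thesis by (simp add: smap_pt)
  qed
  note S = galois_groupD[OF s] and T = galois_groupD[OF t]
  note hs = hom_onD[OF L(1) S(1)] and ht = hom_onD[OF L(1) T(1)] and l = is_subfieldD[OF L(1)]
  have sub: "is_subfield {x \<in> L. \<sigma> x = \<tau> x}"
    using hs(1-5,7) ht(1-5,7) l(1-6) by (auto simp: is_subfield_def)
  have "K \<subseteq> {x \<in> L. \<sigma> x = \<tau> x}" using S(2) T(2) L(2) by auto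
  moreover have "set coords \<subseteq> {x \<in> L. \<sigma> x = \<tau> x}"
    using p L(3) unfolding set_coords by (auto simp: pmap_def)
  ultimately have "L \<subseteq> {x \<in> L. \<sigma> x = \<tau> x}"
    unfolding L_eq[symmetric] using adjoin_least[OF sub, of K "set coords"] L_eq by simp
  then show "\<sigma> = \<tau>"
    using S(4) T(4) by (auto intro: extensionalityI)
qed

lemma det_zero_kernel: "qdet A = 0 \<Longrightarrow> \<exists>u. u \<noteq> (0, 0) \<and> act A u = (0, 0)"
proof -
  have "\<forall>a b c d. qdet (Quad a b c d) = 0 \<longrightarrow> (\<exists>u\<in>{(1,0), (0,1), (1,1), (1,2)}. act (Quad a b c d) u = (0, 0))"
    unfolding f3_all by simp
  moreover assume "qdet A = 0"
  ultimately obtain u where "u \<in> {(1,0), (0,1), (1,1), (1,2)}" "act A u = (0, 0)"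
    by (cases A) blast
  then show ?thesis by (intro exI[of _ u]) auto
qed

definition R where "R = rho ` carrier G"

sublocale quad_subgroup R
proof (rule quad_subgroup.intro)
  have 1: "(\<lambda>x\<in>L. x) \<in> carrier G" by (rule galois_group_one[OF L(1,2)])
  have "rho (\<lambda>x\<in>L. x) = qI"
  proof (rule act_eqI)
    fix u
    have "smap (\<lambda>x\<in>L. x) S = S" if "S = Infinity \<or> (\<exists>A\<in>flexes E. S = pt A)" for S
      using that flex_mem by (auto simp: smap_pt pmap_def)
    then have "smap (\<lambda>x\<in>L. x) (case_prod phi u) = case_prod phi u" using phi_flex by (cases u) simp
    then show "act (rho (\<lambda>x\<in>L. x)) u = act qI u"
      unfolding rho[OF 1] phi_prod_inj by (cases u) simp
  qed
  then show "qI \<in> R" unfolding R_def using 1 by (metis image_eqI)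
  show "A \<star> B \<in> R" if AB: "A \<in> R" "B \<in> R" for A B
  proof -
    obtain \<sigma> \<tau> where s: "\<sigma> \<in> carrier G" "\<tau> \<in> carrier G" "A = rho \<sigma>" "B = rho \<tau>"
      using AB unfolding R_def by blast
    have "\<sigma> \<otimes>\<^bsub>G\<^esub> \<tau> \<in> carrier G"
      unfolding galois_group_mult[OF s(1,2)] by (rule galois_group_closed[OF L(1) s(1,2) L(2)])
    then show ?thesis unfolding R_def s(3,4) rho_mult[OF s(1,2), symmetric] by blast
  qed
  \<comment> \<open>A vector in the kernel would be an affine point sent to \<open>Infinity\<close>,
    whereas automorphisms act on coordinates.\<close>
  show "qdet A \<noteq> 0" if A: "A \<in> R" for A
  proof
    assume "qdet A = 0"
    then obtain u where u: "u \<noteq> (0, 0)" "act A u = (0, 0)" using det_zero_kernel by blast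
    obtain \<sigma> where s: "\<sigma> \<in> carrier G" "A = rho \<sigma>" using A unfolding R_def by blast
    have i: "case_prod phi (0, 0) = Infinity" by (simp add: phi_def)
    have "smap \<sigma> (case_prod phi u) = Infinity" unfolding rho[OF s(1)] s(2)[symmetric] u(2) i ..
    then have "case_prod phi u = case_prod phi (0, 0)" unfolding i by (auto simp: smap_def split: point.splits)
    then show False using u(1) unfolding phi_prod_inj by blast
  qed
qed

lemma G_iso: "G \<cong> quad_monoid R"
proof -
  have "rho \<in> iso G (quad_monoid R)"
    using rho_mult rho_inj by (auto simp: iso_def hom_def bij_betw_def R_def)
  then show ?thesis unfolding is_iso_def by blast
qed

end

section \<open>Cubic resolvents and fixed fields\<close>

context torsion_galois
begin

lemma sigma_xco: "\<sigma> \<in> carrier G \<Longrightarrow> \<sigma> (xco u) = xco (act (rho \<sigma>) u)"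
proof -
  assume s: "\<sigma> \<in> carrier G"
  have "xco w = (case case_prod phi w of Infinity \<Rightarrow> 0 | Affine x y \<Rightarrow> x)" for w
    by (cases w) (simp add: xco_def)
  moreover have "\<sigma> 0 = 0" using hom_onD(4)[OF L(1) galois_groupD(1)[OF s]] .
  ultimately show ?thesis
    unfolding rho[OF s, symmetric] by (cases "case_prod phi u") (simp_all add: smap_def flip: rho[OF s])
qed

lemma x_ne: "fst P \<noteq> fst Q" "fst Q \<noteq> fst P" "fst P \<noteq> fst C1" "fst C1 \<noteq> fst P" "fst P \<noteq> fst C2" "fst C2 \<noteq> fst P"
  "fst Q \<noteq> fst C1" "fst C1 \<noteq> fst Q" "fst Q \<noteq> fst C2" "fst C2 \<noteq> fst Q" "fst C1 \<noteq> fst C2" "fst C2 \<noteq> fst C1"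
  using PQ C1(2,3) C2(2,3) C12 by auto

lemma x_mem: "fst P \<in> L" "fst Q \<in> L" "fst C1 \<in> L" "fst C2 \<in> L" "snd P \<in> L"
  using flex_mem P Q C1(1) C2(1) by auto

lemma fixes_line_iff:
  assumes "qdet A \<noteq> 0"
  shows "xco (act A (1, 0)) = fst P \<longleftrightarrow> fixes_line A"
proof -
  have "\<forall>a b c d. qdet (Quad a b c d) \<noteq> 0 \<longrightarrow> (xco (act (Quad a b c d) (1, 0)) = fst P \<longleftrightarrow> fixes_line (Quad a b c d))"
    unfolding f3_all by (simp add: x_ne)
  then show ?thesis using assms by (cases A) blast
qed

lemma fixes_axes_iff:
  assumes "qdet A \<noteq> 0"
  shows "xco (act A (1, 0)) = fst P \<and> xco (act A (0, 1)) = fst Q \<or>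
      xco (act A (1, 0)) = fst Q \<and> xco (act A (0, 1)) = fst P \<longleftrightarrow> fixes_axes A"
proof -
  have "\<forall>a b c d. qdet (Quad a b c d) \<noteq> 0 \<longrightarrow> (xco (act (Quad a b c d) (1, 0)) = fst P \<and> xco (act (Quad a b c d) (0, 1)) = fst Q \<or>
      xco (act (Quad a b c d) (1, 0)) = fst Q \<and> xco (act (Quad a b c d) (0, 1)) = fst P \<longleftrightarrow> fixes_axes (Quad a b c d))"
    unfolding f3_all by (simp add: x_ne)
  then show ?thesis using assms by (cases A) blast
qed

lemma same_line:
  assumes "xco (v1, v2) = xco (w1, w2)" "(v1, v2) \<noteq> (0, 0)" "(w1, w2) \<noteq> (0, 0)"
  shows "v1 * w2 - v2 * w1 = 0"
proof -
  have "\<forall>v1 v2 w1 w2. (v1, v2) \<noteq> (0, 0) \<longrightarrow> (w1, w2) \<noteq> (0, 0) \<longrightarrow> xco (v1, v2) = xco (w1, w2) \<longrightarrow> v1 * w2 - v2 * w1 = 0"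
    unfolding f3_all by (simp add: x_ne)
  then show ?thesis using assms by blast
qed

definition dd :: "'a \<Rightarrow> 'a \<Rightarrow> 'a \<Rightarrow> 'a \<Rightarrow> 'a" where
  "dd w x y z = b4 E - 3 * (w * x + y * z)"

text \<open>The cube root of the discriminant that belongs to the image under \<open>A\<close> of
  the partition into axes and diagonals.\<close>

definition resolvent :: "quad \<Rightarrow> 'a" where
  "resolvent A = dd (xco (act A (1, 0))) (xco (act A (0, 1))) (xco (act A (1, 1))) (xco (act A (1, 2)))"

text \<open>A transvection of order three; its powers carry the standard partition to the other two,
  whose resolvents are \<open>D2\<close> and \<open>D3\<close>.\<close>

abbreviation S :: quad where "S \<equiv> Quad 1 1 0 1"
abbreviation D1 where "D1 \<equiv> dd (fst P) (fst Q) (fst C1) (fst C2)"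
abbreviation D2 where "D2 \<equiv> dd (fst P) (fst C1) (fst Q) (fst C2)"
abbreviation D3 where "D3 \<equiv> dd (fst P) (fst C2) (fst Q) (fst C1)"

lemma dd_eq:
  "dd (fst Q) (fst P) (fst C1) (fst C2) = D1" "dd (fst P) (fst Q) (fst C2) (fst C1) = D1"
  "dd (fst Q) (fst P) (fst C2) (fst C1) = D1" "dd (fst C1) (fst C2) (fst P) (fst Q) = D1"
  "dd (fst C1) (fst C2) (fst Q) (fst P) = D1" "dd (fst C2) (fst C1) (fst P) (fst Q) = D1"
  "dd (fst C2) (fst C1) (fst Q) (fst P) = D1"
  "dd (fst C1) (fst P) (fst Q) (fst C2) = D2" "dd (fst P) (fst C1) (fst C2) (fst Q) = D2"
  "dd (fst C1) (fst P) (fst C2) (fst Q) = D2" "dd (fst Q) (fst C2) (fst P) (fst C1) = D2"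
  "dd (fst Q) (fst C2) (fst C1) (fst P) = D2" "dd (fst C2) (fst Q) (fst P) (fst C1) = D2"
  "dd (fst C2) (fst Q) (fst C1) (fst P) = D2"
  "dd (fst C2) (fst P) (fst Q) (fst C1) = D3" "dd (fst P) (fst C2) (fst C1) (fst Q) = D3"
  "dd (fst C2) (fst P) (fst C1) (fst Q) = D3" "dd (fst Q) (fst C1) (fst P) (fst C2) = D3"
  "dd (fst Q) (fst C1) (fst C2) (fst P) = D3" "dd (fst C1) (fst Q) (fst P) (fst C2) = D3"
  "dd (fst C1) (fst Q) (fst C2) (fst P) = D3"
  by (simp_all add: dd_def ac_simps)

lemma dd_ne: "D1 \<noteq> D2" "D2 \<noteq> D1" "D1 \<noteq> D3" "D3 \<noteq> D1" "D2 \<noteq> D3" "D3 \<noteq> D2"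
proof -
  have *: "dd w x y z \<noteq> dd w y x z" if "w \<noteq> z" "x \<noteq> y" for w x y z
  proof
    assume "dd w x y z = dd w y x z"
    then have "3 * ((w - z) * (x - y)) = 0" unfolding dd_def by Groebner_Basis.algebra
    then show False using three that by simp
  qed
  have "D1 \<noteq> D2" using *[of "fst P" "fst C2" "fst Q" "fst C1"] x_ne by simp
  moreover have "D1 \<noteq> D3" using *[of "fst P" "fst C1" "fst Q" "fst C2"] x_ne dd_eq by simp
  moreover have "D2 \<noteq> D3" using *[of "fst P" "fst Q" "fst C1" "fst C2"] x_ne dd_eq by simp
  ultimately show "D1 \<noteq> D2" "D2 \<noteq> D1" "D1 \<noteq> D3" "D3 \<noteq> D1" "D2 \<noteq> D3" "D3 \<noteq> D2" by auto
qed

text \<open>Invertible matrices act on the three partitions through the symmetric group, so the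
  images of two of them determine the permutation and hence its sign.\<close>

lemma resolvent_table:
  assumes "qdet A \<noteq> 0"
  shows "resolvent A = D1 \<longleftrightarrow> fixes_partition A"
    "resolvent (A \<star> S) = D2 \<longleftrightarrow> fixes_partition (S \<star> S \<star> A \<star> S)"
    "resolvent (A \<star> S \<star> S) = D3 \<longleftrightarrow> fixes_partition (S \<star> A \<star> S \<star> S)"
    "qdet A = 1 \<Longrightarrow> (resolvent A, resolvent (A \<star> S)) \<in> {(D1, D2), (D2, D3), (D3, D1)}"
    "qdet A \<noteq> 1 \<Longrightarrow> (resolvent A, resolvent (A \<star> S)) \<in> {(D1, D3), (D2, D1), (D3, D2)}"
proof -
  have 1: "\<forall>a b c d. qdet (Quad a b c d) \<noteq> 0 \<longrightarrow> (resolvent (Quad a b c d) = D1 \<longleftrightarrow> fixes_partition (Quad a b c d))"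
    unfolding f3_all by (simp add: resolvent_def dd_eq dd_ne)
  have 2: "\<forall>a b c d. qdet (Quad a b c d) \<noteq> 0 \<longrightarrow>
      (resolvent (Quad a b c d \<star> S) = D2 \<longleftrightarrow> fixes_partition (S \<star> S \<star> Quad a b c d \<star> S))"
    unfolding f3_all by (simp add: resolvent_def dd_eq dd_ne)
  have 3: "\<forall>a b c d. qdet (Quad a b c d) \<noteq> 0 \<longrightarrow>
      (resolvent (Quad a b c d \<star> S \<star> S) = D3 \<longleftrightarrow> fixes_partition (S \<star> Quad a b c d \<star> S \<star> S))"
    unfolding f3_all by (simp add: resolvent_def dd_eq dd_ne)
  have 4: "\<forall>a b c d. qdet (Quad a b c d) = 1 \<longrightarrow>
      (resolvent (Quad a b c d), resolvent (Quad a b c d \<star> S)) \<in> {(D1, D2), (D2, D3), (D3, D1)}"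
    unfolding f3_all by (simp add: resolvent_def dd_eq dd_ne)
  have 5: "\<forall>a b c d. qdet (Quad a b c d) \<noteq> 0 \<longrightarrow> qdet (Quad a b c d) \<noteq> 1 \<longrightarrow>
      (resolvent (Quad a b c d), resolvent (Quad a b c d \<star> S)) \<in> {(D1, D3), (D2, D1), (D3, D2)}"
    unfolding f3_all by (simp add: resolvent_def dd_eq dd_ne)
  obtain a b c d where A: "A = Quad a b c d" by (cases A)
  show "resolvent A = D1 \<longleftrightarrow> fixes_partition A" using 1 assms unfolding A by blast
  show "resolvent (A \<star> S) = D2 \<longleftrightarrow> fixes_partition (S \<star> S \<star> A \<star> S)" using 2 assms unfolding A by blast
  show "resolvent (A \<star> S \<star> S) = D3 \<longleftrightarrow> fixes_partition (S \<star> A \<star> S \<star> S)" using 3 assms unfolding A by blast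
  show "(resolvent A, resolvent (A \<star> S)) \<in> {(D1, D2), (D2, D3), (D3, D1)}" if "qdet A = 1"
    using 4 that unfolding A by blast
  show "(resolvent A, resolvent (A \<star> S)) \<in> {(D1, D3), (D2, D1), (D3, D2)}" if "qdet A \<noteq> 1"
    using 5 assms that unfolding A by blast
qed

lemma resolvent_S: "resolvent qI = D1" "resolvent S = D2" "resolvent (S \<star> S) = D3"
  by (simp_all add: resolvent_def dd_eq)

lemma dd_mem: "D1 \<in> L" "D2 \<in> L" "D3 \<in> L"
  unfolding dd_def using x_mem coeffs_K(7) L(2)
  by (intro is_subfieldD(3,4,7,11)[OF L(1)]; blast)+

lemma sigma_resolvent:
  assumes s: "\<sigma> \<in> carrier G"
  shows "\<sigma> (resolvent B) = resolvent (rho \<sigma> \<star> B)"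
proof -
  have m: "xco u \<in> L" for u
  proof -
    have "\<forall>i j. xco (i, j) \<in> L"
    proof -
      have "xco (0, 0) = 0" by (simp add: xco_def phi_def)
      then show ?thesis unfolding f3_all using x_mem is_subfieldD(1)[OF L(1)] by simp
    qed
    then show ?thesis by (cases u) blast
  qed
  note h = hom_onD[OF L(1) galois_groupD(1)[OF s]]
  have "b4 E \<in> L" "\<sigma> (b4 E) = b4 E" using coeffs_K(7) L(2) galois_groupD(2)[OF s] by auto
  then show ?thesis
    unfolding resolvent_def dd_def
    using m by (simp add: h is_subfieldD[OF L(1)] sigma_xco[OF s] act_mult)
qed

end

lemma sum_prod_eq_iff:
  fixes p q x y :: "'a::field"
  shows "x + y = p + q \<and> x * y = p * q \<longleftrightarrow> x = p \<and> y = q \<or> x = q \<and> y = p"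
proof
  assume *: "x + y = p + q \<and> x * y = p * q"
  then have "(x - p) * (x - q) = 0" by Groebner_Basis.algebra
  then show "x = p \<and> y = q \<or> x = q \<and> y = p" using * by auto
qed (auto simp: ac_simps)

lemma cube_roots_of_unity:
  fixes z w :: "'a::field"
  assumes "z ^ 3 = 1" "z \<noteq> 1" "w ^ 3 = 1"
  shows "w = 1 \<or> w = z \<or> w = z^2"
proof -
  have "(z - 1) * (z^2 + z + 1) = 0" using assms(1) by Groebner_Basis.algebra
  then have "z^2 + z + 1 = 0" using assms(2) by simp
  then have "(w - 1) * ((w - z) * (w - z^2)) = 0" using assms(1,3) by Groebner_Basis.algebra
  then show ?thesis by auto
qed

locale torsion_resolvents = torsion_galois E P Q K L for E :: "'a::field weierstrass" and P Q K L +
  fixes \<zeta> :: 'a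
  assumes D_nz: "D1 \<noteq> 0" and D_cube: "D2 ^ 3 = D1 ^ 3" "D3 ^ 3 = D1 ^ 3" and zeta: "\<zeta> ^ 3 = 1" "\<zeta> \<noteq> 1"
begin

text \<open>A matrix of determinant 1 permutes the resolvents evenly and any other invertible matrix oddly,
  so an automorphism fixes the ratio \<open>\<omega>\<close> of two resolvents if and only if its matrix has determinant 1.\<close>

definition \<omega> where "\<omega> = D2 / D1"

lemma omega: "\<omega> ^ 3 = 1" "\<omega> \<noteq> 1" "D2 = \<omega> * D1" "D3 = \<omega>^2 * D1" "\<omega>^2 \<noteq> \<omega>"
proof -
  show 1: "\<omega> ^ 3 = 1" "\<omega> \<noteq> 1" "D2 = \<omega> * D1"
    using D_cube(1) D_nz dd_ne by (auto simp: \<omega>_def power_divide)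
  have "(D3 / D1) ^ 3 = 1" using D_cube(2) D_nz by (simp add: power_divide)
  then have "D3 / D1 = 1 \<or> D3 / D1 = \<omega> \<or> D3 / D1 = \<omega>^2" by (rule cube_roots_of_unity[OF 1(1,2)])
  then show "D3 = \<omega>^2 * D1"
    using dd_ne D_nz 1(3) by (auto simp: divide_eq_eq)
  show "\<omega>^2 \<noteq> \<omega>"
  proof
    assume "\<omega>^2 = \<omega>"
    then have "\<omega>^3 = \<omega> * \<omega>" by (simp add: power3_eq_cube power2_eq_square)
    then show False using 1(1,2) \<open>\<omega>^2 = \<omega>\<close> by (simp add: power2_eq_square)
  qed
qed

lemma zeta_omega: "\<zeta> = \<omega> \<or> \<zeta> = \<omega>^2" "\<omega> = \<zeta> \<or> \<omega> = \<zeta>^2"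
  using cube_roots_of_unity[OF omega(1,2) zeta(1)] cube_roots_of_unity[OF zeta omega(1)] zeta(2) omega(2) by auto

text \<open>The ratio of two resolvents is a primitive third root of unity, so it is
  \<open>\<zeta>\<close> or its square.\<close>

lemma zeta_mem: "\<zeta> \<in> L"
proof -
  have "\<omega> \<in> L" unfolding \<omega>_def using dd_mem by (intro is_subfieldD(8)[OF L(1)])
  then show ?thesis using zeta_omega(1) is_subfieldD(9)[OF L(1)] by auto
qed

context
  fixes \<sigma>
  assumes s: "\<sigma> \<in> carrier G"
begin

lemma det_rho: "qdet (rho \<sigma>) \<noteq> 0"
  using det s by (auto simp: R_def)

lemma fix_resolvents:
  "\<sigma> D1 = D1 \<longleftrightarrow> fixes_partition (rho \<sigma>)"
  "\<sigma> D2 = D2 \<longleftrightarrow> fixes_partition (S \<star> S \<star> rho \<sigma> \<star> S)"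
  "\<sigma> D3 = D3 \<longleftrightarrow> fixes_partition (S \<star> rho \<sigma> \<star> S \<star> S)"
  using sigma_resolvent[OF s, of qI] sigma_resolvent[OF s, of S] sigma_resolvent[OF s, of "S \<star> S"]
    resolvent_table(1-3)[OF det_rho]
  unfolding resolvent_S qmul_one qmul_assoc[symmetric] by simp_all

lemma fix_zeta: "\<sigma> \<zeta> = \<zeta> \<longleftrightarrow> qdet (rho \<sigma>) = 1"
proof -
  note h = hom_onD[OF L(1) galois_groupD(1)[OF s]]
  have wL: "\<omega> \<in> L" unfolding \<omega>_def using dd_mem by (intro is_subfieldD(8)[OF L(1)])
  have e: "\<sigma> \<omega> = resolvent (rho \<sigma> \<star> S) / resolvent (rho \<sigma>)"
    unfolding \<omega>_def using h(8)[OF dd_mem(2,1)] sigma_resolvent[OF s, of qI] sigma_resolvent[OF s, of S]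
    unfolding resolvent_S qmul_one by simp
  have w: "D2 / D1 = \<omega>" "D3 / D2 = \<omega>" "D1 / D3 = \<omega>" "D3 / D1 = \<omega>^2" "D1 / D2 = \<omega>^2" "D2 / D3 = \<omega>^2"
    and nz: "\<omega> \<noteq> 0"
  proof -
    show nz: "\<omega> \<noteq> 0" using omega(1) by auto
    have "\<omega> * \<omega>^2 = 1" using omega(1) by (simp add: power3_eq_cube power2_eq_square mult.assoc)
    then have i: "1 / \<omega> = \<omega>^2" "1 / \<omega>^2 = \<omega>" using nz by (simp_all add: field_simps)
    show "D2 / D1 = \<omega>" by (simp add: \<omega>_def)
    show "D3 / D2 = \<omega>" "D3 / D1 = \<omega>^2"
      unfolding omega(3,4) using nz D_nz by (simp_all add: power2_eq_square)
    show "D1 / D3 = \<omega>" "D1 / D2 = \<omega>^2" "D2 / D3 = \<omega>^2"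
      unfolding omega(3,4) using nz D_nz i by (simp_all add: power2_eq_square)
  qed
  have "\<sigma> \<omega> = \<omega> \<longleftrightarrow> qdet (rho \<sigma>) = 1"
  proof (cases "qdet (rho \<sigma>) = 1")
    case True
    from resolvent_table(4)[OF det_rho this] have "\<sigma> \<omega> = \<omega>" unfolding e using w by auto
    then show ?thesis using True by simp
  next
    case False
    from resolvent_table(5)[OF det_rho this] have "\<sigma> \<omega> = \<omega>^2" unfolding e using w by auto
    then show ?thesis using False omega(5) by simp
  qed
  moreover have "\<sigma> \<zeta> = \<zeta> \<longleftrightarrow> \<sigma> \<omega> = \<omega>"
    using zeta_omega h(9)[OF wL] h(9)[OF zeta_mem] by metis
  ultimately show ?thesis by simp
qed

lemma fix_alpha: "\<sigma> (fst P) = fst P \<longleftrightarrow> fixes_line (rho \<sigma>)"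
  using sigma_xco[OF s, of "(1, 0)"] fixes_line_iff[OF det_rho] by simp

text \<open>Sum and product determine an unordered pair, so fixing both allows the two roots to be
  exchanged.\<close>

lemma fix_sum_prod: "\<sigma> (fst P + fst Q) = fst P + fst Q \<and> \<sigma> (fst P * fst Q) = fst P * fst Q \<longleftrightarrow> fixes_axes (rho \<sigma>)"
proof -
  note h = hom_onD[OF L(1) galois_groupD(1)[OF s]]
  have "\<sigma> (fst P) = xco (act (rho \<sigma>) (1, 0))" "\<sigma> (fst Q) = xco (act (rho \<sigma>) (0, 1))"
    using sigma_xco[OF s, of "(1, 0)"] sigma_xco[OF s, of "(0, 1)"] by simp_all
  then show ?thesis
    unfolding h(2)[OF x_mem(1,2)] h(3)[OF x_mem(1,2)] sum_prod_eq_iff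
    using fixes_axes_iff[OF det_rho] by simp
qed

lemma fix_flex: "\<sigma> (fst P) = fst P \<and> \<sigma> (snd P) = snd P \<longleftrightarrow> fixes_vector (rho \<sigma>)"
proof -
  have "pt (pmap \<sigma> P) = case_prod phi (act (rho \<sigma>) (1, 0))"
    using rho[OF s, of "(1, 0)"] by (simp add: phi_def smap_pt)
  moreover have "pt P = case_prod phi (1, 0)" by (simp add: phi_def)
  ultimately have "pt (pmap \<sigma> P) = pt P \<longleftrightarrow> act (rho \<sigma>) (1, 0) = (1, 0)"
    using phi_prod_inj by metis
  also have "act (rho \<sigma>) (1, 0) = (1, 0) \<longleftrightarrow> fixes_vector (rho \<sigma>)"
    by (cases "rho \<sigma>") simp
  finally show ?thesis by (simp add: pmap_def prod_eq_iff)
qed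

end

section \<open>Field-theoretic hypotheses as conditions on matrices\<close>

lemma R_ball: "(\<forall>A\<in>R. p A) \<longleftrightarrow> (\<forall>\<sigma>\<in>carrier G. p (rho \<sigma>))"
  by (simp add: R_def)

lemma sum_prod_mem: "fst P + fst Q \<in> L" "fst P * fst Q \<in> L"
  using x_mem by (auto intro: is_subfieldD[OF L(1)])

text \<open>A vector fixed by \<open>R\<close> has rational coordinates, and one fixed up to sign
  has a rational \<open>x\<close>-coordinate. By uniqueness the two abscissas agree, so the vectors
  lie on one line.\<close>

lemma reduction_condition:
  assumes unique: "\<forall>(x, y)\<in>flexes E. x \<in> K \<longrightarrow> y \<in> K \<longrightarrow> (\<forall>x'\<in>K. poly (g_poly E) x' = 0 \<longrightarrow> x' = x)"
    and v: "\<forall>A\<in>R. act A (v1, v2) = (v1, v2)" and w: "\<forall>A\<in>R. act A (w1, w2) \<in> {(w1, w2), (2 * w1, 2 * w2)}"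
  shows "v1 * w2 - v2 * w1 = 0"
proof (cases "(v1, v2) = (0, 0) \<or> (w1, w2) = (0, 0)")
  case False
  have nI: "phi i j \<noteq> Infinity" if "(i, j) \<noteq> (0, 0)" for i j
    using phi_inj[of i j 0 0] that by (simp add: phi_def)
  obtain x y where xy: "(x, y) \<in> flexes E" "phi v1 v2 = Affine x y"
    using phi_flex[of v1 v2] nI[of v1 v2] False by (auto simp: pt_def)
  obtain x' y' where xy': "(x', y') \<in> flexes E" "phi w1 w2 = Affine x' y'"
    using phi_flex[of w1 w2] nI[of w1 w2] False by (auto simp: pt_def)
  have m: "x \<in> L" "y \<in> L" "x' \<in> L" using flex_mem[OF xy(1)] flex_mem[OF xy'(1)] by simp_all
  have "x \<in> K" "y \<in> K"
  proof -
    have "\<sigma> x = x \<and> \<sigma> y = y" if s: "\<sigma> \<in> carrier G" for \<sigma>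
    proof -
      have "act (rho \<sigma>) (v1, v2) = (v1, v2)" using v s by (simp add: R_def)
      then show ?thesis using rho[OF s, of "(v1, v2)"] by (simp add: xy smap_def)
    qed
    then show "x \<in> K" "y \<in> K" using mem_base_iff m by blast+
  qed
  moreover have xw: "xco (2 * w1, 2 * w2) = xco (w1, w2)"
  proof -
    have "\<forall>i j. xco (2 * i, 2 * j) = xco (i, j)" unfolding f3_all by simp
    then show ?thesis by blast
  qed
  have "x' \<in> K"
  proof -
    have x': "x' = xco (w1, w2)" by (simp add: xco_def xy')
    have "\<sigma> x' = x'" if s: "\<sigma> \<in> carrier G" for \<sigma>
      unfolding x' sigma_xco[OF s] using w s xw by (auto simp: R_def)
    then show ?thesis using mem_base_iff m by blast
  qed
  ultimately have "x' = x" using unique xy(1) xy'(1) by (fastforce simp: flexes_def)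
  then have "xco (v1, v2) = xco (w1, w2)" by (simp add: xco_def xy xy')
  then show ?thesis using same_line False by blast
qed auto

text \<open>Two elements are treated together because the point \<open>(\<alpha>, \<beta>)\<close>
  and the pair \<open>s\<close>, \<open>t\<close> correspond to matrix conditions only
  jointly.\<close>

lemma pair_mem_adjoin:
  assumes "A \<subseteq> L" "x \<in> L" "y \<in> L"
    and p: "\<And>\<sigma>. \<sigma> \<in> carrier G \<Longrightarrow> (\<forall>a\<in>A. \<sigma> a = a) \<longleftrightarrow> p (rho \<sigma>)"
    and q: "\<And>\<sigma>. \<sigma> \<in> carrier G \<Longrightarrow> \<sigma> x = x \<and> \<sigma> y = y \<longleftrightarrow> q (rho \<sigma>)"
  shows "x \<in> adjoin K A \<and> y \<in> adjoin K A \<longleftrightarrow> (\<forall>B\<in>R. p B \<longrightarrow> q B)"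
proof -
  have "x \<in> adjoin K A \<and> y \<in> adjoin K A \<longleftrightarrow>
      (\<forall>\<sigma>\<in>carrier G. (\<forall>a\<in>A. \<sigma> a = a) \<longrightarrow> \<sigma> x = x \<and> \<sigma> y = y)"
    unfolding mem_adjoin_iff[OF assms(1,2)] mem_adjoin_iff[OF assms(1,3)] by blast
  also have "\<dots> \<longleftrightarrow> (\<forall>\<sigma>\<in>carrier G. p (rho \<sigma>) \<longrightarrow> q (rho \<sigma>))"
    by (rule ball_cong[OF refl]) (simp only: p q)
  finally show ?thesis unfolding R_ball .
qed

lemmas mem_adjoin = pair_mem_adjoin[where x = z and y = z for z, unfolded conj_absorb]

abbreviation sm where "sm \<equiv> fst P + fst Q"
abbreviation pr where "pr \<equiv> fst P * fst Q"

lemma mem_K: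
  "\<zeta> \<in> K \<longleftrightarrow> (\<forall>A\<in>R. qdet A = 1)"
  "D1 \<in> K \<longleftrightarrow> (\<forall>A\<in>R. fixes_partition A)"
  "D2 \<in> K \<longleftrightarrow> (\<forall>A\<in>R. fixes_partition (S \<star> S \<star> A \<star> S))"
  "D3 \<in> K \<longleftrightarrow> (\<forall>A\<in>R. fixes_partition (S \<star> A \<star> S \<star> S))"
  "fst P \<in> K \<longleftrightarrow> (\<forall>A\<in>R. fixes_line A)"
  "sm \<in> K \<and> pr \<in> K \<longleftrightarrow> (\<forall>A\<in>R. fixes_axes A)"
proof -
  note m = mem_base_iff[OF zeta_mem] mem_base_iff[OF dd_mem(1)] mem_base_iff[OF dd_mem(2)]
    mem_base_iff[OF dd_mem(3)] mem_base_iff[OF x_mem(1)] mem_base_iff[OF sum_prod_mem(1)]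
    mem_base_iff[OF sum_prod_mem(2)]
  show "\<zeta> \<in> K \<longleftrightarrow> (\<forall>A\<in>R. qdet A = 1)"
    "D1 \<in> K \<longleftrightarrow> (\<forall>A\<in>R. fixes_partition A)"
    "D2 \<in> K \<longleftrightarrow> (\<forall>A\<in>R. fixes_partition (S \<star> S \<star> A \<star> S))"
    "D3 \<in> K \<longleftrightarrow> (\<forall>A\<in>R. fixes_partition (S \<star> A \<star> S \<star> S))"
    "fst P \<in> K \<longleftrightarrow> (\<forall>A\<in>R. fixes_line A)"
    unfolding m R_ball by (rule ball_cong[OF refl], simp only: fix_zeta fix_resolvents fix_alpha)+
  have "sm \<in> K \<and> pr \<in> K \<longleftrightarrow> (\<forall>\<sigma>\<in>carrier G. \<sigma> sm = sm \<and> \<sigma> pr = pr)"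
    unfolding m by blast
  also have "\<dots> \<longleftrightarrow> (\<forall>A\<in>R. fixes_axes A)"
    unfolding R_ball by (rule ball_cong[OF refl], simp only: fix_sum_prod)
  finally show "sm \<in> K \<and> pr \<in> K \<longleftrightarrow> (\<forall>A\<in>R. fixes_axes A)" .
qed

lemma mem_adjoin_sum_prod: "fst P \<in> adjoin K {sm, pr} \<longleftrightarrow> (\<forall>A\<in>R. fixes_axes A \<longrightarrow> fixes_line A)"
  by (rule mem_adjoin) (use x_mem sum_prod_mem in \<open>simp_all add: fix_alpha fix_sum_prod\<close>)

lemma mem_adjoin_resolvent:
  "fst P \<in> adjoin K {D1} \<longleftrightarrow> (\<forall>A\<in>R. fixes_partition A \<longrightarrow> fixes_line A)"
  "fst P \<in> adjoin K {D1} \<and> snd P \<in> adjoin K {D1} \<longleftrightarrow> (\<forall>A\<in>R. fixes_partition A \<longrightarrow> fixes_vector A)"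
  "sm \<in> adjoin K {D1} \<and> pr \<in> adjoin K {D1} \<longleftrightarrow> (\<forall>A\<in>R. fixes_partition A \<longrightarrow> fixes_axes A)"
proof -
  note m = x_mem sum_prod_mem dd_mem and i = fix_sum_prod fix_resolvents
  show "fst P \<in> adjoin K {D1} \<longleftrightarrow> (\<forall>A\<in>R. fixes_partition A \<longrightarrow> fixes_line A)"
    by (rule mem_adjoin) (use m in \<open>simp_all add: fix_alpha i\<close>)
  show "fst P \<in> adjoin K {D1} \<and> snd P \<in> adjoin K {D1} \<longleftrightarrow> (\<forall>A\<in>R. fixes_partition A \<longrightarrow> fixes_vector A)"
    "sm \<in> adjoin K {D1} \<and> pr \<in> adjoin K {D1} \<longleftrightarrow> (\<forall>A\<in>R. fixes_partition A \<longrightarrow> fixes_axes A)"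
    by (rule pair_mem_adjoin; use m in \<open>simp add: fix_flex i\<close>)+
qed

lemma mem_adjoin_zeta:
  "fst P \<in> adjoin K {\<zeta>} \<longleftrightarrow> (\<forall>A\<in>R. qdet A = 1 \<longrightarrow> fixes_line A)"
  "sm \<in> adjoin K {\<zeta>} \<and> pr \<in> adjoin K {\<zeta>} \<longleftrightarrow> (\<forall>A\<in>R. qdet A = 1 \<longrightarrow> fixes_axes A)"
  "fst P \<in> adjoin K {\<zeta>, sm, pr} \<longleftrightarrow> (\<forall>A\<in>R. qdet A = 1 \<and> fixes_axes A \<longrightarrow> fixes_line A)"
  by (rule mem_adjoin pair_mem_adjoin;
      use x_mem sum_prod_mem zeta_mem in \<open>simp add: fix_alpha fix_sum_prod fix_zeta\<close>)+

lemma mem_adjoin_resolvent_zeta: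
  "fst P \<in> adjoin K {D1, \<zeta>} \<longleftrightarrow> (\<forall>A\<in>R. fixes_partition A \<and> qdet A = 1 \<longrightarrow> fixes_line A)"
  "fst P \<in> adjoin K {D1, \<zeta>} \<and> snd P \<in> adjoin K {D1, \<zeta>} \<longleftrightarrow>
     (\<forall>A\<in>R. fixes_partition A \<and> qdet A = 1 \<longrightarrow> fixes_vector A)"
  "sm \<in> adjoin K {D1, \<zeta>} \<and> pr \<in> adjoin K {D1, \<zeta>} \<longleftrightarrow>
     (\<forall>A\<in>R. fixes_partition A \<and> qdet A = 1 \<longrightarrow> fixes_axes A)"
proof -
  note m = x_mem sum_prod_mem zeta_mem dd_mem and i = fix_sum_prod fix_resolvents fix_zeta
  show "fst P \<in> adjoin K {D1, \<zeta>} \<longleftrightarrow> (\<forall>A\<in>R. fixes_partition A \<and> qdet A = 1 \<longrightarrow> fixes_line A)"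
    by (rule mem_adjoin) (use m in \<open>simp_all add: fix_alpha i\<close>)
  show "fst P \<in> adjoin K {D1, \<zeta>} \<and> snd P \<in> adjoin K {D1, \<zeta>} \<longleftrightarrow>
      (\<forall>A\<in>R. fixes_partition A \<and> qdet A = 1 \<longrightarrow> fixes_vector A)"
    "sm \<in> adjoin K {D1, \<zeta>} \<and> pr \<in> adjoin K {D1, \<zeta>} \<longleftrightarrow>
      (\<forall>A\<in>R. fixes_partition A \<and> qdet A = 1 \<longrightarrow> fixes_axes A)"
    by (rule pair_mem_adjoin; use m in \<open>simp add: fix_flex i\<close>)+
qed

end

section \<open>The cases of the theorem\<close>

text \<open>A nonzero resolvent separates two pairs of roots. Three numberings of the roots, all
  with nonzero resolvents since the cubes agree, give all six inequalities.\<close>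

lemma roots_distinct:
  fixes x1 x2 x3 x4 :: "'a::field"
  assumes 3: "(3::'a) \<noteq> 0"
    and g: "g_poly E = smult 3 ([:- x1, 1:] * [:- x2, 1:] * [:- x3, 1:] * [:- x4, 1:])"
    and d: "(b4 E - 3 * (x1 * x2 + x3 * x4)) ^ 3 = disc E" "disc E \<noteq> 0"
  shows "distinct [x1, x2, x3, x4]"
proof -
  have nz: "b4 E - 3 * (x1 * x2 + x3 * x4) \<noteq> 0" using d by auto
  note 1 = resolvents[OF 3 g nz]
  have "b4 E - 3 * (x1 * x3 + x2 * x4) \<noteq> 0" using 1(1) nz by auto
  then have nz': "b4 E - 3 * (x1 * x3 + x4 * x2) \<noteq> 0" by (simp add: mult.commute)
  have g2: "g_poly E = smult 3 ([:- x1, 1:] * [:- x2, 1:] * [:- x4, 1:] * [:- x3, 1:])"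
    and g3: "g_poly E = smult 3 ([:- x1, 1:] * [:- x3, 1:] * [:- x4, 1:] * [:- x2, 1:])"
    unfolding g by (simp_all only: ac_simps)
  have nz2: "b4 E - 3 * (x1 * x2 + x4 * x3) \<noteq> 0" using nz by (simp add: mult.commute)
  show ?thesis using 1(3,4) resolvents(3,4)[OF 3 g2 nz2] resolvents(3,4)[OF 3 g3 nz'] by auto
qed

lemma roots_of_split:
  fixes x1 x2 x3 x4 :: "'a::field"
  assumes "(3::'a) \<noteq> 0" and g: "g = smult 3 ([:- x1, 1:] * [:- x2, 1:] * [:- x3, 1:] * [:- x4, 1:])"
  shows "poly g x = 0 \<longleftrightarrow> x \<in> {x1, x2, x3, x4}"
proof -
  have l: "poly [:- a, 1:] x = x - a" for a by simp
  show ?thesis using assms(1) unfolding g poly_smult poly_mult l by simp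
qed

lemma psi2_nonzero_if_roots_distinct:
  fixes x1 x2 x3 x4 :: "'a::field"
  assumes 3: "(3::'a) \<noteq> 0"
    and g: "g_poly E = smult 3 ([:- x1, 1:] * [:- x2, 1:] * [:- x3, 1:] * [:- x4, 1:])"
    and d: "distinct [x1, x2, x3, x4]"
  shows "psi2_nonzero E"
  unfolding psi2_nonzero_def
proof (intro allI impI)
  fix x assume "poly (g_poly E) x = 0"
  then have x: "x = x1 \<or> x = x2 \<or> x = x3 \<or> x = x4" unfolding roots_of_split[OF 3 g] by simp
  have "3 * psi2_sq E x = 3 * ((x - x2) * (x - x3) * (x - x4) + (x - x1) * (x - x3) * (x - x4) +
      (x - x1) * (x - x2) * (x - x4) + (x - x1) * (x - x2) * (x - x3))"
    unfolding pderiv_g_poly[symmetric] g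
    by (simp add: pderiv_smult pderiv_mult pderiv_pCons algebra_simps)
  then show "psi2_sq E x \<noteq> 0" using 3 x d by auto
qed

lemma exists_flex_over:
  assumes "alg_closed_type TYPE('a)" "poly (g_poly E) x = 0"
  obtains y where "(x, y :: 'a::field) \<in> flexes E"
proof -
  let ?p = "[:- (x^3 + a2 E * x^2 + a4 E * x + a6 E), a1 E * x + a3 E, 1:]"
  obtain y where "poly ?p y = 0"
    using assms(1) unfolding alg_closed_type_def by (metis degree_pCons_eq_if pCons_eq_0_iff one_neq_zero zero_less_Suc)
  then have "weq E x y = 0" unfolding weq_def by (simp add: algebra_simps power2_eq_square)
  then show thesis using that assms(2) by (auto simp: flexes_def)
qed

lemma torsion_resolvents_exist:
  fixes \<alpha>1 \<alpha>2 \<alpha>3 \<alpha>4 \<beta> \<zeta> :: "'a::field"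
  assumes ac: "alg_closed_type TYPE('a)" and K: "is_subfield K" "coeffs_in K E" and L: "L = torsion_field K E 3"
    and 3: "(3::'a) \<noteq> 0" and g: "g_poly E = smult 3 ([:- \<alpha>1, 1:] * [:- \<alpha>2, 1:] * [:- \<alpha>3, 1:] * [:- \<alpha>4, 1:])"
    and d: "\<delta> = b4 E - 3 * (\<alpha>1 * \<alpha>2 + \<alpha>3 * \<alpha>4)" "\<delta> ^ 3 = disc E" "disc E \<noteq> 0"
    and \<beta>: "weq E \<alpha>1 \<beta> = 0" and zeta: "\<zeta> ^ 3 = 1" "\<zeta> \<noteq> 1"
  obtains y where "torsion_resolvents E (\<alpha>1, \<beta>) (\<alpha>2, y) K L \<zeta>"
    "torsion_galois.dd E \<alpha>1 \<alpha>2 (fst (flex_basis.C1 E (\<alpha>1, \<beta>) (\<alpha>2, y))) (fst (flex_basis.C2 E (\<alpha>1, \<beta>) (\<alpha>2, y))) = \<delta>"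
proof -
  have dist: "distinct [\<alpha>1, \<alpha>2, \<alpha>3, \<alpha>4]" using roots_distinct[OF 3 g] d by simp
  have nz: "psi2_nonzero E" by (rule psi2_nonzero_if_roots_distinct[OF 3 g dist])
  have root: "poly (g_poly E) x = 0 \<longleftrightarrow> x \<in> {\<alpha>1, \<alpha>2, \<alpha>3, \<alpha>4}" for x by (rule roots_of_split[OF 3 g])
  obtain y where y: "(\<alpha>2, y) \<in> flexes E" using exists_flex_over[OF ac, of E \<alpha>2] root by auto
  have P: "(\<alpha>1, \<beta>) \<in> flexes E" using \<beta> root by (simp add: flexes_def)
  interpret torsion_galois E "(\<alpha>1, \<beta>)" "(\<alpha>2, y)" K L
    by unfold_locales (use 3 nz P y dist ac K L in simp_all)
  \<comment> \<open>Which of the points \<open>C1\<close>, \<open>C2\<close> lies over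
    \<open>\<alpha>3\<close> depends on the choice of \<open>y\<close>, but the resolvent is
    symmetric in the two.\<close>
  have "fst C1 \<in> {\<alpha>1, \<alpha>2, \<alpha>3, \<alpha>4}" "fst C2 \<in> {\<alpha>1, \<alpha>2, \<alpha>3, \<alpha>4}"
    unfolding root[symmetric] using C1(1) C2(1) by (simp_all add: flexes_def split_beta)
  then have C: "fst C1 = \<alpha>3 \<and> fst C2 = \<alpha>4 \<or> fst C1 = \<alpha>4 \<and> fst C2 = \<alpha>3"
    using x_ne unfolding fst_conv insert_iff empty_iff by metis
  have 1: "dd \<alpha>1 \<alpha>2 (fst C1) (fst C2) = \<delta>" using C d(1) by (auto simp: dd_def ac_simps)
  have nz: "b4 E - 3 * (\<alpha>1 * \<alpha>2 + fst C1 * fst C2) \<noteq> 0" "b4 E - 3 * (\<alpha>1 * \<alpha>2 + fst C2 * fst C1) \<noteq> 0"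
    using 1 d(2,3) by (auto simp: dd_def ac_simps)
  have g': "g_poly E = smult 3 ([:- \<alpha>1, 1:] * [:- \<alpha>2, 1:] * [:- fst C1, 1:] * [:- fst C2, 1:])"
    "g_poly E = smult 3 ([:- \<alpha>1, 1:] * [:- \<alpha>2, 1:] * [:- fst C2, 1:] * [:- fst C1, 1:])"
    using C unfolding g by (auto simp only: ac_simps)
  have "torsion_resolvents E (\<alpha>1, \<beta>) (\<alpha>2, y) K L \<zeta>"
    using 1 d(2,3) zeta resolvents(1)[OF 3 g'(1) nz(1)] resolvents(1)[OF 3 g'(2) nz(2)]
    by unfold_locales (auto simp: dd_def ac_simps)
  then show thesis using 1 that by blast
qed

context torsion_resolvents
begin

lemma adjoin_ne_iff:
  assumes "is_subfield F"
  shows "adjoin F {sm, pr} \<noteq> F \<longleftrightarrow> \<not> (sm \<in> F \<and> pr \<in> F)"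
  by (simp add: adjoin_subset_eq[OF assms])

lemma adjoin_eqs:
  "adjoin K {\<zeta>, sm, pr} = adjoin (adjoin K {\<zeta>}) {sm, pr}"
  "adjoin (adjoin K {D1}) {\<zeta>} = adjoin K {D1, \<zeta>}"
  "adjoin (adjoin K {D1}) {\<zeta>, sm, pr} = adjoin (adjoin K {D1, \<zeta>}) {sm, pr}"
  using adjoin_insert[of K \<zeta> "{sm, pr}"] adjoin_insert[of K D1 "{\<zeta>}"]
    adjoin_insert[of "adjoin K {D1}" \<zeta> "{sm, pr}"] by simp_all

lemma G_isoI: "quad_monoid R \<cong> H \<Longrightarrow> G \<cong> H"
  using G_iso by (rule iso_trans)

context
  assumes unique: "\<forall>(x, y)\<in>flexes E. x \<in> K \<longrightarrow> y \<in> K \<longrightarrow> (\<forall>x'\<in>K. poly (g_poly E) x' = 0 \<longrightarrow> x' = x)"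
begin

lemmas red = reduction_condition[OF unique]

lemma case_1:
  assumes "\<zeta> \<in> K" "D1 \<in> K"
  shows "fst P \<in> K \<Longrightarrow> G \<cong> integer_mod_group 2"
    "fst P \<notin> K \<Longrightarrow> sm \<in> K \<Longrightarrow> pr \<in> K \<Longrightarrow> G \<cong> integer_mod_group 4"
    "adjoin K {sm, pr} \<noteq> K \<Longrightarrow> fst P \<in> adjoin K {sm, pr} \<Longrightarrow> G \<cong> integer_mod_group 4"
    "adjoin K {sm, pr} \<noteq> K \<Longrightarrow> fst P \<notin> adjoin K {sm, pr} \<Longrightarrow> G \<cong> quaternion_group"
proof -
  have R: "qdet A = 1 \<and> fixes_partition A" if "A \<in> R" for A
    using assms that unfolding mem_K by blast
  show "G \<cong> integer_mod_group 2" if "fst P \<in> K"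
  proof (rule G_isoI[OF C2_case])
    show "R \<noteq> {qI}" by (rule trivial_impossible) (rule red)
    show "qdet A = 1 \<and> fixes_partition A \<and> fixes_line A" if "A \<in> R" for A
      using R that \<open>fst P \<in> K\<close> unfolding mem_K by blast
  qed
  show "G \<cong> integer_mod_group 4" if h: "fst P \<notin> K" "sm \<in> K" "pr \<in> K"
  proof -
    obtain B where B: "B \<in> R" "\<not> fixes_line B" using h(1) unfolding mem_K by blast
    have "\<forall>A\<in>R. fixes_axes A" using h(2,3) mem_K(6) by blast
    then show ?thesis by (intro G_isoI[OF C4_case_axes[OF _ B]]) (use R in blast)
  qed
  assume "adjoin K {sm, pr} \<noteq> K"
  then obtain B where B: "B \<in> R" "\<not> fixes_axes B"
    unfolding adjoin_ne_iff[OF K] mem_K by blast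
  show "G \<cong> integer_mod_group 4" if "fst P \<in> adjoin K {sm, pr}"
    by (rule G_isoI[OF C4_case_diagonal[OF R B]]) (use that mem_adjoin_sum_prod in blast)+
  show "G \<cong> quaternion_group" if "fst P \<notin> adjoin K {sm, pr}"
  proof -
    obtain A where "A \<in> R" "fixes_axes A" "\<not> fixes_line A" using \<open>fst P \<notin> _\<close> unfolding mem_adjoin_sum_prod by blast
    then show ?thesis by (intro G_isoI[OF Q8_case[OF R B]])
  qed
qed

lemma case_3:
  assumes "\<zeta> \<notin> K" "D1 \<in> K"
  shows "fst P \<in> adjoin K {\<zeta>} \<Longrightarrow> G \<cong> integer_mod_group 2 \<times>\<times> integer_mod_group 2"
    "sm \<in> adjoin K {\<zeta>} \<Longrightarrow> pr \<in> adjoin K {\<zeta>} \<Longrightarrow> adjoin K {sm, pr} \<noteq> K \<Longrightarrow> G \<cong> integer_mod_group 8"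
    "fst P \<notin> adjoin K {\<zeta>} \<Longrightarrow> sm \<in> K \<Longrightarrow> pr \<in> K \<Longrightarrow> G \<cong> dihedral_group 4"
    "adjoin K {\<zeta>, sm, pr} \<noteq> adjoin K {\<zeta>} \<Longrightarrow> fst P \<in> adjoin K {\<zeta>, sm, pr} \<Longrightarrow> G \<cong> dihedral_group 4"
    "adjoin K {\<zeta>, sm, pr} \<noteq> adjoin K {\<zeta>} \<Longrightarrow> fst P \<notin> adjoin K {\<zeta>} \<and> G \<cong> semidihedral_group 4"
proof -
  have par: "fixes_partition A" if "A \<in> R" for A
    using assms(2) that unfolding mem_K by blast
  obtain T where T: "T \<in> R" "qdet T \<noteq> 1" using assms(1) unfolding mem_K by blast
  show "G \<cong> integer_mod_group 2 \<times>\<times> integer_mod_group 2" if "fst P \<in> adjoin K {\<zeta>}"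
  proof -
    have N: "fixes_line A" if "A \<in> R" "qdet A = 1" for A
      using that \<open>fst P \<in> _\<close> unfolding mem_adjoin_zeta by blast
    have "qM \<in> R" by (rule minus_one_mem[OF par N T red])
    with par N T show ?thesis by (intro G_isoI[OF C2xC2_case])
  qed
  show "G \<cong> integer_mod_group 8" if h: "sm \<in> adjoin K {\<zeta>}" "pr \<in> adjoin K {\<zeta>}" "adjoin K {sm, pr} \<noteq> K"
  proof -
    obtain B where B: "B \<in> R" "\<not> fixes_axes B"
      using h(3) unfolding adjoin_ne_iff[OF K] mem_K by blast
    have "fixes_axes A" if "A \<in> R" "qdet A = 1" for A
      using that h(1,2) mem_adjoin_zeta(2) by blast
    then show ?thesis using par B by (intro G_isoI[OF C8_case])
  qed
  show "G \<cong> dihedral_group 4" if h: "fst P \<notin> adjoin K {\<zeta>}" "sm \<in> K" "pr \<in> K"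
  proof -
    obtain A where A: "A \<in> R" "qdet A = 1" "\<not> fixes_line A" using h(1) unfolding mem_adjoin_zeta by blast
    have "fixes_axes A" if "A \<in> R" for A using that h(2,3) mem_K(6) by blast
    then show ?thesis using par T A by (intro G_isoI[OF D4_case])
  qed
  assume "adjoin K {\<zeta>, sm, pr} \<noteq> adjoin K {\<zeta>}"
  then have "\<not> (sm \<in> adjoin K {\<zeta>} \<and> pr \<in> adjoin K {\<zeta>})"
    unfolding adjoin_eqs adjoin_ne_iff[OF adjoin_is_subfield] .
  then obtain C where C: "C \<in> R" "qdet C = 1" "\<not> fixes_axes C"
    unfolding mem_adjoin_zeta by blast
  note SD = SD16_case[OF par T C]
  \<comment> \<open>This element of \<open>R\<close> fixes \<open>\<zeta>\<close>, \<open>sm\<close> and \<open>pr\<close> but not \<open>fst P\<close>, so the hypotheses of the fourth claim,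
    case (3)(d), contradict each other.\<close>
  have m: "qdet (Quad 0 2 1 0) = 1 \<and> fixes_axes (Quad 0 2 1 0) \<and> \<not> fixes_line (Quad 0 2 1 0)" by simp
  have "fst P \<notin> adjoin K {\<zeta>, sm, pr}" "fst P \<notin> adjoin K {\<zeta>}"
    unfolding mem_adjoin_zeta using SD(2) m by blast+
  then show "fst P \<in> adjoin K {\<zeta>, sm, pr} \<Longrightarrow> G \<cong> dihedral_group 4"
    "fst P \<notin> adjoin K {\<zeta>} \<and> G \<cong> semidihedral_group 4"
    using G_isoI[OF SD(1)] by blast+
qed

end

lemma case_2:
  assumes "\<zeta> \<in> K" "D1 \<notin> K"
  shows "fst P \<in> adjoin K {D1} \<Longrightarrow> snd P \<in> adjoin K {D1} \<Longrightarrow> G \<cong> integer_mod_group 3"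
    "fst P \<in> adjoin K {D1} \<Longrightarrow> snd P \<notin> adjoin K {D1} \<Longrightarrow> G \<cong> integer_mod_group 6"
    "adjoin (adjoin K {D1}) {sm, pr} \<noteq> adjoin K {D1} \<Longrightarrow> G \<cong> SL2_F3"
proof -
  have det1: "qdet A = 1" if "A \<in> R" for A
    using assms(1) that unfolding mem_K by blast
  obtain B where B: "B \<in> R" "\<not> fixes_partition B" using assms(2) unfolding mem_K by blast
  show "G \<cong> integer_mod_group 3" if h: "fst P \<in> adjoin K {D1}" "snd P \<in> adjoin K {D1}"
    by (rule G_isoI[OF C3_case[OF det1 B]]) (use h mem_adjoin_resolvent(2) in blast)+
  show "G \<cong> integer_mod_group 6" if h: "fst P \<in> adjoin K {D1}" "snd P \<notin> adjoin K {D1}"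
  proof -
    obtain C where "C \<in> R" "fixes_partition C" "\<not> fixes_vector C"
      using h mem_adjoin_resolvent(2) by blast
    moreover have "fixes_line A" if "A \<in> R" "fixes_partition A" for A
      using that h(1) mem_adjoin_resolvent(1) by blast
    ultimately show ?thesis using det1 B by (intro G_isoI[OF C6_case])
  qed
  show "G \<cong> SL2_F3" if "adjoin (adjoin K {D1}) {sm, pr} \<noteq> adjoin K {D1}"
  proof -
    obtain C where C: "C \<in> R" "fixes_partition C" "\<not> fixes_axes C"
      using \<open>adjoin (adjoin K {D1}) {sm, pr} \<noteq> adjoin K {D1}\<close>
      unfolding adjoin_ne_iff[OF adjoin_is_subfield] mem_adjoin_resolvent by blast
    have "R = {A. qdet A = 1}"
      using SL2_subset[OF B(1) det1[OF B(1)] B(2) C(1) det1[OF C(1)] C(2,3)] det1 by blast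
    then show ?thesis using G_isoI SL2_iso by simp
  qed
qed

text \<open>If one of the three resolvents were rational, \<open>R\<close> would contain no
  three-cycle of the partitions. Excluding all three therefore yields an element of determinant 1
  that moves the standard partition.\<close>

lemma case_4:
  assumes "\<zeta> \<notin> K" "D1 \<notin> K" "D2 \<notin> K" "D3 \<notin> K"
  defines "F \<equiv> adjoin (adjoin K {D1}) {\<zeta>}"
  shows "fst P \<in> F \<Longrightarrow> snd P \<in> F \<Longrightarrow> G \<cong> dihedral_group 3"
    "fst P \<in> F \<Longrightarrow> snd P \<notin> F \<Longrightarrow> G \<cong> dihedral_group 6"
    "adjoin (adjoin K {D1}) {\<zeta>, sm, pr} \<noteq> F \<Longrightarrow> fst P \<notin> F \<and> G \<cong> GL2_F3"
proof -
  have F: "F = adjoin K {D1, \<zeta>}" unfolding F_def by (rule adjoin_eqs(2))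
  obtain T where T: "T \<in> R" "qdet T \<noteq> 1" using assms(1) unfolding mem_K by blast
  have "\<exists>A\<in>R. qdet A = 1 \<and> \<not> fixes_partition A"
    by (rule three_cycle_exists) (use assms(2-4) mem_K in blast)+
  then obtain C where C: "C \<in> R" "qdet C = 1" "\<not> fixes_partition C" by blast
  show "G \<cong> dihedral_group 3" if h: "fst P \<in> F" "snd P \<in> F"
    by (rule G_isoI[OF D3_case[OF C T]]) (use h[unfolded F] mem_adjoin_resolvent_zeta(2) in blast)
  show "G \<cong> dihedral_group 6" if h: "fst P \<in> F" "snd P \<notin> F"
  proof -
    obtain B where B: "B \<in> R" "qdet B = 1" "fixes_partition B" "\<not> fixes_vector B"
      using h[unfolded F] mem_adjoin_resolvent_zeta(2) by blast
    have N: "fixes_line A" if "A \<in> R" "qdet A = 1" "fixes_partition A" for A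
      using that h(1)[unfolded F] mem_adjoin_resolvent_zeta(1) by blast
    show ?thesis by (rule G_isoI[OF D6_case[OF C T N B]])
  qed
  assume "adjoin (adjoin K {D1}) {\<zeta>, sm, pr} \<noteq> F"
  then obtain A where A: "A \<in> R" "qdet A = 1" "fixes_partition A" "\<not> fixes_axes A"
    unfolding adjoin_eqs(3) F adjoin_ne_iff[OF adjoin_is_subfield] mem_adjoin_resolvent_zeta by blast
  have R: "R = {A. qdet A \<noteq> 0}" by (rule GL2_subset[OF C A T])
  \<comment> \<open>This matrix exchanges the two axes, so it moves \<open>fst P\<close> while it
    fixes \<open>D1\<close> and \<open>\<zeta>\<close>.\<close>
  have m: "qdet (Quad 0 2 1 0) = 1 \<and> fixes_partition (Quad 0 2 1 0) \<and> \<not> fixes_line (Quad 0 2 1 0)" by simp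
  have "Quad 0 2 1 0 \<in> R" unfolding R by simp
  then have "fst P \<notin> F" unfolding F mem_adjoin_resolvent_zeta using m by blast
  then show "fst P \<notin> F \<and> G \<cong> GL2_F3" using G_isoI GL2_iso R by simp
qed

end

theorem theorem3p8:
  fixes K :: "'a::field set" and v :: "'a \<Rightarrow> int"
    and E :: "'a weierstrass"
    and \<alpha>1 \<alpha>2 \<alpha>3 \<alpha>4 \<alpha> \<beta> \<delta> \<zeta>3 s t :: 'a
    and K1 L :: "'a set" and G :: "('a \<Rightarrow> 'a) monoid"
  assumes closure: "algebraic_closure (ambient :: 'a ring) K"
    and local_field: "nonarch_local_field K v"
    and residue_char: "residue_char K v \<noteq> 3"
    and elliptic: "elliptic_curve K E"
    and minimal: "minimal_weierstrass K v E"
    and additive: "additive_reduction K v E"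
    and potentially_good: "potentially_good_reduction K v E"
    and L: "L = torsion_field K E 3"
    and G: "G = galois_group K L"
    and roots: "g_poly E = smult 3 ([:- \<alpha>1, 1:] * [:- \<alpha>2, 1:] * [:- \<alpha>3, 1:] * [:- \<alpha>4, 1:])"
    and delta_cube: "\<delta> ^ 3 = disc E"
    and delta_rational: "(\<exists>d \<in> K - {0}. d ^ 3 = disc E) \<longrightarrow> \<delta> \<in> K"
    and delta_roots: "\<delta> = b4 E - 3 * (\<alpha>1 * \<alpha>2 + \<alpha>3 * \<alpha>4)"
    and K1: "K1 = adjoin K {\<delta>}"
    and s: "s = \<alpha>1 + \<alpha>2"
    and t: "t = \<alpha>1 * \<alpha>2"
    and alpha: "\<alpha> = \<alpha>1"
    and beta: "\<beta>^2 + a1 E * \<alpha> * \<beta> + a3 E * \<beta> = \<alpha>^3 + a2 E * \<alpha>^2 + a4 E * \<alpha> + a6 E"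
    and zeta: "\<zeta>3 ^ 3 = 1" "\<zeta>3 \<noteq> 1"
  shows
    "(\<zeta>3 \<in> K \<and> \<delta> \<in> K \<longrightarrow>
        (\<alpha> \<in> K \<longrightarrow> G \<cong> integer_mod_group 2) \<and>
        (\<alpha> \<notin> K \<and> s \<in> K \<and> t \<in> K \<longrightarrow> G \<cong> integer_mod_group 4) \<and>
        (adjoin K {s, t} \<noteq> K \<and> \<alpha> \<in> adjoin K {s, t} \<longrightarrow> G \<cong> integer_mod_group 4) \<and>
        (adjoin K {s, t} \<noteq> K \<and> \<alpha> \<notin> adjoin K {s, t} \<longrightarrow> G \<cong> quaternion_group)) \<and>
     (\<zeta>3 \<in> K \<and> \<delta> \<notin> K \<longrightarrow>
        (\<alpha> \<in> K1 \<and> \<beta> \<in> K1 \<longrightarrow> G \<cong> integer_mod_group 3) \<and>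
        (\<alpha> \<in> K1 \<and> \<beta> \<notin> K1 \<longrightarrow> G \<cong> integer_mod_group 6) \<and>
        (adjoin K1 {s, t} \<noteq> K1 \<longrightarrow> G \<cong> SL2_F3)) \<and>
     (\<zeta>3 \<notin> K \<and> \<delta> \<in> K \<longrightarrow>
        (\<alpha> \<in> adjoin K {\<zeta>3} \<longrightarrow> G \<cong> integer_mod_group 2 \<times>\<times> integer_mod_group 2) \<and>
        (\<alpha> \<notin> adjoin K {\<zeta>3} \<and> s \<in> adjoin K {\<zeta>3} \<and> t \<in> adjoin K {\<zeta>3} \<and> adjoin K {s, t} \<noteq> K
           \<longrightarrow> G \<cong> integer_mod_group 8) \<and>
        (\<alpha> \<notin> adjoin K {\<zeta>3} \<and> s \<in> K \<and> t \<in> K \<longrightarrow> G \<cong> dihedral_group 4) \<and>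
        (adjoin K {\<zeta>3, s, t} \<noteq> adjoin K {\<zeta>3} \<and> \<alpha> \<in> adjoin K {\<zeta>3, s, t}
           \<longrightarrow> G \<cong> dihedral_group 4) \<and>
        (adjoin K {\<zeta>3, s, t} \<noteq> adjoin K {\<zeta>3}
           \<longrightarrow> \<alpha> \<notin> adjoin K {\<zeta>3} \<and> G \<cong> semidihedral_group 4)) \<and>
     (\<zeta>3 \<notin> K \<and> \<delta> \<notin> K \<longrightarrow>
        (\<alpha> \<in> adjoin K1 {\<zeta>3} \<and> \<beta> \<in> adjoin K1 {\<zeta>3} \<longrightarrow> G \<cong> dihedral_group 3) \<and>
        (\<alpha> \<in> adjoin K1 {\<zeta>3} \<and> \<beta> \<notin> adjoin K1 {\<zeta>3} \<longrightarrow> G \<cong> dihedral_group 6) \<and>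
        (adjoin K1 {\<zeta>3, s, t} \<noteq> adjoin K1 {\<zeta>3}
           \<longrightarrow> \<alpha> \<notin> adjoin K1 {\<zeta>3} \<and> G \<cong> GL2_F3))"
proof -
  have ac: "alg_closed_type TYPE('a)" by (rule alg_closed_type_if_algebraic_closure[OF closure])
  have K: "is_subfield K" using local_field by (auto simp: nonarch_local_field_def intro: is_subfield_if_subfield)
  have E: "coeffs_in K E" "disc E \<noteq> 0" using elliptic by (simp_all add: elliptic_curve_def)
  have b: "weq E \<alpha>1 \<beta> = 0" using beta by (simp add: weq_def alpha)
  note 3 = three_nonzero[OF local_field residue_char]
  obtain y where TR: "torsion_resolvents E (\<alpha>1, \<beta>) (\<alpha>2, y) K L \<zeta>3" and
    D: "torsion_galois.dd E \<alpha>1 \<alpha>2 (fst (flex_basis.C1 E (\<alpha>1, \<beta>) (\<alpha>2, y)))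
      (fst (flex_basis.C2 E (\<alpha>1, \<beta>) (\<alpha>2, y))) = \<delta>"
    by (rule torsion_resolvents_exist[OF ac K E(1) L 3 roots delta_roots delta_cube E(2) b zeta])
  interpret T: torsion_resolvents E "(\<alpha>1, \<beta>)" "(\<alpha>2, y)" K L \<zeta>3 by (rule TR)
  have unique: "\<forall>(x, y)\<in>flexes E. x \<in> K \<longrightarrow> y \<in> K \<longrightarrow> (\<forall>x'\<in>K. poly (g_poly E) x' = 0 \<longrightarrow> x' = x)"
    using additive_unique_rational_flex[OF local_field residue_char additive E(2)] flex_not_two_torsion[OF T.nz]
    by blast
  \<comment> \<open>By the choice of \<open>\<delta>\<close>, any cube root of the discriminant in
    \<open>K\<close> would make \<open>\<delta>\<close> rational; applied to the other two
    resolvents this supplies the hypotheses of \<open>case_4\<close>.\<close>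
  have rational: "x \<notin> K" if "\<delta> \<notin> K" "x ^ 3 = \<delta> ^ 3" for x
    using that delta_rational delta_cube E(2) by auto
  note eqs = fst_conv snd_conv D
  have D23: "T.D2 \<notin> K" "T.D3 \<notin> K" if "\<delta> \<notin> K"
    using rational[OF that] T.D_cube unfolding eqs by blast+
  note 1 = T.case_1[OF unique, unfolded eqs] and 2 = T.case_2[unfolded eqs]
    and 3 = T.case_3[OF unique, unfolded eqs] and 4 = T.case_4[unfolded eqs] D23[unfolded eqs]
  show ?thesis
    unfolding K1 s t alpha G
    by (intro conjI impI) (use 1 in blast | use 2 in blast | use 3 in blast | use 4 in blast)+
qed


end
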